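(* Let $L$ be a pseudo-Finsler metric defined on $A\subseteq\mathrm{T}M$ with metric nonlinear connection $\mathrm{H}A$ and Chern anisotropic connection $\nabla$. Let $S\in\mathcal{T}^0_2(M_A)$ be symmetric, $v\in A$, $T\in\mathcal{T}^1_1(M_A)$ and $X\in\mathfrak{X}(M_A)$. (A) The following are equivalent: (Ai) $S_v(-,\nabla^v_{-}X)$ is antisymmetric; (Aii) $\nabla^vX$ is anti-self-adjoint with respect to $S_v$, that is, $S_v(\nabla^v_{-}X,-)=-S_v(-,\nabla^v_{-}X)$ (i.e. $S_v(\nabla^v_yX,w)=-S_v(y,\nabla^v_wX)$ for all $y,w\in\mathrm{T}_{\pi(v)}M$); (Aiii) $(\mathfrak{l}^{\mathrm{H}}_XS)_v=\nabla^v_XS$. (B) One has $$\mathrm{div}(T(X))-\mathrm{trace}(T(\nabla X))=\mathbf{C}^1_2(\nabla T)(X),$$ where $\mathbf{C}^1_2$ is the operator that contracts the contravariant index with the covariant one introduced by $\nabla$. (C) One has $\mathrm{trace}(T(\nabla X))(v)=0$ assuming any of the following conditions: (Ci) $T^\flat_v(-,\nabla^v_{-}X)$ is antisymmetric; (Cii) $T^\flat_v$ is symmetric and $(\mathfrak{l}^{\mathrm{H}}_Xg)_v=0$.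
   Context: $M$ is a connected oriented smooth manifold of dimension $n\ge2$, $\pi\colon\mathrm{T}M\to M$ is the projection, and $A\subseteq\mathrm{T}M\setminus\mathbf{0}$ is open with $\pi(A)=M$ and conic ($\lambda v\in A$ for $v\in A$, $\lambda>0$). Coordinates $x^i$ on $M$ induce coordinates $(x^i,y^i)$ on $\mathrm{T}M$; $\partial_i=\partial/\partial x^i$, $\dot\partial_i=\partial/\partial y^i$. An anisotropic tensor field $T\in\mathcal{T}^r_s(M_A)$ assigns smoothly to each $v\in A$ an $r$-contravariant $s$-covariant tensor $T_v$ on $\mathrm{T}_{\pi(v)}M$; $\mathfrak{X}(M_A)=\mathcal{T}^1_0(M_A)$, and $\Omega_s(M_A)$ denotes the alternating elements of $\mathcal{T}^0_s(M_A)$. A pseudo-Finsler metric on $A$ is a smooth positively $2$-homogeneous function $L\colon A\to\mathbb{R}$ whose fundamental tensor $g_{ij}=\frac12\dot\partial_i\dot\partial_jL$ is nondegenerate at each $v\in A$. Its Cartan tensor is $C_{ijk}=\frac12\dot\partial_kg_{ij}$ (indices raised with $g$). The metric nonlinear connection $\mathrm{H}A$ of $L$ is the horizontal subbundle of $\mathrm{T}A$ spanned by $\delta_i=\frac{\delta}{\delta x^i}=\partial_i-N^j_i\dot\partial_j$ with $N^i_j=\gamma^i_{jk}y^k-C^i_{jk}\gamma^k_{ab}y^ay^b$, $\gamma^i_{jk}=\frac12g^{ic}(\partial_kg_{cj}+\partial_jg_{ck}-\partial_cg_{jk})$. The metric volume form is $d\mathrm{Vol}=\sqrt{|\det g_{ab}(x,y)|}\,dx^1\wedge\dots\wedge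 dx^n\in\Omega_n(M_A)$ in positively oriented coordinates. The Chern anisotropic connection $\nabla$ of $L$ has Christoffel symbols $\Gamma^i_{jk}=\frac12 g^{il}(\delta_kg_{lj}+\delta_jg_{lk}-\delta_lg_{jk})$ and acts on anisotropic tensors by $\nabla_{k}T^{i_1\dots i_r}_{j_1\dots j_s}=\delta_{k}T^{i_1\dots i_r}_{j_1\dots j_s}+\sum_\mu\Gamma^{i_\mu}_{kl}T^{i_1\dots l\dots i_r}_{j_1\dots j_s}-\sum_\nu\Gamma^l_{kj_\nu}T^{i_1\dots i_r}_{j_1\dots l\dots j_s}$. A superscript $v$ denotes evaluation at $v$: $\nabla^v_wX=(\nabla_wX)_v$, $\nabla^v_XS=(\nabla_XS)_v$. The anisotropic Lie bracket with $Z\in\mathfrak{X}(M_A)$, $\mathfrak{l}^{\mathrm{H}}_Z$, is the unique tensor derivation of anisotropic tensors ($\mathbb{R}$-linear, type-preserving, Leibniz for tensor products, commuting with contractions) with $\mathfrak{l}^{\mathrm{H}}_Zf=Z^k\delta_kf$ for smooth functions $f$ on $A$ and $\mathfrak{l}^{\mathrm{H}}_ZX=(Z^j\delta_jX^i-X^j\delta_jZ^i)\partial_i$ for $X\in\mathfrak{X}(M_A)$. The divergence of $Z\in\mathfrak{X}(M_A)$ is the function $\mathrm{div}(Z)$ on $A$ with $\mathfrak{l}^{\mathrm{H}}_Z(d\mathrm{Vol})=\mathrm{div}(Z)\,d\mathrm{Vol}$. $T\in\mathcal{T}^1_1(M_A)$ is regarded as an endomorphism of anisotropic vector fields, $T(X)^i=T^i_jX^j$,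 and $T^\flat\in\mathcal{T}^0_2(M_A)$ is $T^\flat(X,Y):=g(X,T(Y))$. $\mathrm{trace}(T(\nabla X))=T^i_j\nabla_iX^j$ is the trace of $Y\mapsto T(\nabla_YX)$, and $\mathbf{C}^1_2(\nabla T)_j=\nabla_iT^i_j$. *)

theory Defs
  imports "HOL-Analysis.Analysis"
begin

section \<open>Smooth maps and oriented atlases\<close>

primrec Ck_on :: "nat \<Rightarrow> 'a::real_normed_vector set \<Rightarrow> ('a \<Rightarrow> 'b::real_normed_vector) \<Rightarrow> bool" where
  "Ck_on 0 S f \<longleftrightarrow> continuous_on S f"
| "Ck_on (Suc k) S f \<longleftrightarrow>
     (\<forall>x\<in>S. f differentiable (at x)) \<and> (\<forall>h. Ck_on k S (\<lambda>x. frechet_derivative f (at x) h))"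

text \<open>Only used for open \<open>S\<close>.\<close>
definition smooth_on :: "'a::real_normed_vector set \<Rightarrow> ('a \<Rightarrow> 'b::real_normed_vector) \<Rightarrow> bool" where
  "smooth_on S f \<longleftrightarrow> (\<forall>k. Ck_on k S f)"

text \<open>The points of the manifold are the elements of the type \<open>'m\<close>. A chart is its domain together
  with its coordinate map, whose values off the domain are irrelevant.\<close>
type_synonym ('m, 'n) chart = "'m set \<times> ('m \<Rightarrow> real^'n)"

abbreviation dom_of :: "('m, 'n::finite) chart \<Rightarrow> 'm set" where "dom_of c \<equiv> fst c"
abbreviation map_of_chart :: "('m, 'n::finite) chart \<Rightarrow> 'm \<Rightarrow> real^'n" where "map_of_chart c \<equiv> snd c"

definition chart_inv :: "('m, 'n::finite) chart \<Rightarrow> real^'n \<Rightarrow> 'm" where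
  "chart_inv c = inv_into (dom_of c) (map_of_chart c)"

definition transition :: "('m, 'n::finite) chart \<Rightarrow> ('m, 'n) chart \<Rightarrow> real^'n \<Rightarrow> real^'n" where
  "transition c c' = map_of_chart c' \<circ> chart_inv c"

text \<open>The entry \<open>i\<close>, \<open>k\<close> is the partial derivative at \<open>p\<close> of the \<open>i\<close>-th coordinate of \<open>c'\<close>
  with respect to the \<open>k\<close>-th coordinate of \<open>c\<close>.\<close>
definition jac :: "('m, 'n::finite) chart \<Rightarrow> ('m, 'n) chart \<Rightarrow> 'm \<Rightarrow> real^'n^'n" where
  "jac c c' p = matrix (frechet_derivative (transition c c') (at (map_of_chart c p)))"

text \<open>An oriented smooth structure is given by an atlas of (positively oriented) charts; the atlas
  need not be maximal.\<close>
definition oriented_atlas :: "('m::topological_space, 'n::finite) chart set \<Rightarrow> bool" where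
  "oriented_atlas M \<longleftrightarrow>
     (\<Union>c\<in>M. dom_of c) = UNIV \<and>
     (\<forall>c\<in>M. open (dom_of c) \<and> open (map_of_chart c ` dom_of c) \<and>
        homeomorphism (dom_of c) (map_of_chart c ` dom_of c) (map_of_chart c) (chart_inv c)) \<and>
     (\<forall>c\<in>M. \<forall>c'\<in>M.
        smooth_on (map_of_chart c ` (dom_of c \<inter> dom_of c')) (transition c c') \<and>
        (\<forall>p\<in>dom_of c \<inter> dom_of c'. det (jac c c' p) > 0))"

definition charts_at :: "('m, 'n::finite) chart set \<Rightarrow> 'm \<Rightarrow> ('m, 'n) chart set" where
  "charts_at M p = {c\<in>M. p \<in> dom_of c}"


section \<open>The tangent bundle\<close>

text \<open>A tangent vector at \<open>p\<close> is the family of its component vectors in all charts around \<open>p\<close>,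
  related by the Jacobian matrices; by convention the family vanishes on all other charts.\<close>
type_synonym ('m, 'n) tvec = "('m, 'n) chart \<Rightarrow> real^'n"
type_synonym ('m, 'n) tbundle = "'m \<times> ('m, 'n) tvec"

definition tangent_space :: "('m, 'n::finite) chart set \<Rightarrow> 'm \<Rightarrow> ('m, 'n) tvec set" where
  "tangent_space M p = {y. (\<forall>c\<in>charts_at M p. \<forall>c'\<in>charts_at M p. y c' = jac c c' p *v y c) \<and>
     (\<forall>c. c \<notin> charts_at M p \<longrightarrow> y c = 0)}"

text \<open>The coordinates \<open>(x, y)\<close> induced by a chart on the tangent bundle, and their inverse.\<close>
definition tcoord :: "('m, 'n::finite) chart \<Rightarrow> ('m, 'n) tbundle \<Rightarrow> (real^'n) \<times> (real^'n)" where
  "tcoord c v = (map_of_chart c (fst v), snd v c)"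

definition tcoord_inv ::
  "('m, 'n::finite) chart set \<Rightarrow> ('m, 'n) chart \<Rightarrow> (real^'n) \<times> (real^'n) \<Rightarrow> ('m, 'n) tbundle" where
  "tcoord_inv M c z = (let p = chart_inv c (fst z) in
     (p, \<lambda>c'. if c' \<in> charts_at M p then jac c c' p *v snd z else 0))"

definition coord_image :: "('m, 'n::finite) tbundle set \<Rightarrow> ('m, 'n) chart \<Rightarrow> ((real^'n) \<times> (real^'n)) set" where
  "coord_image A c = tcoord c ` {v\<in>A. fst v \<in> dom_of c}"

text \<open>Openness of \<open>A\<close> in the tangent bundle is openness in all the induced coordinates.\<close>
definition conic_domain :: "('m, 'n::finite) chart set \<Rightarrow> ('m, 'n) tbundle set \<Rightarrow> bool" where
  "conic_domain M A \<longleftrightarrow>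
     (\<forall>v\<in>A. snd v \<in> tangent_space M (fst v) \<and> snd v \<noteq> (\<lambda>_. 0)) \<and>
     (\<forall>c\<in>M. open (coord_image A c)) \<and>
     fst ` A = UNIV \<and>
     (\<forall>v\<in>A. \<forall>t>0. (fst v, \<lambda>c. t *\<^sub>R snd v c) \<in> A)"

definition dx :: "('m, 'n::finite) chart set \<Rightarrow> ('m, 'n) chart \<Rightarrow> 'n \<Rightarrow>
    (('m, 'n) tbundle \<Rightarrow> real) \<Rightarrow> ('m, 'n) tbundle \<Rightarrow> real" where
  "dx M c i f v = frechet_derivative (f \<circ> tcoord_inv M c) (at (tcoord c v)) (axis i 1, 0)"

definition dy :: "('m, 'n::finite) chart set \<Rightarrow> ('m, 'n) chart \<Rightarrow> 'n \<Rightarrow>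
    (('m, 'n) tbundle \<Rightarrow> real) \<Rightarrow> ('m, 'n) tbundle \<Rightarrow> real" where
  "dy M c i f v = frechet_derivative (f \<circ> tcoord_inv M c) (at (tcoord c v)) (0, axis i 1)"


section \<open>Anisotropic tensor fields\<close>

text \<open>\<open>T v c I J\<close> is the component of the tensor \<open>T\<^sub>v\<close> in the chart \<open>c\<close> with list \<open>I\<close> of contravariant
  and list \<open>J\<close> of covariant indices. To make equality of fields plain equality, components are \<open>0\<close>
  when \<open>v \<notin> A\<close>, when \<open>c\<close> is not a chart around the base point of \<open>v\<close>, or when the index lists have the
  wrong lengths.\<close>
type_synonym ('m, 'n) tensor = "('m, 'n) tbundle \<Rightarrow> ('m, 'n) chart \<Rightarrow> 'n list \<Rightarrow> 'n list \<Rightarrow> real"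

definition tensor_fields ::
  "('m, 'n::finite) chart set \<Rightarrow> ('m, 'n) tbundle set \<Rightarrow> nat \<Rightarrow> nat \<Rightarrow> ('m, 'n) tensor set" where
  "tensor_fields M A r s = {T.
     (\<forall>v c I J. \<not> (v \<in> A \<and> c \<in> charts_at M (fst v) \<and> length I = r \<and> length J = s) \<longrightarrow> T v c I J = 0) \<and>
     (\<forall>v\<in>A. \<forall>c\<in>charts_at M (fst v). \<forall>c'\<in>charts_at M (fst v). \<forall>I J. length I = r \<longrightarrow> length J = s \<longrightarrow>
        T v c' I J = (\<Sum>K | length K = r. \<Sum>H | length H = s.
          (\<Prod>a<r. jac c c' (fst v) $ (I ! a) $ (K ! a)) *
          (\<Prod>b<s. jac c' c (fst v) $ (H ! b) $ (J ! b)) * T v c K H)) \<and>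
     (\<forall>c\<in>M. \<forall>I J. smooth_on (coord_image A c) (\<lambda>z. T (tcoord_inv M c z) c I J))}"

definition tensor_prod ::
  "nat \<Rightarrow> nat \<Rightarrow> ('m, 'n::finite) tensor \<Rightarrow> ('m, 'n) tensor \<Rightarrow> ('m, 'n) tensor" where
  "tensor_prod r s T U = (\<lambda>v c I J. T v c (take r I) (take s J) * U v c (drop r I) (drop s J))"

text \<open>Contraction of the contravariant slot \<open>a\<close> with the covariant slot \<open>b\<close>; slots are counted from \<open>0\<close>.\<close>
definition contract :: "nat \<Rightarrow> nat \<Rightarrow> ('m, 'n::finite) tensor \<Rightarrow> ('m, 'n) tensor" where
  "contract a b T = (\<lambda>v c I J. \<Sum>k\<in>UNIV. T v c (take a I @ k # drop a I) (take b J @ k # drop b J))"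

text \<open>One operator \<open>D\<close> serves all types at once, since fields of different types only share the
  zero field.\<close>
definition tensor_derivation :: "('m, 'n::finite) chart set \<Rightarrow> ('m, 'n) tbundle set \<Rightarrow>
    (('m, 'n) tensor \<Rightarrow> ('m, 'n) tensor) \<Rightarrow> bool" where
  "tensor_derivation M A D \<longleftrightarrow>
     (\<forall>r s. \<forall>T\<in>tensor_fields M A r s. D T \<in> tensor_fields M A r s) \<and>
     (\<forall>r s. \<forall>T\<in>tensor_fields M A r s. \<forall>U\<in>tensor_fields M A r s. \<forall>a b::real.
        D (\<lambda>v c I J. a * T v c I J + b * U v c I J) =
          (\<lambda>v c I J. a * D T v c I J + b * D U v c I J)) \<and>
     (\<forall>r s r' s'. \<forall>T\<in>tensor_fields M A r s. \<forall>U\<in>tensor_fields M A r' s'.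
        D (tensor_prod r s T U) =
          (\<lambda>v c I J. tensor_prod r s (D T) U v c I J + tensor_prod r s T (D U) v c I J)) \<and>
     (\<forall>r s. \<forall>T\<in>tensor_fields M A r s. \<forall>a<r. \<forall>b<s. D (contract a b T) = contract a b (D T))"


section \<open>Pseudo-Finsler metrics\<close>

definition gmat :: "('m, 'n::finite) chart set \<Rightarrow> (('m, 'n) tbundle \<Rightarrow> real) \<Rightarrow>
    ('m, 'n) chart \<Rightarrow> ('m, 'n) tbundle \<Rightarrow> real^'n^'n" where
  "gmat M L c v = (\<chi> i j. 1/2 * dy M c i (dy M c j L) v)"

definition pseudo_finsler :: "('m, 'n::finite) chart set \<Rightarrow> ('m, 'n) tbundle set \<Rightarrow>
    (('m, 'n) tbundle \<Rightarrow> real) \<Rightarrow> bool" where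
  "pseudo_finsler M A L \<longleftrightarrow>
     (\<forall>c\<in>M. smooth_on (coord_image A c) (L \<circ> tcoord_inv M c)) \<and>
     (\<forall>v\<in>A. \<forall>t>0. L (fst v, \<lambda>c. t *\<^sub>R snd v c) = t\<^sup>2 * L v) \<and>
     (\<forall>v\<in>A. \<forall>c\<in>charts_at M (fst v). invertible (gmat M L c v))"

definition ginv :: "('m, 'n::finite) chart set \<Rightarrow> (('m, 'n) tbundle \<Rightarrow> real) \<Rightarrow>
    ('m, 'n) chart \<Rightarrow> ('m, 'n) tbundle \<Rightarrow> real^'n^'n" where
  "ginv M L c v = matrix_inv (gmat M L c v)"

definition metric_tensor :: "('m, 'n::finite) chart set \<Rightarrow> ('m, 'n) tbundle set \<Rightarrow>
    (('m, 'n) tbundle \<Rightarrow> real) \<Rightarrow> ('m, 'n) tensor" where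
  "metric_tensor M A L v c I J =
     (if v \<in> A \<and> c \<in> charts_at M (fst v) \<and> I = [] \<and> length J = 2
      then gmat M L c v $ (J ! 0) $ (J ! 1) else 0)"

definition cartan :: "('m, 'n::finite) chart set \<Rightarrow> (('m, 'n) tbundle \<Rightarrow> real) \<Rightarrow>
    ('m, 'n) chart \<Rightarrow> ('m, 'n) tbundle \<Rightarrow> 'n \<Rightarrow> 'n \<Rightarrow> 'n \<Rightarrow> real" where
  "cartan M L c v i j k = 1/2 * dy M c k (\<lambda>u. gmat M L c u $ i $ j) v"

text \<open>The Cartan tensor with its first index raised.\<close>
definition cartan_up :: "('m, 'n::finite) chart set \<Rightarrow> (('m, 'n) tbundle \<Rightarrow> real) \<Rightarrow>
    ('m, 'n) chart \<Rightarrow> ('m, 'n) tbundle \<Rightarrow> 'n \<Rightarrow> 'n \<Rightarrow> 'n \<Rightarrow> real" where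
  "cartan_up M L c v i j k = (\<Sum>l\<in>UNIV. ginv M L c v $ i $ l * cartan M L c v l j k)"

definition formal_christoffel :: "('m, 'n::finite) chart set \<Rightarrow> (('m, 'n) tbundle \<Rightarrow> real) \<Rightarrow>
    ('m, 'n) chart \<Rightarrow> ('m, 'n) tbundle \<Rightarrow> 'n \<Rightarrow> 'n \<Rightarrow> 'n \<Rightarrow> real" where
  "formal_christoffel M L c v i j k = (\<Sum>l\<in>UNIV. 1/2 * ginv M L c v $ i $ l *
     (dx M c k (\<lambda>u. gmat M L c u $ l $ j) v + dx M c j (\<lambda>u. gmat M L c u $ l $ k) v
       - dx M c l (\<lambda>u. gmat M L c u $ j $ k) v))"

definition nonlin_conn :: "('m, 'n::finite) chart set \<Rightarrow> (('m, 'n) tbundle \<Rightarrow> real) \<Rightarrow>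
    ('m, 'n) chart \<Rightarrow> ('m, 'n) tbundle \<Rightarrow> 'n \<Rightarrow> 'n \<Rightarrow> real" where
  "nonlin_conn M L c v i j =
     (\<Sum>k\<in>UNIV. formal_christoffel M L c v i j k * snd v c $ k) -
     (\<Sum>k\<in>UNIV. \<Sum>a\<in>UNIV. \<Sum>b\<in>UNIV.
        cartan_up M L c v i j k * formal_christoffel M L c v k a b * snd v c $ a * snd v c $ b)"

definition delta :: "('m, 'n::finite) chart set \<Rightarrow> (('m, 'n) tbundle \<Rightarrow> real) \<Rightarrow> ('m, 'n) chart \<Rightarrow>
    'n \<Rightarrow> (('m, 'n) tbundle \<Rightarrow> real) \<Rightarrow> ('m, 'n) tbundle \<Rightarrow> real" where
  "delta M L c i f v = dx M c i f v - (\<Sum>j\<in>UNIV. nonlin_conn M L c v j i * dy M c j f v)"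

definition chern :: "('m, 'n::finite) chart set \<Rightarrow> (('m, 'n) tbundle \<Rightarrow> real) \<Rightarrow>
    ('m, 'n) chart \<Rightarrow> ('m, 'n) tbundle \<Rightarrow> 'n \<Rightarrow> 'n \<Rightarrow> 'n \<Rightarrow> real" where
  "chern M L c v i j k = (\<Sum>l\<in>UNIV. 1/2 * ginv M L c v $ i $ l *
     (delta M L c k (\<lambda>u. gmat M L c u $ l $ j) v + delta M L c j (\<lambda>u. gmat M L c u $ l $ k) v
       - delta M L c l (\<lambda>u. gmat M L c u $ j $ k) v))"

text \<open>The covariant index introduced by the Chern connection is the last one.\<close>
definition nabla :: "('m, 'n::finite) chart set \<Rightarrow> ('m, 'n) tbundle set \<Rightarrow>
    (('m, 'n) tbundle \<Rightarrow> real) \<Rightarrow> ('m, 'n) tensor \<Rightarrow> ('m, 'n) tensor" where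
  "nabla M A L T v c I J' =
     (if v \<in> A \<and> c \<in> charts_at M (fst v) \<and> J' \<noteq> [] then
        (let J = butlast J'; k = last J' in
           delta M L c k (\<lambda>u. T u c I J) v
           + (\<Sum>m<length I. \<Sum>l\<in>UNIV. chern M L c v (I ! m) k l * T v c (I[m := l]) J)
           - (\<Sum>m<length J. \<Sum>l\<in>UNIV. chern M L c v l k (J ! m) * T v c I (J[m := l])))
      else 0)"

text \<open>The covariant derivative of \<open>T\<close> along the anisotropic vector field \<open>X\<close>.\<close>
definition nabla_along :: "('m, 'n::finite) chart set \<Rightarrow> ('m, 'n) tbundle set \<Rightarrow>
    (('m, 'n) tbundle \<Rightarrow> real) \<Rightarrow> ('m, 'n) tensor \<Rightarrow> ('m, 'n) tensor \<Rightarrow> ('m, 'n) tensor" where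
  "nabla_along M A L X T v c I J = (\<Sum>k\<in>UNIV. X v c [k] [] * nabla M A L T v c I (J @ [k]))"

text \<open>The derivative at \<open>v\<close> of the anisotropic vector field \<open>X\<close> in the direction of the tangent
  vector \<open>w\<close>.\<close>
definition nabla_at :: "('m, 'n::finite) chart set \<Rightarrow> ('m, 'n) tbundle set \<Rightarrow>
    (('m, 'n) tbundle \<Rightarrow> real) \<Rightarrow> ('m, 'n) tbundle \<Rightarrow> ('m, 'n) tvec \<Rightarrow> ('m, 'n) tensor \<Rightarrow> ('m, 'n) tvec" where
  "nabla_at M A L v w X = (\<lambda>c. \<chi> i. \<Sum>k\<in>UNIV. w c $ k * nabla M A L X v c [i] [k])"


section \<open>Volume form, anisotropic Lie bracket and divergence\<close>

text \<open>The determinant is the value of \<open>dx\<^sup>1 \<and> \<dots> \<and> dx\<^sup>n\<close> on the coordinate vector fields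
  with indices \<open>J\<close>; the order on \<open>'n\<close> numbers the coordinates, and \<open>card {..<b}\<close> is the position
  of \<open>b\<close>.\<close>
definition dVol :: "('m, 'n::{finite,linorder}) chart set \<Rightarrow> ('m, 'n) tbundle set \<Rightarrow>
    (('m, 'n) tbundle \<Rightarrow> real) \<Rightarrow> ('m, 'n) tensor" where
  "dVol M A L v c I J =
     (if v \<in> A \<and> c \<in> charts_at M (fst v) \<and> I = [] \<and> length J = CARD('n)
      then sqrt \<bar>det (gmat M L c v)\<bar> * det (\<chi> (a::'n) (b::'n). if J ! card {..<b} = a then 1 else 0)
      else 0)"

text \<open>This determines \<open>D\<close> on all tensor fields.\<close>
definition anisotropic_lie_bracket :: "('m, 'n::finite) chart set \<Rightarrow> ('m, 'n) tbundle set \<Rightarrow>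
    (('m, 'n) tbundle \<Rightarrow> real) \<Rightarrow> ('m, 'n) tensor \<Rightarrow> (('m, 'n) tensor \<Rightarrow> ('m, 'n) tensor) \<Rightarrow> bool" where
  "anisotropic_lie_bracket M A L Z D \<longleftrightarrow>
     tensor_derivation M A D \<and>
     (\<forall>f\<in>tensor_fields M A 0 0. \<forall>v\<in>A. \<forall>c\<in>charts_at M (fst v).
        D f v c [] [] = (\<Sum>k\<in>UNIV. Z v c [k] [] * delta M L c k (\<lambda>u. f u c [] []) v)) \<and>
     (\<forall>X\<in>tensor_fields M A 1 0. \<forall>v\<in>A. \<forall>c\<in>charts_at M (fst v). \<forall>i.
        D X v c [i] [] = (\<Sum>j\<in>UNIV. Z v c [j] [] * delta M L c j (\<lambda>u. X u c [i] []) v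
                               - X v c [j] [] * delta M L c j (\<lambda>u. Z u c [i] []) v))"

definition divergence :: "('m, 'n::{finite,linorder}) chart set \<Rightarrow> ('m, 'n) tbundle set \<Rightarrow>
    (('m, 'n) tbundle \<Rightarrow> real) \<Rightarrow> (('m, 'n) tensor \<Rightarrow> ('m, 'n) tensor \<Rightarrow> ('m, 'n) tensor) \<Rightarrow>
    ('m, 'n) tensor \<Rightarrow> ('m, 'n) tbundle \<Rightarrow> real" where
  "divergence M A L lie Z v =
     (THE a. \<forall>c I J. lie Z (dVol M A L) v c I J = a * dVol M A L v c I J)"


section \<open>Endomorphisms and bilinear forms\<close>

definition endo_apply :: "('m, 'n::finite) tensor \<Rightarrow> ('m, 'n) tensor \<Rightarrow> ('m, 'n) tensor" where
  "endo_apply T X v c I J = (if J = [] then \<Sum>j\<in>UNIV. T v c I [j] * X v c [j] [] else 0)"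

definition flat :: "('m, 'n::finite) chart set \<Rightarrow> ('m, 'n) tbundle set \<Rightarrow>
    (('m, 'n) tbundle \<Rightarrow> real) \<Rightarrow> ('m, 'n) tensor \<Rightarrow> ('m, 'n) tensor" where
  "flat M A L T v c I J = (if I = [] \<and> length J = 2
     then \<Sum>l\<in>UNIV. metric_tensor M A L v c [] [J ! 0, l] * T v c [l] [J ! 1] else 0)"

text \<open>The number \<open>S\<^sub>v(y, w)\<close>, computed in the chart \<open>c\<close>.\<close>
definition bilin :: "('m, 'n::finite) chart \<Rightarrow> ('m, 'n) tensor \<Rightarrow> ('m, 'n) tbundle \<Rightarrow>
    ('m, 'n) tvec \<Rightarrow> ('m, 'n) tvec \<Rightarrow> real" where
  "bilin c S v y w = (\<Sum>i\<in>UNIV. \<Sum>j\<in>UNIV. S v c [] [i, j] * y c $ i * w c $ j)"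

text \<open>The number \<open>\<theta>\<^sub>v(X\<^sub>v)\<close> for an anisotropic one-form \<open>\<theta>\<close>, computed in the chart \<open>c\<close>.\<close>
definition pairing :: "('m, 'n::finite) chart \<Rightarrow> ('m, 'n) tensor \<Rightarrow> ('m, 'n) tensor \<Rightarrow>
    ('m, 'n) tbundle \<Rightarrow> real" where
  "pairing c \<theta> X v = (\<Sum>j\<in>UNIV. \<theta> v c [] [j] * X v c [j] [])"

text \<open>The trace at \<open>v\<close> of the endomorphism \<open>Y \<mapsto> T(\<nabla>\<^sub>Y X)\<close>, computed in the chart \<open>c\<close>.\<close>
definition trace_T_nabla :: "('m, 'n::finite) chart set \<Rightarrow> ('m, 'n) tbundle set \<Rightarrow>
    (('m, 'n) tbundle \<Rightarrow> real) \<Rightarrow> ('m, 'n) chart \<Rightarrow> ('m, 'n) tensor \<Rightarrow> ('m, 'n) tensor \<Rightarrow>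
    ('m, 'n) tbundle \<Rightarrow> real" where
  "trace_T_nabla M A L c T X v =
     trace (\<chi> i k. \<Sum>j\<in>UNIV. T v c [i] [j] * nabla M A L X v c [j] [k])"

end

theory Submission
  imports Defs
begin

text \<open>In a chart, the Lie bracket of a covariant tensor is forced by the derivation property: contracting
  a slot with a field that extends a coordinate vector lowers the number of slots, so induction gives
  \<open>(l\<^sub>X S)\<^sub>J = X\<^sup>k \<delta>\<^sub>k S\<^sub>J + \<dots>\<close>. Since the Chern connection is torsion-free,
  \<open>l\<^sub>X S - \<nabla>\<^sub>X S\<close> is \<open>S(\<nabla>X, -) + S(-, \<nabla>X)\<close>, which is (A). Since it is also metric, \<open>\<nabla>g = 0\<close>, so the
  condition \<open>l\<^sub>X g = 0\<close> makes \<open>g(-, \<nabla>X)\<close> antisymmetric, and each case of (C) is the vanishing of the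
  trace of a symmetric times an antisymmetric matrix. For the volume form, the derivative of the
  determinant gives \<open>div Z = trace (\<nabla>Z)\<close>, and (B) is the Leibniz rule for \<open>T(X)\<close>.\<close>

section \<open>Smooth functions\<close>

text \<open>A Lie bracket is given only as an operator on global fields, known through its algebraic
  rules. Its components at \<open>v\<close> are reached by feeding it global fields with a
  prescribed value at \<open>v\<close>; this is what the bump functions, and the small calculus of
  smooth maps below them, are for. Of such an extension only the value at \<open>v\<close> is
  controlled, so its derivatives have to cancel in every computation. The other obstacle is the
  change of chart. Antisymmetry in (A) is read in one chart \<open>c\<close>, whereas
  \<open>lie X S v = nabla_along M A L X S v\<close> equates components in all charts around the
  base point, and \<open>bilin\<close> is independent of the chart on genuine tangent vectors only.
  Hence the vector \<nabla>X in a direction y must be shown to be tangent. This comes from a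
  Koszul-type formula that writes g(w, \<nabla>X(y)) in terms of Lie brackets, followed by
  nondegeneracy of g.\<close>

lemma Ck_on_cong:
  assumes "open S" "\<And>x. x \<in> S \<Longrightarrow> f x = g x" "Ck_on k S f"
  shows "Ck_on k S g"
  using assms(2,3)
proof (induction k arbitrary: f g)
  case 0
  then show ?case using continuous_on_cong[of S S f g] by simp
next
  case (Suc k)
  have d: "(g has_derivative frechet_derivative f (at x)) (at x)" if "x \<in> S" for x
    by (rule has_derivative_transform_within_open[OF _ assms(1) that Suc.prems(1)])
       (use Suc.prems(2) that in \<open>simp_all flip: frechet_derivative_works\<close>)
  then have "frechet_derivative f (at x) = frechet_derivative g (at x)" if "x \<in> S" for x
    using frechet_derivative_at that by blast
  then have "Ck_on k S (\<lambda>x. frechet_derivative g (at x) h)" for h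
    using Suc.IH[of "\<lambda>x. frechet_derivative f (at x) h"] Suc.prems(2) by simp
  with d show ?case by (auto simp: differentiable_def)
qed

text \<open>By uniqueness of derivatives, any explicit derivative \<open>f'\<close> agrees on
  \<open>S\<close> with the chosen \<open>frechet_derivative\<close>. The closure properties below
  are proved through this rule, each with the formula from calculus as \<open>f'\<close>.\<close>

lemma Ck_on_SucI:
  assumes "open S" "\<And>x. x \<in> S \<Longrightarrow> (f has_derivative f' x) (at x)"
    and "\<And>h. Ck_on k S (\<lambda>x. f' x h)"
  shows "Ck_on (Suc k) S f"
proof -
  have "Ck_on k S (\<lambda>x. frechet_derivative f (at x) h)" for h
    by (rule Ck_on_cong[OF assms(1) _ assms(3)[of h]]) (metis assms(2) frechet_derivative_at)
  then show ?thesis using assms(2) by (auto simp: differentiable_def)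
qed

lemma Ck_on_SucD: "Ck_on (Suc k) S f \<Longrightarrow> Ck_on k S f"
proof (induction k arbitrary: f)
  case 0
  then show ?case
    by (auto intro!: differentiable_imp_continuous_on simp: differentiable_on_def differentiable_at_withinI)
next
  case (Suc k)
  have "Ck_on k S (\<lambda>x. frechet_derivative f (at x) h)" for h
    by (rule Suc.IH) (use Suc.prems in simp)
  then show ?case using Suc.prems by simp
qed

lemma Ck_on_subset: "Ck_on k S f \<Longrightarrow> S' \<subseteq> S \<Longrightarrow> Ck_on k S' f"
  by (induction k arbitrary: f) (auto intro: continuous_on_subset)

text \<open>Being C^k is a local property. This yields the pointwise criterion
  \<open>smooth_on_locally\<close>, which suits fields glued from a formula and zero.\<close>

lemma Ck_on_UN:
  assumes "\<And>i. i \<in> I \<Longrightarrow> open (S i)" "\<And>i. i \<in> I \<Longrightarrow> Ck_on k (S i) f"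
  shows "Ck_on k (\<Union>i\<in>I. S i) f"
  using assms(2)
proof (induction k arbitrary: f)
  case 0
  then show ?case using assms(1) by (auto intro!: continuous_on_open_UN)
qed auto

lemma Ck_on_const [simp]: "Ck_on k S (\<lambda>x. c)"
  by (induction k arbitrary: c) auto

lemma Ck_on_bounded_linear:
  assumes "open S" "bounded_linear g" "Ck_on k S f"
  shows "Ck_on k S (\<lambda>x. g (f x))"
  using assms(3)
proof (induction k arbitrary: f)
  case 0
  then show ?case using bounded_linear.continuous_on[OF assms(2)] by simp
next
  case (Suc k)
  show ?case
    by (rule Ck_on_SucI[OF assms(1), where f' = "\<lambda>x h. g (frechet_derivative f (at x) h)"])
       (use Suc in \<open>auto intro!: bounded_linear.has_derivative[OF assms(2)] simp flip: frechet_derivative_works\<close>)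
qed

lemma Ck_on_add:
  assumes "open S" "Ck_on k S f" "Ck_on k S g"
  shows "Ck_on k S (\<lambda>x. f x + g x)"
  using assms(2,3)
proof (induction k arbitrary: f g)
  case 0
  then show ?case by (auto intro: continuous_intros)
next
  case (Suc k)
  show ?case
    by (rule Ck_on_SucI[OF assms(1),
          where f' = "\<lambda>x h. frechet_derivative f (at x) h + frechet_derivative g (at x) h"])
       (use Suc in \<open>auto intro!: has_derivative_add simp flip: frechet_derivative_works\<close>)
qed

text \<open>The product rule leaves one factor undifferentiated in each term, so the induction also
  uses that C^(k+1) maps are C^k.\<close>

lemma Ck_on_scaleR:
  assumes "open S" "Ck_on k S f" "Ck_on k S g"
  shows "Ck_on k S (\<lambda>x. f x *\<^sub>R g x)"
  using assms(2,3)
proof (induction k arbitrary: f g)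
  case 0
  then show ?case by (auto intro: continuous_intros)
next
  case (Suc k)
  have "Ck_on k S (\<lambda>x. f x *\<^sub>R frechet_derivative g (at x) h + frechet_derivative f (at x) h *\<^sub>R g x)" for h
    by (intro Ck_on_add assms(1) Suc.IH Ck_on_SucD[OF Suc.prems(1)] Ck_on_SucD[OF Suc.prems(2)])
       (use Suc.prems in simp_all)
  then show ?case
    by (intro Ck_on_SucI[OF assms(1),
          where f' = "\<lambda>x h. f x *\<^sub>R frechet_derivative g (at x) h + frechet_derivative f (at x) h *\<^sub>R g x"])
       (use Suc in \<open>auto intro!: has_derivative_scaleR simp flip: frechet_derivative_works\<close>)
qed

lemma Ck_on_sum:
  assumes "open S" "\<And>i. i \<in> I \<Longrightarrow> Ck_on k S (f i)"
  shows "Ck_on k S (\<lambda>x. \<Sum>i\<in>I. f i x)"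
  using assms(2) by (induction I rule: infinite_finite_induct) (auto intro: Ck_on_add[OF assms(1)])

text \<open>In the chain rule the outer derivative is taken in the direction
  \<open>frechet_derivative g (at x) h\<close>, which moves with \<open>x\<close>, while
  \<open>Ck_on\<close> speaks of fixed directions. Expanding that direction in a basis of the middle
  space, which is therefore Euclidean, leaves fixed directions with C^k coefficients.\<close>

lemma Ck_on_compose:
  fixes g :: "'a::real_normed_vector \<Rightarrow> 'b::euclidean_space" and f :: "'b \<Rightarrow> 'c::real_normed_vector"
  assumes "open S" "open T" "g ` S \<subseteq> T" "Ck_on k S g" "Ck_on k T f"
  shows "Ck_on k S (\<lambda>x. f (g x))"
  using assms(4,5)
proof (induction k arbitrary: f)
  case 0
  then show ?case using continuous_on_compose2[of T f S g] assms(3) by simp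
next
  case (Suc k)
  let ?F = "\<lambda>x h. frechet_derivative f (at (g x)) (frechet_derivative g (at x) h)"
  have df: "(f has_derivative frechet_derivative f (at (g x))) (at (g x))" if "x \<in> S" for x
    using Suc.prems(2) that assms(3) by (auto simp flip: frechet_derivative_works)
  have dg: "(g has_derivative frechet_derivative g (at x)) (at x)" if "x \<in> S" for x
    using Suc.prems(1) that by (auto simp flip: frechet_derivative_works)
  have "Ck_on k S (\<lambda>x. ?F x h)" for h
  proof (rule Ck_on_cong[OF assms(1)])
    show "(\<Sum>i\<in>Basis. (frechet_derivative g (at x) h \<bullet> i) *\<^sub>R frechet_derivative f (at (g x)) i) = ?F x h"
      if "x \<in> S" for x
    proof -
      interpret bounded_linear "frechet_derivative f (at (g x))"
        using df[OF that] by (rule has_derivative_bounded_linear)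
      have "?F x h = frechet_derivative f (at (g x)) (\<Sum>i\<in>Basis. (frechet_derivative g (at x) h \<bullet> i) *\<^sub>R i)"
        by (simp add: euclidean_representation)
      then show ?thesis by (simp add: sum scale)
    qed
    show "Ck_on k S (\<lambda>x. \<Sum>i\<in>Basis. (frechet_derivative g (at x) h \<bullet> i) *\<^sub>R frechet_derivative f (at (g x)) i)"
    proof (intro Ck_on_sum Ck_on_scaleR assms(1))
      fix i :: 'b
      show "Ck_on k S (\<lambda>x. frechet_derivative g (at x) h \<bullet> i)"
        by (rule Ck_on_bounded_linear[OF assms(1) bounded_linear_inner_left]) (use Suc.prems in simp)
      show "Ck_on k S (\<lambda>x. frechet_derivative f (at (g x)) i)"
        by (rule Suc.IH) (use Suc.prems Ck_on_SucD in auto)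
    qed
  qed
  moreover have "((\<lambda>x. f (g x)) has_derivative ?F x) (at x)" if "x \<in> S" for x
    using has_derivative_compose[OF dg df] that by simp
  ultimately show ?case by (intro Ck_on_SucI[OF assms(1), where f' = ?F])
qed

lemma smooth_on_cong:
  "open S \<Longrightarrow> (\<And>x. x \<in> S \<Longrightarrow> f x = g x) \<Longrightarrow> smooth_on S f \<Longrightarrow> smooth_on S g"
  unfolding smooth_on_def using Ck_on_cong by blast

lemma smooth_on_subset: "smooth_on S f \<Longrightarrow> S' \<subseteq> S \<Longrightarrow> smooth_on S' f"
  unfolding smooth_on_def using Ck_on_subset by blast

lemma smooth_on_locally:
  assumes "\<And>x. x \<in> S \<Longrightarrow> \<exists>U. open U \<and> x \<in> U \<and> smooth_on U f"
  shows "smooth_on S f"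
proof -
  obtain U where U: "\<And>x. x \<in> S \<Longrightarrow> open (U x) \<and> x \<in> U x \<and> smooth_on (U x) f"
    using assms by metis
  have "Ck_on k (\<Union>x\<in>S. U x) f" for k
    by (rule Ck_on_UN) (use U in \<open>auto simp: smooth_on_def\<close>)
  then show ?thesis
    using U Ck_on_subset unfolding smooth_on_def by (metis UN_iff subsetI)
qed

lemma smooth_on_const [simp]: "smooth_on S (\<lambda>x. c)"
  by (simp add: smooth_on_def)

lemma smooth_on_bounded_linear:
  "open S \<Longrightarrow> bounded_linear g \<Longrightarrow> smooth_on S f \<Longrightarrow> smooth_on S (\<lambda>x. g (f x))"
  unfolding smooth_on_def using Ck_on_bounded_linear by blast

lemma smooth_on_id: "open S \<Longrightarrow> smooth_on S (\<lambda>x. x)"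
proof -
  assume S: "open S"
  have "Ck_on k S (\<lambda>x. x)" for k
  proof (cases k)
    case (Suc j)
    show ?thesis unfolding Suc
      by (rule Ck_on_SucI[OF S, where f' = "\<lambda>x h. h"]) auto
  qed auto
  then show ?thesis by (simp add: smooth_on_def)
qed

lemma smooth_on_add:
  "open S \<Longrightarrow> smooth_on S f \<Longrightarrow> smooth_on S g \<Longrightarrow> smooth_on S (\<lambda>x. f x + g x)"
  unfolding smooth_on_def using Ck_on_add by blast

lemma smooth_on_scaleR:
  "open S \<Longrightarrow> smooth_on S f \<Longrightarrow> smooth_on S g \<Longrightarrow> smooth_on S (\<lambda>x. f x *\<^sub>R g x)"
  unfolding smooth_on_def using Ck_on_scaleR by blast

lemma smooth_on_mult:
  fixes f g :: "_ \<Rightarrow> real"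
  shows "open S \<Longrightarrow> smooth_on S f \<Longrightarrow> smooth_on S g \<Longrightarrow> smooth_on S (\<lambda>x. f x * g x)"
  using smooth_on_scaleR[of S f g] by simp

lemma smooth_on_diff:
  "open S \<Longrightarrow> smooth_on S f \<Longrightarrow> smooth_on S g \<Longrightarrow> smooth_on S (\<lambda>x. f x - g x)"
  using smooth_on_add[of S f "\<lambda>x. - g x"] smooth_on_bounded_linear[of S uminus g]
  by (simp add: bounded_linear_minus bounded_linear_ident)

lemma smooth_on_sum:
  "open S \<Longrightarrow> (\<And>i. i \<in> I \<Longrightarrow> smooth_on S (f i)) \<Longrightarrow> smooth_on S (\<lambda>x. \<Sum>i\<in>I. f i x)"
  unfolding smooth_on_def by (simp add: Ck_on_sum)

lemma smooth_on_prod: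
  fixes f :: "_ \<Rightarrow> _ \<Rightarrow> real"
  assumes "open S" "\<And>i. i \<in> I \<Longrightarrow> smooth_on S (f i)"
  shows "smooth_on S (\<lambda>x. \<Prod>i\<in>I. f i x)"
  using assms(2) by (induction I rule: infinite_finite_induct) (auto intro: smooth_on_mult[OF assms(1)])

lemma smooth_on_compose:
  fixes g :: "'a::real_normed_vector \<Rightarrow> 'b::euclidean_space" and f :: "'b \<Rightarrow> 'c::real_normed_vector"
  shows "open S \<Longrightarrow> open T \<Longrightarrow> g ` S \<subseteq> T \<Longrightarrow> smooth_on S g \<Longrightarrow> smooth_on T f \<Longrightarrow> smooth_on S (\<lambda>x. f (g x))"
  unfolding smooth_on_def using Ck_on_compose by blast

lemma smooth_on_differentiable: "smooth_on S f \<Longrightarrow> x \<in> S \<Longrightarrow> f differentiable (at x)"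
  unfolding smooth_on_def by (metis Ck_on.simps(2))

lemma smooth_on_frechet_derivative: "smooth_on S f \<Longrightarrow> smooth_on S (\<lambda>x. frechet_derivative f (at x) h)"
  unfolding smooth_on_def by (metis Ck_on.simps(2))

lemma smooth_on_imp_continuous_on: "smooth_on S f \<Longrightarrow> continuous_on S f"
  unfolding smooth_on_def by (metis Ck_on.simps(1))

text \<open>If the derivative of each member is a linear combination of later members, induction on
  \<open>k\<close> makes all members C^k at once. The two-term recursion is what negative powers of
  t times sqrt |t|, and times exp (-1/t), satisfy.\<close>

lemma smooth_on_derivative_family:
  fixes F :: "nat \<Rightarrow> real \<Rightarrow> real" and a b :: "nat \<Rightarrow> real"
  assumes "open S"
    and "\<And>m x. x \<in> S \<Longrightarrow> (F m has_real_derivative a m * F (m+1) x + b m * F (m+2) x) (at x)"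
  shows "smooth_on S (F m)"
proof -
  have "Ck_on k S (F m)" for k
  proof (induction k arbitrary: m)
    case 0
    then show ?case
      using DERIV_continuous_on[OF has_field_derivative_at_within[OF assms(2)]] by simp
  next
    case (Suc k)
    have "Ck_on k S (\<lambda>x. (h * a m) *\<^sub>R F (m+1) x + (h * b m) *\<^sub>R F (m+2) x)" for h
      using Ck_on_add[OF assms(1) Ck_on_scaleR[OF assms(1) Ck_on_const Suc] Ck_on_scaleR[OF assms(1) Ck_on_const Suc]] .
    moreover have "(\<lambda>x. (h * a m) *\<^sub>R F (m+1) x + (h * b m) *\<^sub>R F (m+2) x)
        = (\<lambda>x. (a m * F (m+1) x + b m * F (m+2) x) * h)" for h
      by (simp add: algebra_simps)
    ultimately have "Ck_on k S (\<lambda>x. (a m * F (m+1) x + b m * F (m+2) x) * h)" for h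
      by metis
    then show ?case
      by (intro Ck_on_SucI[OF assms(1), where f' = "\<lambda>x h. (a m * F (m+1) x + b m * F (m+2) x) * h"])
         (use assms(2) in \<open>auto simp: has_field_derivative_def\<close>)
  qed
  then show ?thesis by (simp add: smooth_on_def)
qed

text \<open>Writing the derivative with \<open>sqrt \<bar>x\<bar> * inverse x\<close> gives one
  formula for both signs, and one of the same shape as the function itself.\<close>

lemma has_derivative_sqrt_abs:
  assumes "x \<noteq> (0::real)"
  shows "((\<lambda>t. sqrt \<bar>t\<bar>) has_real_derivative (sqrt \<bar>x\<bar> * inverse x / 2)) (at x)"
proof -
  have "sqrt \<bar>x\<bar> * sqrt \<bar>x\<bar> = \<bar>x\<bar>" by simp
  then have "sgn x * (inverse (sqrt \<bar>x\<bar>) / 2) = sqrt \<bar>x\<bar> * inverse x / 2"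
    using assms by (simp add: field_simps sgn_if abs_if split: if_splits)
  \<comment> \<open>On the half-line containing \<open>x\<close> the absolute value is the linear
    function \<open>sgn x * t\<close>.\<close>
  moreover have "((\<lambda>t. sqrt \<bar>t\<bar>) has_real_derivative (sgn x * (inverse (sqrt \<bar>x\<bar>) / 2))) (at x)"
  proof (rule has_field_derivative_transform_within_open[where S = "{t. 0 < sgn x * t}"])
    show "((\<lambda>t. sqrt (sgn x * t)) has_real_derivative (sgn x * (inverse (sqrt \<bar>x\<bar>) / 2))) (at x)"
      using assms by (auto intro!: derivative_eq_intros simp: sgn_if)
    show "open {t. 0 < sgn x * t}"
      by (intro open_Collect_less continuous_intros)
  qed (use assms in \<open>auto simp: sgn_if split: if_splits\<close>)
  ultimately show ?thesis by simp
qed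

lemma smooth_on_sqrt_abs: "smooth_on (- {0}) (\<lambda>t::real. sqrt \<bar>t\<bar>)"
proof -
  have *: "((\<lambda>t. sqrt \<bar>t\<bar> * inverse t ^ m) has_real_derivative
      (1/2 - real m) * (sqrt \<bar>x\<bar> * inverse x ^ (m+1)) + 0 * (sqrt \<bar>x\<bar> * inverse x ^ (m+2))) (at x)"
    if "x \<in> - {0::real}" for m x
  proof -
    have x: "x \<noteq> 0" using that by simp
    have p: "((\<lambda>t. inverse t ^ m) has_real_derivative (- real m * inverse x ^ (m+1))) (at x)"
      by (rule DERIV_cong[OF DERIV_power[OF DERIV_inverse]], use x in simp, cases m, simp_all add: power2_eq_square algebra_simps)
    show ?thesis
      by (rule DERIV_cong[OF DERIV_mult[OF has_derivative_sqrt_abs[OF x] p]]) (simp add: algebra_simps)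
  qed
  show ?thesis
    using smooth_on_derivative_family[where F = "\<lambda>m t. sqrt \<bar>t\<bar> * inverse t ^ m" and m = 0
        and a = "\<lambda>m. 1/2 - real m" and b = "\<lambda>m. 0" and S = "- {0}", OF _ *] by auto
qed

text \<open>For \<open>m = 0\<close> this is the classical smooth function exp (-1/t) extended by
  zero. The powers of 1/t are carried along because differentiation produces them.\<close>

definition flat_exp :: "nat \<Rightarrow> real \<Rightarrow> real" where
  "flat_exp m t = (if t > 0 then inverse t ^ m * exp (- inverse t) else 0)"

lemma flat_exp_tendsto_0: "(flat_exp m \<longlongrightarrow> 0) (at_right 0)"
proof -
  have "((\<lambda>t. inverse t ^ m * exp (- inverse t)) \<longlongrightarrow> (0::real)) (at_right 0)"
    using filterlim_compose[OF tendsto_power_div_exp_0[of m] filterlim_inverse_at_top_right]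
    by (simp add: exp_minus divide_inverse)
  then show ?thesis
    by (rule Lim_transform_eventually)
       (auto simp: flat_exp_def eventually_at_right_field intro: exI[of _ 1])
qed

lemma has_derivative_flat_exp:
  "(flat_exp m has_real_derivative (- real m * flat_exp (m+1) t + 1 * flat_exp (m+2) t)) (at t)"
proof -
  consider "t > 0" | "t < 0" | "t = 0" by linarith
  then show ?thesis
  proof cases
    case 1
    have "((\<lambda>t. inverse t ^ m) has_real_derivative (- real m * inverse t ^ (m+1))) (at t)"
      by (rule DERIV_cong[OF DERIV_power[OF DERIV_inverse]], use 1 in simp, cases m, simp_all add: power2_eq_square algebra_simps)
    moreover have "((\<lambda>t. exp (- inverse t)) has_real_derivative (exp (- inverse t) * inverse t ^ 2)) (at t)"
      using 1 by (auto intro!: derivative_eq_intros simp: field_simps power2_eq_square)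
    ultimately have "((\<lambda>t. inverse t ^ m * exp (- inverse t)) has_real_derivative
        (- real m * flat_exp (m+1) t + 1 * flat_exp (m+2) t)) (at t)"
      by (rule DERIV_cong[OF DERIV_mult]) (use 1 in \<open>simp add: flat_exp_def algebra_simps power2_eq_square\<close>)
    then show ?thesis
      by (rule has_field_derivative_transform_within_open[where S="{0<..}"]) (use 1 in \<open>auto simp: flat_exp_def\<close>)
  next
    case 2
    have "((\<lambda>t. 0) has_real_derivative (- real m * flat_exp (m+1) t + 1 * flat_exp (m+2) t)) (at t)"
      using 2 by (simp add: flat_exp_def)
    then show ?thesis
      by (rule has_field_derivative_transform_within_open[where S="{..<0}"]) (use 2 in \<open>auto simp: flat_exp_def\<close>)
  next
    case 3
    \<comment> \<open>For h > 0 the difference quotient at 0 is \<open>flat_exp (m+1) h\<close>,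
      which tends to 0; for h < 0 it vanishes.\<close>
    have "((\<lambda>h. flat_exp m h / h) \<longlongrightarrow> 0) (at_right 0)"
      by (rule Lim_transform_eventually[OF flat_exp_tendsto_0[of "m+1"]])
         (auto simp: flat_exp_def eventually_at_right_field divide_inverse intro!: exI[of _ 1])
    moreover have "((\<lambda>h. flat_exp m h / h) \<longlongrightarrow> 0) (at_left 0)"
      by (rule Lim_transform_eventually[OF tendsto_const])
         (auto simp: flat_exp_def eventually_at_left_field intro!: exI[of _ "-1"])
    ultimately have "((\<lambda>h. flat_exp m h / h) \<longlongrightarrow> 0) (at 0)"
      by (simp add: filterlim_at_split)
    then show ?thesis using 3 by (simp add: DERIV_def flat_exp_def)
  qed
qed

lemma smooth_bump:
  fixes x0 :: "'a::euclidean_space"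
  assumes "r > 0"
  obtains \<beta> :: "'a \<Rightarrow> real" where "smooth_on UNIV \<beta>" "\<beta> x0 = 1" "\<And>x. x \<notin> cball x0 r \<Longrightarrow> \<beta> x = 0"
proof
  \<comment> \<open>The sum is the squared distance to \<open>x0\<close>, spelled out as a
    polynomial in the coordinates so that its smoothness is evident. The leading factor normalises
    the value at \<open>x0\<close> to 1.\<close>
  let ?\<beta> = "\<lambda>x. inverse (flat_exp 0 (r\<^sup>2)) * flat_exp 0 (r\<^sup>2 - (\<Sum>i\<in>Basis. ((x - x0) \<bullet> i) * ((x - x0) \<bullet> i)))"
  have F: "smooth_on UNIV (flat_exp m)" for m
    by (rule smooth_on_derivative_family[where a = "\<lambda>m. - real m" and b = "\<lambda>m. 1"])
       (use has_derivative_flat_exp in auto)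
  have "smooth_on UNIV (\<lambda>x. (x - x0) \<bullet> i)" for i
    by (rule smooth_on_bounded_linear[OF open_UNIV bounded_linear_inner_left])
       (intro smooth_on_diff smooth_on_id smooth_on_const open_UNIV)
  then have "smooth_on UNIV (\<lambda>x. r\<^sup>2 - (\<Sum>i\<in>Basis. ((x - x0) \<bullet> i) * ((x - x0) \<bullet> i)))"
    by (intro smooth_on_diff smooth_on_sum smooth_on_mult smooth_on_const open_UNIV) auto
  then show "smooth_on UNIV ?\<beta>"
    by (intro smooth_on_mult smooth_on_const open_UNIV smooth_on_compose[OF _ _ _ _ F]) auto
  show "?\<beta> x0 = 1" using assms by (simp add: flat_exp_def)
  show "?\<beta> x = 0" if "x \<notin> cball x0 r" for x
  proof -
    have "(\<Sum>i\<in>Basis. ((x - x0) \<bullet> i) * ((x - x0) \<bullet> i)) = (norm (x - x0))\<^sup>2"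
      by (simp add: power2_norm_eq_inner euclidean_inner[symmetric])
    moreover have "r\<^sup>2 \<le> (norm (x - x0))\<^sup>2"
      using that assms by (intro power_mono) (auto simp: dist_norm norm_minus_commute)
    ultimately show ?thesis by (simp add: flat_exp_def)
  qed
qed

text \<open>The second difference of \<open>f\<close> along \<open>h\<close> and \<open>k\<close> is rewritten by two applications of the mean
  value theorem as a mixed derivative at an intermediate point.\<close>
lemma second_difference_eq:
  fixes f :: "'a::real_normed_vector \<Rightarrow> real"
  assumes S: "smooth_on S f"
    and s: "s > 0" and in_S: "\<And>a b. 0 \<le> a \<Longrightarrow> a \<le> s \<Longrightarrow> 0 \<le> b \<Longrightarrow> b \<le> s \<Longrightarrow> x + a *\<^sub>R h + b *\<^sub>R k \<in> S"
  shows "\<exists>a b. 0 \<le> a \<and> a \<le> s \<and> 0 \<le> b \<and> b \<le> s \<and>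
    f (x + s *\<^sub>R h + s *\<^sub>R k) - f (x + s *\<^sub>R h) - f (x + s *\<^sub>R k) + f x
     = s * s * frechet_derivative (\<lambda>y. frechet_derivative f (at y) h) (at (x + a *\<^sub>R h + b *\<^sub>R k)) k"
proof -
  have line: "((\<lambda>t. g (y + t *\<^sub>R u)) has_real_derivative frechet_derivative g (at (y + t *\<^sub>R u)) u) (at t)"
    if "smooth_on S g" "y + t *\<^sub>R u \<in> S" for g :: "'a \<Rightarrow> real" and y u t
  proof -
    have g: "(g has_derivative frechet_derivative g (at (y + t *\<^sub>R u))) (at (y + t *\<^sub>R u))"
      using smooth_on_differentiable[OF that] frechet_derivative_works by blast
    have "((\<lambda>t. y + t *\<^sub>R u) has_derivative (\<lambda>r. r *\<^sub>R u)) (at t)"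
      by (auto intro!: derivative_eq_intros)
    from has_derivative_compose[OF this g] show ?thesis
      using linear_scale[OF bounded_linear.linear[OF has_derivative_bounded_linear[OF g]]]
      by (simp add: has_field_derivative_def mult.commute[of _ "frechet_derivative g _ _"] mult_commute_abs)
  qed
  let ?\<phi> = "\<lambda>a. f (x + a *\<^sub>R h + s *\<^sub>R k) - f (x + a *\<^sub>R h)"
  let ?D = "\<lambda>y. frechet_derivative f (at y) h"
  have "(?\<phi> has_real_derivative ?D (x + a *\<^sub>R h + s *\<^sub>R k) - ?D (x + a *\<^sub>R h)) (at a)"
    if "0 \<le> a" "a \<le> s" for a
    using line[OF S, of "x + s *\<^sub>R k" a h] line[OF S, of "x" a h] in_S[OF that, of s] in_S[OF that, of 0] s
    by (auto intro!: DERIV_diff simp: add_ac)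
  from MVT2[OF s this] obtain a where a: "0 < a" "a < s"
    "?\<phi> s - ?\<phi> 0 = s * (?D (x + a *\<^sub>R h + s *\<^sub>R k) - ?D (x + a *\<^sub>R h))" by auto
  have "((\<lambda>b. ?D (x + a *\<^sub>R h + b *\<^sub>R k)) has_real_derivative
      frechet_derivative ?D (at (x + a *\<^sub>R h + b *\<^sub>R k)) k) (at b)" if "0 \<le> b" "b \<le> s" for b
    using line[OF smooth_on_frechet_derivative[OF S], of "x + a *\<^sub>R h" b k] in_S[of a b] a that by auto
  from MVT2[OF s this] obtain b where b: "0 < b" "b < s"
    "?D (x + a *\<^sub>R h + s *\<^sub>R k) - ?D (x + a *\<^sub>R h)
      = s * frechet_derivative ?D (at (x + a *\<^sub>R h + b *\<^sub>R k)) k" by auto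
  show ?thesis using a b by (intro exI[of _ a] exI[of _ b]) auto
qed

text \<open>The second difference is unchanged when \<open>h\<close> and \<open>k\<close> are
  exchanged. So the two mixed derivatives take equal values at suitable points arbitrarily close to
  \<open>x\<close>, and their continuity excludes a gap at \<open>x\<close>.\<close>

lemma frechet_derivative_commute:
  fixes f :: "'a::real_normed_vector \<Rightarrow> real"
  assumes S: "smooth_on S f" and "open S" "x \<in> S"
  shows "frechet_derivative (\<lambda>y. frechet_derivative f (at y) h) (at x) k
       = frechet_derivative (\<lambda>y. frechet_derivative f (at y) k) (at x) h"
proof (rule ccontr)
  let ?P = "\<lambda>y. frechet_derivative (\<lambda>y. frechet_derivative f (at y) h) (at y) k"
  let ?Q = "\<lambda>y. frechet_derivative (\<lambda>y. frechet_derivative f (at y) k) (at y) h"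
  assume ne: "?P x \<noteq> ?Q x"
  \<comment> \<open>Half the gap: a number less than \<open>?e\<close> away from one of the two
    values is not that close to the other.\<close>
  let ?e = "\<bar>?P x - ?Q x\<bar> / 2"
  have "continuous_on S ?P" "continuous_on S ?Q"
    by (intro smooth_on_imp_continuous_on smooth_on_frechet_derivative S)+
  then have "isCont ?P x" "isCont ?Q x"
    using assms(2,3) by (auto simp: continuous_on_eq_continuous_at)
  moreover have "\<forall>\<^sub>F y in nhds x. dist (P y) (P x) < ?e" if "isCont P x" for P :: "'a \<Rightarrow> real"
    using that ne tendsto_at_iff_tendsto_nhds[of P x] by (intro tendstoD) (auto simp: isCont_def)
  ultimately have "\<forall>\<^sub>F y in nhds x. dist (?P y) (?P x) < ?e" "\<forall>\<^sub>F y in nhds x. dist (?Q y) (?Q x) < ?e"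
    by blast+
  then obtain d1 d2 where d: "d1 > 0" "d2 > 0"
    "\<And>y. dist y x < d1 \<Longrightarrow> \<bar>?P y - ?P x\<bar> < ?e" "\<And>y. dist y x < d2 \<Longrightarrow> \<bar>?Q y - ?Q x\<bar> < ?e"
    unfolding eventually_nhds_metric dist_real_def by blast
  obtain d3 where d3: "d3 > 0" "ball x d3 \<subseteq> S" using assms(2,3) openE by blast
  define d where "d = min d1 (min d2 d3)"
  have d0: "d > 0" using d d3 by (simp add: d_def)
  \<comment> \<open>The summand 1 keeps \<open>N\<close> positive when both directions vanish. With
    \<open>s = d / (2 * N)\<close> the parallelogram spanned by \<open>s *\<^sub>R h\<close> and
    \<open>s *\<^sub>R k\<close> stays within d/2 of \<open>x\<close>.\<close>
  define N where "N = norm h + norm k + 1"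
  define s where "s = d / (2 * N)"
  have n: "N > 0" unfolding N_def by (smt (verit) norm_ge_zero)
  then have s0: "s > 0" using d0 by (simp add: s_def)
  have near: "dist (x + a *\<^sub>R h + b *\<^sub>R k) x < d" if "0 \<le> a" "a \<le> s" "0 \<le> b" "b \<le> s" for a b
  proof -
    have "norm (a *\<^sub>R h + b *\<^sub>R k) \<le> a * norm h + b * norm k"
      using norm_triangle_ineq[of "a *\<^sub>R h" "b *\<^sub>R k"] that by simp
    also have "\<dots> \<le> s * norm h + s * norm k"
      using that by (intro add_mono mult_right_mono) auto
    also have "\<dots> \<le> s * N" using s0 by (simp add: N_def algebra_simps)
    also have "\<dots> = d / 2" using n by (simp add: s_def)
    also have "\<dots> < d" using d0 by simp
    finally show ?thesis by (simp add: dist_norm add.assoc)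
  qed
  have inS: "x + a *\<^sub>R h + b *\<^sub>R k \<in> S" if "0 \<le> a" "a \<le> s" "0 \<le> b" "b \<le> s" for a b
    using near[OF that] d3 by (auto simp: d_def dist_commute)
  obtain a b where ab: "0 \<le> a" "a \<le> s" "0 \<le> b" "b \<le> s"
    "f (x + s *\<^sub>R h + s *\<^sub>R k) - f (x + s *\<^sub>R h) - f (x + s *\<^sub>R k) + f x = s * s * ?P (x + a *\<^sub>R h + b *\<^sub>R k)"
    using second_difference_eq[OF S s0 inS] by blast
  have inS': "x + a *\<^sub>R k + b *\<^sub>R h \<in> S" if "0 \<le> a" "a \<le> s" "0 \<le> b" "b \<le> s" for a b
    using inS[of b a] that by (simp add: add_ac)
  obtain a' b' where ab': "0 \<le> a'" "a' \<le> s" "0 \<le> b'" "b' \<le> s"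
    "f (x + s *\<^sub>R k + s *\<^sub>R h) - f (x + s *\<^sub>R k) - f (x + s *\<^sub>R h) + f x = s * s * ?Q (x + a' *\<^sub>R k + b' *\<^sub>R h)"
    using second_difference_eq[OF S s0 inS'] by blast
  have "x + s *\<^sub>R k + s *\<^sub>R h = x + s *\<^sub>R h + s *\<^sub>R k" by (simp add: add_ac)
  then have "s * s * ?P (x + a *\<^sub>R h + b *\<^sub>R k) = s * s * ?Q (x + a' *\<^sub>R k + b' *\<^sub>R h)"
    using ab(5) ab'(5) by (simp add: algebra_simps)
  then have "?P (x + a *\<^sub>R h + b *\<^sub>R k) = ?Q (x + a' *\<^sub>R k + b' *\<^sub>R h)" using s0 by simp
  moreover have "\<bar>?P (x + a *\<^sub>R h + b *\<^sub>R k) - ?P x\<bar> < ?e"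
    using near[OF ab(1-4)] by (intro d) (simp add: d_def)
  moreover have "\<bar>?Q (x + a' *\<^sub>R k + b' *\<^sub>R h) - ?Q x\<bar> < ?e"
    using near[OF ab'(3,4,1,2)] by (intro d) (simp add: d_def add_ac)
  moreover have "\<bar>P - Q\<bar> \<le> \<bar>p - P\<bar> + \<bar>p - Q\<bar>" for p P Q :: real by simp
  ultimately show False by (metis add_strict_mono field_sum_of_halves not_less)
qed

section \<open>Charts and anisotropic tensor fields\<close>

text \<open>Splits off the first index, so that the transformation law, a sum over all index lists
  of given lengths, unfolds into nested sums slot by slot.\<close>

lemma sum_lists_Suc:
  fixes f :: "'n::finite list \<Rightarrow> 'a::comm_monoid_add"
  shows "(\<Sum>K | length K = Suc n. f K) = (\<Sum>k\<in>UNIV. \<Sum>K | length K = n. f (k # K))"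
proof -
  have "finite {K :: 'n list. length K = n}"
    using finite_lists_length_eq[of "UNIV :: 'n set" n] by simp
  moreover have "{K :: 'n list. length K = Suc n} = (\<lambda>(k, K). k # K) ` (UNIV \<times> {K. length K = n})"
    by (auto simp: image_iff length_Suc_conv)
  moreover have "inj_on (\<lambda>(k, K). k # K) (UNIV \<times> {K :: 'n list. length K = n})"
    by (auto simp: inj_on_def)
  ultimately show ?thesis
    by (simp add: sum.reindex sum.cartesian_product case_prod_unfold o_def)
qed

lemma prod_lists_Suc:
  fixes f :: "'n \<Rightarrow> 'm \<Rightarrow> 'a::comm_monoid_mult"
  shows "(\<Prod>a<Suc n. f ((i # I) ! a) ((k # K) ! a)) = f i k * (\<Prod>a<n. f (I ! a) (K ! a))"
  by (subst prod.lessThan_Suc_shift) simp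

locale anisotropic_domain =
  fixes M :: "('m::t2_space, 'n::finite) chart set" and A :: "('m, 'n) tbundle set"
  assumes atlas: "oriented_atlas M" and conic: "conic_domain M A"
begin

lemma chart_homeomorphism:
  "c \<in> M \<Longrightarrow> homeomorphism (dom_of c) (map_of_chart c ` dom_of c) (map_of_chart c) (chart_inv c)"
  using atlas unfolding oriented_atlas_def by blast

lemma open_dom: "c \<in> M \<Longrightarrow> open (dom_of c)"
  using atlas unfolding oriented_atlas_def by blast

lemma chart_inv_map [simp]: "c \<in> M \<Longrightarrow> p \<in> dom_of c \<Longrightarrow> chart_inv c (map_of_chart c p) = p"
  using chart_homeomorphism unfolding homeomorphism_def by blast

lemma open_chart_image:
  assumes "c \<in> M" "open W"
  shows "open (map_of_chart c ` (dom_of c \<inter> W))"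
proof -
  have "map_of_chart c ` (dom_of c \<inter> W) = map_of_chart c ` dom_of c \<inter> chart_inv c -` W"
    using chart_inv_map[OF assms(1)] by auto
  moreover have "continuous_on (map_of_chart c ` dom_of c) (chart_inv c)"
    using chart_homeomorphism[OF assms(1)] unfolding homeomorphism_def by blast
  moreover have "open (map_of_chart c ` dom_of c)"
    using atlas assms(1) unfolding oriented_atlas_def by blast
  ultimately show ?thesis
    using assms(2) by (simp add: continuous_open_preimage)
qed

lemma charts_atD: "c \<in> charts_at M p \<Longrightarrow> c \<in> M" "c \<in> charts_at M p \<Longrightarrow> p \<in> dom_of c"
  by (auto simp: charts_at_def)

lemma smooth_transition:
  "c \<in> M \<Longrightarrow> c' \<in> M \<Longrightarrow> smooth_on (map_of_chart c ` (dom_of c \<inter> dom_of c')) (transition c c')"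
  using atlas unfolding oriented_atlas_def by blast

lemma transition_map: "c \<in> charts_at M p \<Longrightarrow> transition c c' (map_of_chart c p) = map_of_chart c' p"
  by (simp add: transition_def charts_atD)

lemma has_derivative_transition:
  assumes "c \<in> charts_at M p" "c' \<in> charts_at M p"
  shows "(transition c c' has_derivative (\<lambda>h. jac c c' p *v h)) (at (map_of_chart c p))"
proof -
  have "transition c c' differentiable at (map_of_chart c p)"
    using smooth_on_differentiable[OF smooth_transition] assms by (auto simp: charts_at_def)
  then show ?thesis
    by (simp add: jac_def matrix_works linear_frechet_derivative frechet_derivative_works)
qed

text \<open>The chain rule for transition maps. The composite agrees with
  \<open>transition c c''\<close> over the common domain of \<open>c\<close> and \<open>c'\<close>,
  an open set around \<open>p\<close>, and this determines the derivative.\<close>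

lemma jac_cocycle:
  assumes c: "c \<in> charts_at M p" and c': "c' \<in> charts_at M p" and c'': "c'' \<in> charts_at M p"
  shows "jac c' c'' p ** jac c c' p = jac c c'' p"
proof -
  have "(transition c' c'' has_derivative (\<lambda>h. jac c' c'' p *v h)) (at (transition c c' (map_of_chart c p)))"
    using has_derivative_transition[OF c' c''] transition_map[OF c] by simp
  from has_derivative_compose[OF has_derivative_transition[OF c c'] this]
  have "((\<lambda>x. transition c' c'' (transition c c' x)) has_derivative
      (\<lambda>h. jac c' c'' p *v (jac c c' p *v h))) (at (map_of_chart c p))" .
  then have "(transition c c'' has_derivative (\<lambda>h. jac c' c'' p *v (jac c c' p *v h))) (at (map_of_chart c p))"
  proof (rule has_derivative_transform_within_open[where s = "map_of_chart c ` (dom_of c \<inter> dom_of c')"])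
    show "open (map_of_chart c ` (dom_of c \<inter> dom_of c'))"
      using c c' by (intro open_chart_image open_dom charts_atD)
    show "map_of_chart c p \<in> map_of_chart c ` (dom_of c \<inter> dom_of c')"
      using c c' by (auto simp: charts_at_def)
    show "transition c' c'' (transition c c' x) = transition c c'' x"
      if "x \<in> map_of_chart c ` (dom_of c \<inter> dom_of c')" for x
      using that c c' by (auto simp: transition_def charts_at_def)
  qed
  from has_derivative_unique[OF this has_derivative_transition[OF c c'']]
  have "jac c' c'' p *v (jac c c' p *v h) = jac c c'' p *v h" for h by meson
  then show ?thesis by (simp add: matrix_eq matrix_vector_mul_assoc)
qed

lemma jac_self:
  assumes c: "c \<in> charts_at M p"
  shows "jac c c p = mat 1"
proof -
  have "((\<lambda>x. x) has_derivative (\<lambda>h. jac c c p *v h)) (at (map_of_chart c p))"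
    by (rule has_derivative_transform_within_open[OF has_derivative_transition[OF c c],
          where s = "map_of_chart c ` (dom_of c \<inter> UNIV)"])
       (use c open_chart_image[of c UNIV] in \<open>auto simp: charts_at_def transition_def\<close>)
  from has_derivative_unique[OF this has_derivative_ident]
  have "jac c c p *v h = h" for h by meson
  then show ?thesis by (simp add: matrix_eq)
qed

text \<open>The entries are derivatives taken at the coordinates of \<open>c\<close>. Reading them
  in the coordinates of \<open>c1\<close> amounts to composing with
  \<open>transition c1 c\<close>.\<close>

lemma smooth_jac:
  assumes "c \<in> M" "c' \<in> M" "c1 \<in> M"
  shows "smooth_on (map_of_chart c1 ` (dom_of c1 \<inter> (dom_of c \<inter> dom_of c')))
    (\<lambda>x. jac c c' (chart_inv c1 x) $ i $ j)" (is "smooth_on ?U _")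
proof -
  let ?V = "map_of_chart c ` (dom_of c \<inter> dom_of c')"
  have U: "open ?U" and V: "open ?V"
    using assms by (intro open_chart_image open_dom open_Int; simp)+
  have D: "smooth_on ?V (\<lambda>x. frechet_derivative (transition c c') (at x) (axis j 1) $ i)"
    by (intro smooth_on_bounded_linear[OF V bounded_linear_vec_nth] smooth_on_frechet_derivative
        smooth_transition assms)
  have sub: "transition c1 c ` ?U \<subseteq> ?V"
    using assms by (auto simp: transition_def)
  have "smooth_on ?U (transition c1 c)"
    by (rule smooth_on_subset[OF smooth_transition[OF assms(3,1)]]) auto
  from smooth_on_compose[OF U V sub this D]
  have "smooth_on ?U (\<lambda>x. frechet_derivative (transition c c') (at (transition c1 c x)) (axis j 1) $ i)" .
  then show ?thesis
    by (rule smooth_on_cong[OF U, rotated]) (auto simp: jac_def matrix_def transition_def)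
qed

section \<open>Tangent vectors and induced coordinates\<close>

lemma tangent: "v \<in> A \<Longrightarrow> snd v \<in> tangent_space M (fst v)"
  using conic unfolding conic_domain_def by blast

lemma tangent_transform:
  assumes "y \<in> tangent_space M p" "c \<in> charts_at M p" "c' \<in> charts_at M p"
  shows "y c' = jac c c' p *v y c"
  using assms unfolding tangent_space_def by blast

text \<open>One component vector determines the whole family through the Jacobians, and the
  convention that the family vanishes on other charts turns this into an equality of
  functions.\<close>

lemma tcoord_inv_tcoord [simp]:
  assumes v: "v \<in> A" and c: "c \<in> charts_at M (fst v)"
  shows "tcoord_inv M c (tcoord c v) = v"
proof -
  have "(if c' \<in> charts_at M (fst v) then jac c c' (fst v) *v snd v c else 0) = snd v c'" for c'
  proof (cases "c' \<in> charts_at M (fst v)")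
    case True
    then show ?thesis using tangent_transform[OF tangent[OF v] c True] by simp
  next
    case False
    then have "snd v c' = 0" using tangent[OF v] unfolding tangent_space_def by blast
    then show ?thesis using False by simp
  qed
  then show ?thesis
    using c by (simp add: tcoord_inv_def tcoord_def charts_atD prod_eq_iff Let_def fun_eq_iff cong: if_cong)
qed

lemma open_coord_image: "c \<in> M \<Longrightarrow> open (coord_image A c)"
  using conic unfolding conic_domain_def by blast

lemma tcoord_in_coord_image: "v \<in> A \<Longrightarrow> c \<in> charts_at M (fst v) \<Longrightarrow> tcoord c v \<in> coord_image A c"
  by (auto simp: coord_image_def charts_at_def)

lemma coord_imageE:
  assumes "c \<in> M" "z \<in> coord_image A c"
  obtains v where "v \<in> A" "c \<in> charts_at M (fst v)" "z = tcoord c v"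
  using assms by (auto simp: coord_image_def charts_at_def)

lemma tcoord_inv_in: "c \<in> M \<Longrightarrow> z \<in> coord_image A c \<Longrightarrow> tcoord_inv M c z \<in> A"
  by (auto elim!: coord_imageE)

lemma charts_at_tcoord_inv: "c \<in> M \<Longrightarrow> z \<in> coord_image A c \<Longrightarrow> c \<in> charts_at M (fst (tcoord_inv M c z))"
  by (auto elim!: coord_imageE)

lemma tcoord_tcoord_inv: "c \<in> M \<Longrightarrow> z \<in> coord_image A c \<Longrightarrow> tcoord c (tcoord_inv M c z) = z"
  by (auto elim!: coord_imageE)

text \<open>The cocycle rule makes the Jacobian images of \<open>a\<close> a consistent family. Used
  with basis vectors, it turns statements about all tangent vectors into statements about
  components.\<close>

lemma tangent_vector_exists:
  assumes c: "c \<in> charts_at M p"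
  obtains y where "y \<in> tangent_space M p" "y c = a"
proof
  let ?y = "\<lambda>c'. if c' \<in> charts_at M p then jac c c' p *v a else 0"
  show "?y \<in> tangent_space M p"
    using c by (auto simp: tangent_space_def matrix_vector_mul_assoc jac_cocycle)
  show "?y c = a" using c by (simp add: jac_self)
qed

section \<open>Components of anisotropic tensor fields\<close>

lemma tensor_fields_zero:
  "T \<in> tensor_fields M A r s \<Longrightarrow>
    \<not> (v \<in> A \<and> c \<in> charts_at M (fst v) \<and> length I = r \<and> length J = s) \<Longrightarrow> T v c I J = 0"
  unfolding tensor_fields_def by blast

lemma tensor_fields_transform:
  "T \<in> tensor_fields M A r s \<Longrightarrow> v \<in> A \<Longrightarrow> c \<in> charts_at M (fst v) \<Longrightarrow> c' \<in> charts_at M (fst v) \<Longrightarrow>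
    length I = r \<Longrightarrow> length J = s \<Longrightarrow>
    T v c' I J = (\<Sum>K | length K = r. \<Sum>H | length H = s.
          (\<Prod>a<r. jac c c' (fst v) $ (I ! a) $ (K ! a)) *
          (\<Prod>b<s. jac c' c (fst v) $ (H ! b) $ (J ! b)) * T v c K H)"
  unfolding tensor_fields_def by blast

lemma tensor_fields_smooth:
  "T \<in> tensor_fields M A r s \<Longrightarrow> c \<in> M \<Longrightarrow> smooth_on (coord_image A c) (\<lambda>z. T (tcoord_inv M c z) c I J)"
  unfolding tensor_fields_def by blast

lemma vector_transform:
  assumes "X \<in> tensor_fields M A 1 0" "v \<in> A" "c \<in> charts_at M (fst v)" "c' \<in> charts_at M (fst v)"
  shows "X v c' [i] [] = (\<Sum>k\<in>UNIV. jac c c' (fst v) $ i $ k * X v c [k] [])"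
  using tensor_fields_transform[OF assms, of "[i]" "[]"] by (simp add: sum_lists_Suc)

lemma scalar_transform:
  assumes "f \<in> tensor_fields M A 0 0" "v \<in> A" "c \<in> charts_at M (fst v)" "c' \<in> charts_at M (fst v)"
  shows "f v c' [] [] = f v c [] []"
  using tensor_fields_transform[OF assms, of "[]" "[]"] by simp

text \<open>It suffices to extend by a bump function on the manifold: the extension does not depend on the
  direction.\<close>
lemma vector_field_extension:
  assumes v: "v \<in> A" and c: "c \<in> charts_at M (fst v)"
  obtains Y where "Y \<in> tensor_fields M A 1 0" "\<And>l. Y v c [l] [] = a $ l"
proof -
  note cM = charts_atD[OF c]
  let ?x0 = "map_of_chart c (fst v)"
  have "open (map_of_chart c ` (dom_of c \<inter> UNIV))"
    using open_chart_image[OF cM(1) open_UNIV] .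
  then obtain r where r: "r > 0" "cball ?x0 r \<subseteq> map_of_chart c ` dom_of c"
    using cM(2) open_contains_cball by (metis imageI inf_top.right_neutral)
  obtain \<beta> where \<beta>: "smooth_on UNIV \<beta>" "\<beta> ?x0 = 1" "\<And>x. x \<notin> cball ?x0 r \<Longrightarrow> \<beta> x = (0::real)"
    using smooth_bump[OF r(1)] by blast
  define K where "K = chart_inv c ` cball ?x0 r"
  have "continuous_on (map_of_chart c ` dom_of c) (chart_inv c)"
    using chart_homeomorphism[OF cM(1)] unfolding homeomorphism_def by blast
  from compact_continuous_image[OF continuous_on_subset[OF this r(2)] compact_cball]
  have "compact K" unfolding K_def .
  \<comment> \<open>The Hausdorff property enters here: the compact set \<open>K\<close> is closed,
    so its complement, where the field will vanish, is open.\<close>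
  then have clK: "closed K" by (rule compact_imp_closed)
  have K: "K \<subseteq> dom_of c"
  proof
    fix q assume "q \<in> K"
    then obtain x where "x \<in> cball ?x0 r" "q = chart_inv c x" unfolding K_def by blast
    then show "q \<in> dom_of c" using r(2) chart_inv_map[OF cM(1)] by auto
  qed
  have \<beta>0: "\<beta> (map_of_chart c p) = 0" if "p \<in> dom_of c" "p \<notin> K" for p
  proof (rule \<beta>(3))
    show "map_of_chart c p \<notin> cball ?x0 r"
      using that chart_inv_map[OF cM(1) that(1)] unfolding K_def by (metis imageI)
  qed
  \<comment> \<open>In the chart \<open>c\<close> the components are the constant vector
    \<open>a\<close> times the bump function. The value 0 off \<open>dom_of c\<close> fits, since
    the bump already vanishes on \<open>dom_of c\<close> outside \<open>K\<close>.\<close>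
  define Y :: "('m, 'n) tensor" where "Y = (\<lambda>u c' I J.
    if u \<in> A \<and> c' \<in> charts_at M (fst u) \<and> length I = 1 \<and> length J = 0 \<and> fst u \<in> dom_of c
    then \<beta> (map_of_chart c (fst u)) * (jac c c' (fst u) *v a) $ (I ! 0) else 0)"
  have "Y \<in> tensor_fields M A 1 0"
    unfolding tensor_fields_def mem_Collect_eq
  proof (intro conjI allI ballI impI)
    show "Y u c' I J = 0" if "\<not> (u \<in> A \<and> c' \<in> charts_at M (fst u) \<and> length I = 1 \<and> length J = 0)" for u c' I J
      using that by (auto simp: Y_def)
  next
    fix u c1 c2 and I J :: "'n list"
    assume u: "u \<in> A" "c1 \<in> charts_at M (fst u)" "c2 \<in> charts_at M (fst u)" "length I = 1" "length J = 0"
    then obtain i where i: "I = [i]" by (auto simp: length_Suc_conv)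
    have "Y u c2 [i] [] = (\<Sum>k\<in>UNIV. jac c1 c2 (fst u) $ i $ k * Y u c1 [k] [])"
    proof (cases "fst u \<in> dom_of c")
      case True
      then have "c \<in> charts_at M (fst u)" using cM by (simp add: charts_at_def)
      then have "jac c c2 (fst u) *v a = jac c1 c2 (fst u) *v (jac c c1 (fst u) *v a)"
        using jac_cocycle u by (simp add: matrix_vector_mul_assoc)
      then show ?thesis
        using True u by (simp add: Y_def matrix_vector_mult_def[of "jac c1 c2 _"] sum_distrib_left mult_ac)
    qed (simp add: Y_def)
    then show "Y u c2 I J = (\<Sum>K | length K = 1. \<Sum>H | length H = 0.
          (\<Prod>a<1. jac c1 c2 (fst u) $ (I ! a) $ (K ! a)) *
          (\<Prod>b<0. jac c2 c1 (fst u) $ (H ! b) $ (J ! b)) * Y u c1 K H)"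
      using i u by (simp add: sum_lists_Suc)
  next
    fix c1 and I J :: "'n list"
    assume c1: "c1 \<in> M"
    show "smooth_on (coord_image A c1) (\<lambda>z. Y (tcoord_inv M c1 z) c1 I J)"
    proof (rule smooth_on_locally)
      fix z assume z: "z \<in> coord_image A c1"
      let ?U = "\<lambda>W. coord_image A c1 \<inter> map_of_chart c1 ` (dom_of c1 \<inter> W) \<times> UNIV"
      have U: "open (?U W)" if "open W" for W
        using that c1 by (intro open_Int open_coord_image open_Times open_chart_image) auto
      have fst_inv: "fst (tcoord_inv M c1 z) = chart_inv c1 (fst z)" for z
        by (simp add: tcoord_inv_def Let_def)
      let ?p = "chart_inv c1 (fst z)"
      have zU: "z \<in> ?U W" if "?p \<in> W" for W
        using z that c1 by (auto elim!: coord_imageE simp: tcoord_def charts_at_def)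
      show "\<exists>U. open U \<and> z \<in> U \<and> smooth_on U (\<lambda>z. Y (tcoord_inv M c1 z) c1 I J)"
      \<comment> \<open>Near a base point in \<open>dom_of c\<close> the components are a product of
        smooth functions. A base point outside \<open>dom_of c\<close> also lies outside
        \<open>K\<close>, and the components vanish over the open complement of
        \<open>K\<close>.\<close>
      proof (cases "length I = 1 \<and> length J = 0 \<and> ?p \<in> dom_of c")
        case False
        show ?thesis
        proof (cases "length I = 1 \<and> length J = 0")
          case False
          then have "(\<lambda>z. Y (tcoord_inv M c1 z) c1 I J) = (\<lambda>z. 0)" by (auto simp: Y_def)
          then show ?thesis by (intro exI[of _ UNIV]) simp
        next
          case True
          then have p: "?p \<notin> K" using False K by auto
          have op: "open (?U (- K))" using clK by (intro U) auto
          have "smooth_on (?U (- K)) (\<lambda>z. Y (tcoord_inv M c1 z) c1 I J)"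
            by (rule smooth_on_cong[OF op _ smooth_on_const[of _ 0]])
               (use \<beta>0 c1 in \<open>auto simp: Y_def fst_inv\<close>)
          then show ?thesis using op zU p by (intro exI[of _ "?U (- K)"]) auto
        qed
      next
        case True
        have op: "open (?U (dom_of c))" using open_dom cM(1) by (intro U) auto
        have sub: "fst ` ?U (dom_of c) \<subseteq> map_of_chart c1 ` (dom_of c1 \<inter> dom_of c)" by auto
        have sf: "smooth_on (?U (dom_of c)) (\<lambda>z. f (fst z))"
          if "smooth_on (map_of_chart c1 ` (dom_of c1 \<inter> dom_of c)) f" for f :: "real^'n \<Rightarrow> 'z::real_normed_vector"
          using smooth_on_compose[OF op open_chart_image[OF c1 open_dom[OF cM(1)]] sub
              smooth_on_bounded_linear[OF op bounded_linear_fst smooth_on_id[OF op]] that] .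
        let ?G = "\<lambda>z. \<beta> (transition c1 c (fst z)) * (\<Sum>j\<in>UNIV. jac c c1 (chart_inv c1 (fst z)) $ (I ! 0) $ j * a $ j)"
        have "smooth_on (?U (dom_of c)) ?G"
        proof (intro smooth_on_mult smooth_on_sum op smooth_on_const)
          show "smooth_on (?U (dom_of c)) (\<lambda>z. \<beta> (transition c1 c (fst z)))"
            using smooth_on_compose[OF op open_UNIV subset_UNIV sf[OF smooth_transition[OF c1 cM(1)]] \<beta>(1)] .
          fix j
          have "map_of_chart c1 ` (dom_of c1 \<inter> dom_of c) = map_of_chart c1 ` (dom_of c1 \<inter> (dom_of c \<inter> dom_of c1))"
            by auto
          then show "smooth_on (?U (dom_of c)) (\<lambda>z. jac c c1 (chart_inv c1 (fst z)) $ (I ! 0) $ j)"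
            using sf[OF _, of "\<lambda>x. jac c c1 (chart_inv c1 x) $ (I ! 0) $ j"]
              smooth_jac[OF cM(1) c1 c1, of "I ! 0" j] by simp
        qed
        then have "smooth_on (?U (dom_of c)) (\<lambda>z. Y (tcoord_inv M c1 z) c1 I J)"
        proof (rule smooth_on_cong[OF op, rotated])
          fix z assume z: "z \<in> ?U (dom_of c)"
          then have "chart_inv c1 (fst z) \<in> dom_of c" using c1 by auto
          moreover have "tcoord_inv M c1 z \<in> A" "c1 \<in> charts_at M (chart_inv c1 (fst z))"
            using tcoord_inv_in[OF c1] charts_at_tcoord_inv[OF c1] z by (auto simp flip: fst_inv)
          ultimately show "?G z = Y (tcoord_inv M c1 z) c1 I J"
            using True by (simp add: Y_def fst_inv transition_def matrix_vector_mult_def)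
        qed
        then show ?thesis using op zU True by (intro exI[of _ "?U (dom_of c)"]) auto
      qed
    qed
  qed
  moreover have "Y v c [l] [] = a $ l" for l
    using v c cM \<beta>(2) by (simp add: Y_def jac_self)
  ultimately show ?thesis using that by blast
qed

text \<open>Composed from \<open>tensor_prod\<close> and \<open>contract\<close> so that the two
  axioms of a tensor derivation apply to it directly. It lowers the number of covariant slots by
  one.\<close>

definition interior :: "('m, 'n) tensor \<Rightarrow> ('m, 'n) tensor \<Rightarrow> ('m, 'n) tensor" where
  "interior X T = contract 0 0 (tensor_prod 1 0 X T)"

lemma interior_eq: "interior X T v c I J = (\<Sum>k\<in>UNIV. X v c [k] [] * T v c I (k # J))"
  by (simp add: interior_def contract_def tensor_prod_def)

lemma tensor_prod_vector_field:
  assumes X: "X \<in> tensor_fields M A 1 0" and T: "T \<in> tensor_fields M A r s"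
  shows "tensor_prod 1 0 X T \<in> tensor_fields M A (Suc r) s"
  unfolding tensor_fields_def mem_Collect_eq
proof (intro conjI allI ballI impI)
  show "tensor_prod 1 0 X T v c I J = 0"
    if "\<not> (v \<in> A \<and> c \<in> charts_at M (fst v) \<and> length I = Suc r \<and> length J = s)" for v c I J
  proof (cases I)
    case Nil
    then show ?thesis using tensor_fields_zero[OF X] by (simp add: tensor_prod_def)
  next
    case (Cons i I')
    then show ?thesis using tensor_fields_zero[OF T] that by (auto simp: tensor_prod_def)
  qed
next
  fix v c c' and I J :: "'n list"
  assume *: "v \<in> A" "c \<in> charts_at M (fst v)" "c' \<in> charts_at M (fst v)" "length I = Suc r" "length J = s"
  then obtain i I' where I: "I = i # I'" "length I' = r" by (auto simp: length_Suc_conv)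
  show "tensor_prod 1 0 X T v c' I J = (\<Sum>K | length K = Suc r. \<Sum>H | length H = s.
          (\<Prod>a<Suc r. jac c c' (fst v) $ (I ! a) $ (K ! a)) *
          (\<Prod>b<s. jac c' c (fst v) $ (H ! b) $ (J ! b)) * tensor_prod 1 0 X T v c K H)"
    unfolding sum_lists_Suc I(1) prod_lists_Suc[of "\<lambda>i k. jac c c' (fst v) $ i $ k"]
    using vector_transform[OF X *(1-3), of i] tensor_fields_transform[OF T *(1-3) I(2) *(5)]
    by (simp add: tensor_prod_def sum_distrib_left sum_distrib_right sum_product mult_ac)
next
  fix c and I J :: "'n list"
  assume "c \<in> M"
  then show "smooth_on (coord_image A c) (\<lambda>z. tensor_prod 1 0 X T (tcoord_inv M c z) c I J)"
    unfolding tensor_prod_def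
    by (intro smooth_on_mult open_coord_image tensor_fields_smooth[OF X] tensor_fields_smooth[OF T])
qed

lemma interior_vector_field:
  assumes X: "X \<in> tensor_fields M A 1 0" and T: "T \<in> tensor_fields M A r (Suc s)"
  shows "interior X T \<in> tensor_fields M A r s"
  unfolding tensor_fields_def mem_Collect_eq
proof (intro conjI allI ballI impI)
  show "interior X T v c I J = 0"
    if "\<not> (v \<in> A \<and> c \<in> charts_at M (fst v) \<and> length I = r \<and> length J = s)" for v c I J
    using that tensor_fields_zero[OF T] by (auto simp: interior_eq)
next
  fix v c c' and I J :: "'n list"
  assume *: "v \<in> A" "c \<in> charts_at M (fst v)" "c' \<in> charts_at M (fst v)" "length I = r" "length J = s"
  let ?B = "jac c' c (fst v)" and ?B' = "jac c c' (fst v)"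
  let ?P = "\<lambda>K. \<Prod>a<r. ?B' $ (I ! a) $ (K ! a)" and ?Q = "\<lambda>H. \<Prod>b<s. ?B $ (H ! b) $ (J ! b)"
  \<comment> \<open>The Jacobian of the slot filled by \<open>X\<close> turns the components of
    \<open>X\<close> in \<open>c'\<close> into those in \<open>c\<close>. Only the free slots keep a
    Jacobian factor.\<close>
  have inv: "(\<Sum>k\<in>UNIV. ?B $ h $ k * X v c' [k] []) = X v c [h] []" for h
    using vector_transform[OF X *(1,3,2)] by simp
  have "T v c' I (k # J) = (\<Sum>K | length K = r. \<Sum>h\<in>UNIV. \<Sum>H | length H = s.
      ?B $ h $ k * (?P K * ?Q H * T v c K (h # H)))" for k
    using tensor_fields_transform[OF T *(1-4), of "k # J"] *(5)
    by (simp add: sum_lists_Suc prod_lists_Suc[of "\<lambda>i k. ?B $ i $ k"] mult_ac del: prod.lessThan_Suc)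
  then have "interior X T v c' I J = (\<Sum>k\<in>UNIV. \<Sum>K | length K = r. \<Sum>h\<in>UNIV. \<Sum>H | length H = s.
      ?B $ h $ k * X v c' [k] [] * (?P K * ?Q H * T v c K (h # H)))"
    by (simp add: interior_eq sum_distrib_left mult_ac)
  also have "\<dots> = (\<Sum>K | length K = r. \<Sum>k\<in>UNIV. \<Sum>H | length H = s. \<Sum>h\<in>UNIV.
      ?B $ h $ k * X v c' [k] [] * (?P K * ?Q H * T v c K (h # H)))"
    by (subst sum.swap) (intro sum.cong refl sum.swap)
  also have "\<dots> = (\<Sum>K | length K = r. \<Sum>H | length H = s. \<Sum>h\<in>UNIV. \<Sum>k\<in>UNIV.
      ?B $ h $ k * X v c' [k] [] * (?P K * ?Q H * T v c K (h # H)))"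
    by (intro sum.cong refl, subst sum.swap) (intro sum.cong refl sum.swap)
  also have "\<dots> = (\<Sum>K | length K = r. \<Sum>H | length H = s. \<Sum>h\<in>UNIV. X v c [h] [] * (?P K * ?Q H * T v c K (h # H)))"
    by (simp only: sum_distrib_right[symmetric] inv)
  also have "\<dots> = (\<Sum>K | length K = r. \<Sum>H | length H = s. ?P K * ?Q H * interior X T v c K H)"
    by (simp add: interior_eq sum_distrib_left mult_ac)
  finally show "interior X T v c' I J = (\<Sum>K | length K = r. \<Sum>H | length H = s. ?P K * ?Q H * interior X T v c K H)" .
next
  fix c and I J :: "'n list"
  assume "c \<in> M"
  then show "smooth_on (coord_image A c) (\<lambda>z. interior X T (tcoord_inv M c z) c I J)"
    unfolding interior_eq
    by (intro smooth_on_sum smooth_on_mult open_coord_image tensor_fields_smooth[OF X] tensor_fields_smooth[OF T])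
qed

lemma tensor_derivation_interior:
  assumes D: "tensor_derivation M A D"
    and X: "X \<in> tensor_fields M A 1 0" and T: "T \<in> tensor_fields M A r (Suc s)"
  shows "D (interior X T) v c I J = interior (D X) T v c I J + interior X (D T) v c I J"
proof -
  have "D (interior X T) = contract 0 0 (D (tensor_prod 1 0 X T))"
    using D tensor_prod_vector_field[OF X T] unfolding interior_def tensor_derivation_def by blast
  moreover have "D (tensor_prod 1 0 X T)
      = (\<lambda>v c I J. tensor_prod 1 0 (D X) T v c I J + tensor_prod 1 0 X (D T) v c I J)"
    using D X T unfolding tensor_derivation_def by blast
  ultimately show ?thesis
    by (simp add: interior_eq contract_def tensor_prod_def sum.distrib)
qed

text \<open>For a tensor with one covariant slot, applying it to \<open>X\<close> is the interior
  product with \<open>X\<close>. The divergence of T(X) is computed from a Lie bracket, which asks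
  for T(X) to be a field.\<close>

lemma endo_apply_vector_field:
  assumes T: "T \<in> tensor_fields M A 1 1" and X: "X \<in> tensor_fields M A 1 0"
  shows "endo_apply T X \<in> tensor_fields M A 1 0"
proof -
  have "endo_apply T X = interior X T"
    using tensor_fields_zero[OF T]
    by (intro ext) (auto simp: endo_apply_def interior_eq mult.commute)
  then show ?thesis using interior_vector_field[OF X, of T 1 0] T by simp
qed

end

section \<open>Horizontal derivatives\<close>

lemma sum_axis: "(\<Sum>a\<in>UNIV. axis i 1 $ a * f a) = (f i :: real)"
  by (simp add: axis_def if_distrib[of "\<lambda>x. x * _"] cong: if_cong)

context anisotropic_domain
begin

text \<open>Tied to one chart, because component functions \<open>\<lambda>u. T u c I J\<close>
  belong to \<open>c\<close> and are 0 by convention at points over which \<open>c\<close> is not a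
  chart.\<close>

definition smooth_in :: "('m, 'n) chart \<Rightarrow> (('m, 'n) tbundle \<Rightarrow> real) \<Rightarrow> bool" where
  "smooth_in c f \<longleftrightarrow> smooth_on (coord_image A c) (\<lambda>z. f (tcoord_inv M c z))"

lemma smooth_in_tensor: "T \<in> tensor_fields M A r s \<Longrightarrow> c \<in> M \<Longrightarrow> smooth_in c (\<lambda>u. T u c I J)"
  by (simp add: smooth_in_def tensor_fields_smooth)

lemma smooth_in_const: "smooth_in c (\<lambda>u. a)"
  by (simp add: smooth_in_def)

lemma smooth_in_mult: "c \<in> M \<Longrightarrow> smooth_in c f \<Longrightarrow> smooth_in c g \<Longrightarrow> smooth_in c (\<lambda>u. f u * g u)"
  unfolding smooth_in_def by (intro smooth_on_mult open_coord_image)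

lemma smooth_in_sum: "c \<in> M \<Longrightarrow> (\<And>i. i \<in> I \<Longrightarrow> smooth_in c (f i)) \<Longrightarrow> smooth_in c (\<lambda>u. \<Sum>i\<in>I. f i u)"
  unfolding smooth_in_def by (intro smooth_on_sum open_coord_image)

lemma smooth_in_prod: "c \<in> M \<Longrightarrow> (\<And>i. i \<in> I \<Longrightarrow> smooth_in c (f i)) \<Longrightarrow> smooth_in c (\<lambda>u. \<Prod>i\<in>I. f i u)"
  unfolding smooth_in_def by (intro smooth_on_prod open_coord_image)

lemma smooth_in_compose:
  assumes "c \<in> M" "smooth_in c f" "open S" "smooth_on S (g :: real \<Rightarrow> real)"
    and "\<And>u. u \<in> A \<Longrightarrow> c \<in> charts_at M (fst u) \<Longrightarrow> f u \<in> S"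
  shows "smooth_in c (\<lambda>u. g (f u))"
proof -
  have "(\<lambda>z. f (tcoord_inv M c z)) ` coord_image A c \<subseteq> S"
    using assms(5) tcoord_inv_in[OF assms(1)] charts_at_tcoord_inv[OF assms(1)] by blast
  from smooth_on_compose[OF open_coord_image[OF assms(1)] assms(3) this _ assms(4)] assms(2)
  show ?thesis by (simp add: smooth_in_def)
qed

lemma smooth_in_cong:
  assumes "c \<in> M" "\<And>u. u \<in> A \<Longrightarrow> c \<in> charts_at M (fst u) \<Longrightarrow> f u = g u" "smooth_in c f"
  shows "smooth_in c g"
  using assms(3) unfolding smooth_in_def
  by (rule smooth_on_cong[OF open_coord_image[OF assms(1)], rotated])
     (use assms(1,2) tcoord_inv_in charts_at_tcoord_inv in blast)

lemma smooth_in_dy: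
  assumes "c \<in> M" "smooth_in c f"
  shows "smooth_in c (dy M c i f)"
proof -
  have "smooth_on (coord_image A c)
      (\<lambda>z. frechet_derivative (\<lambda>z. f (tcoord_inv M c z)) (at z) (0, axis i 1))"
    using assms(2) unfolding smooth_in_def by (rule smooth_on_frechet_derivative)
  then show ?thesis unfolding smooth_in_def
    by (rule smooth_on_cong[OF open_coord_image[OF assms(1)], rotated])
       (simp add: dy_def tcoord_tcoord_inv[OF assms(1)] o_def)
qed

text \<open>Turns derivatives in the induced coordinates into derivatives of real functions of one
  variable, to which the usual differentiation rules apply.\<close>

lemma has_derivative_line:
  assumes v: "v \<in> A" and c: "c \<in> charts_at M (fst v)" and f: "smooth_in c f"
  shows "((\<lambda>t. f (tcoord_inv M c (tcoord c v + t *\<^sub>R h))) has_real_derivative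
    frechet_derivative (f \<circ> tcoord_inv M c) (at (tcoord c v)) h) (at 0)"
    and "linear (frechet_derivative (f \<circ> tcoord_inv M c) (at (tcoord c v)))"
proof -
  let ?F = "f \<circ> tcoord_inv M c" and ?z = "tcoord c v"
  have d: "?F differentiable (at ?z)"
    using smooth_on_differentiable[OF f[unfolded smooth_in_def] tcoord_in_coord_image[OF v c]]
    by (simp add: o_def)
  then show lin: "linear (frechet_derivative ?F (at ?z))" by (rule linear_frechet_derivative)
  have "(?F has_derivative frechet_derivative ?F (at ?z)) (at (?z + 0 *\<^sub>R h))"
    using d[unfolded frechet_derivative_works] by simp
  moreover have "((\<lambda>t. ?z + t *\<^sub>R h) has_derivative (\<lambda>r. r *\<^sub>R h)) (at 0)"
    by (auto intro!: derivative_eq_intros)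
  ultimately have "((\<lambda>t. ?F (?z + t *\<^sub>R h)) has_derivative (\<lambda>r. frechet_derivative ?F (at ?z) (r *\<^sub>R h))) (at 0)"
    using has_derivative_compose by blast
  then show "((\<lambda>t. f (tcoord_inv M c (?z + t *\<^sub>R h))) has_real_derivative frechet_derivative ?F (at ?z) h) (at 0)"
    by (simp add: has_field_derivative_def linear_scale[OF lin] mult.commute[of _ "frechet_derivative _ _ _"] mult_commute_abs)
qed

text \<open>The coordinate vector of the horizontal field \<open>\<delta>\<^sub>k\<close> at
  \<open>v\<close>. Through it \<open>delta\<close> is a single directional derivative, and its
  product, sum and chain rules follow from those along a line.\<close>

definition horizontal_lift ::
  "(('m, 'n) tbundle \<Rightarrow> real) \<Rightarrow> ('m, 'n) chart \<Rightarrow> ('m, 'n) tbundle \<Rightarrow> 'n \<Rightarrow> (real^'n) \<times> (real^'n)" where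
  "horizontal_lift L c v k = (axis k 1, 0) - (\<Sum>j\<in>UNIV. nonlin_conn M L c v j k *\<^sub>R (0, axis j 1))"

lemma has_derivative_delta:
  assumes v: "v \<in> A" and c: "c \<in> charts_at M (fst v)" and f: "smooth_in c f"
  shows "((\<lambda>t. f (tcoord_inv M c (tcoord c v + t *\<^sub>R horizontal_lift L c v k))) has_real_derivative
    delta M L c k f v) (at 0)"
proof -
  note lin = has_derivative_line(2)[OF assms]
  have "frechet_derivative (f \<circ> tcoord_inv M c) (at (tcoord c v)) (horizontal_lift L c v k) = delta M L c k f v"
    by (simp add: horizontal_lift_def delta_def dx_def dy_def linear_diff[OF lin] linear_sum[OF lin]
        linear_scale[OF lin] del: scaleR_Pair)
  then show ?thesis using has_derivative_line(1)[OF assms, of "horizontal_lift L c v k"] by simp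
qed

lemma delta_unique:
  assumes "v \<in> A" "c \<in> charts_at M (fst v)" "smooth_in c f"
    and "((\<lambda>t. f (tcoord_inv M c (tcoord c v + t *\<^sub>R horizontal_lift L c v k))) has_real_derivative D) (at 0)"
  shows "delta M L c k f v = D"
  using DERIV_unique[OF has_derivative_delta[OF assms(1-3)] assms(4)] .

lemma delta_const [simp]: "delta M L c k (\<lambda>u. a) v = 0"
  by (simp add: delta_def dx_def dy_def o_def)

lemma delta_mult:
  assumes v: "v \<in> A" and c: "c \<in> charts_at M (fst v)" and f: "smooth_in c f" and g: "smooth_in c g"
  shows "delta M L c k (\<lambda>u. f u * g u) v = delta M L c k f v * g v + f v * delta M L c k g v"
proof (rule delta_unique[OF v c smooth_in_mult[OF charts_atD(1)[OF c] f g]])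
  show "((\<lambda>t. f (tcoord_inv M c (tcoord c v + t *\<^sub>R horizontal_lift L c v k)) *
             g (tcoord_inv M c (tcoord c v + t *\<^sub>R horizontal_lift L c v k))) has_real_derivative
        delta M L c k f v * g v + f v * delta M L c k g v) (at 0)"
    using DERIV_mult[OF has_derivative_delta[OF v c f] has_derivative_delta[OF v c g]] v c
    by (simp add: algebra_simps)
qed

lemma delta_sum:
  assumes v: "v \<in> A" and c: "c \<in> charts_at M (fst v)" and f: "\<And>i. i \<in> I \<Longrightarrow> smooth_in c (f i)"
  shows "delta M L c k (\<lambda>u. \<Sum>i\<in>I. f i u) v = (\<Sum>i\<in>I. delta M L c k (f i) v)"
  by (rule delta_unique[OF v c smooth_in_sum[OF charts_atD(1)[OF c] f]])
     (auto intro!: DERIV_sum has_derivative_delta v c f)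

lemma delta_compose:
  assumes v: "v \<in> A" and c: "c \<in> charts_at M (fst v)" and f: "smooth_in c f" and gf: "smooth_in c (\<lambda>u. g (f u))"
    and g: "(g has_real_derivative D) (at (f v))"
  shows "delta M L c k (\<lambda>u. g (f u)) v = D * delta M L c k f v"
proof (rule delta_unique[OF v c gf])
  show "((\<lambda>t. g (f (tcoord_inv M c (tcoord c v + t *\<^sub>R horizontal_lift L c v k)))) has_real_derivative
      D * delta M L c k f v) (at 0)"
    by (rule DERIV_chain2[OF _ has_derivative_delta[OF v c f]]) (use g v c in simp)
qed

text \<open>A derivative sees only an open neighbourhood, here the coordinate image of
  \<open>A\<close>. This replaces components, which carry conventions outside their domain, by plain
  formulas.\<close>

lemma delta_cong:
  assumes v: "v \<in> A" and c: "c \<in> charts_at M (fst v)" and f: "smooth_in c f"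
    and eq: "\<And>u. u \<in> A \<Longrightarrow> c \<in> charts_at M (fst u) \<Longrightarrow> f u = g u"
  shows "delta M L c k f v = delta M L c k g v"
proof -
  have "frechet_derivative (f \<circ> tcoord_inv M c) (at (tcoord c v))
      = frechet_derivative (g \<circ> tcoord_inv M c) (at (tcoord c v))"
  proof (rule frechet_derivative_transform_within_open)
    show "f \<circ> tcoord_inv M c differentiable at (tcoord c v)"
      using smooth_on_differentiable[OF f[unfolded smooth_in_def] tcoord_in_coord_image[OF v c]]
      by (simp add: o_def)
    show "open (coord_image A c)" by (rule open_coord_image[OF charts_atD(1)[OF c]])
    show "tcoord c v \<in> coord_image A c" by (rule tcoord_in_coord_image[OF v c])
    show "(f \<circ> tcoord_inv M c) z = (g \<circ> tcoord_inv M c) z" if "z \<in> coord_image A c" for z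
      using eq tcoord_inv_in[OF charts_atD(1)[OF c] that] charts_at_tcoord_inv[OF charts_atD(1)[OF c] that]
      by simp
  qed
  then show ?thesis by (simp add: delta_def dx_def dy_def)
qed

text \<open>Both sides are derivations, so the induction on the number of slots only has to match the
  Leibniz rule for the contraction with a vector field extending a coordinate vector at \<open>v\<close>.\<close>
lemma lie_bracket_covariant:
  assumes D: "anisotropic_lie_bracket M A L Z D" and Z: "Z \<in> tensor_fields M A 1 0"
    and v: "v \<in> A" and c: "c \<in> charts_at M (fst v)"
  shows "T \<in> tensor_fields M A 0 s \<Longrightarrow> length J = s \<Longrightarrow>
    D T v c [] J = (\<Sum>k\<in>UNIV. Z v c [k] [] * delta M L c k (\<lambda>u. T u c [] J) v)
      + (\<Sum>m<s. \<Sum>l\<in>UNIV. delta M L c (J ! m) (\<lambda>u. Z u c [l] []) v * T v c [] (J[m := l]))"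
proof (induction s arbitrary: T J)
  case 0
  then show ?case using D v c unfolding anisotropic_lie_bracket_def by simp
next
  case (Suc s)
  then obtain i J' where J: "J = i # J'" and J': "length J' = s" by (auto simp: length_Suc_conv)
  note cM = charts_atD(1)[OF c]
  note T = Suc.prems(1)
  \<comment> \<open>\<open>Y\<close> has at \<open>v\<close> the value of the coordinate vector of
    the first index \<open>i\<close>. Its derivatives at \<open>v\<close> are unknown: they enter
    once through the formula for \<open>interior Y T\<close> and once through \<open>D Y\<close>,
    and cancel.\<close>
  obtain Y where Y: "Y \<in> tensor_fields M A 1 0" "\<And>l. Y v c [l] [] = axis i 1 $ l"
    using vector_field_extension[OF v c] by blast
  have Yv: "(\<Sum>l\<in>UNIV. Y v c [l] [] * f l) = f i" for f
    by (simp add: Y(2) sum_axis)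
  let ?d = "\<lambda>k f. delta M L c k f v"
  have deriv: "tensor_derivation M A D" using D unfolding anisotropic_lie_bracket_def by blast
  have int: "interior Y T v c [] K = T v c [] (i # K)" for K
    using Yv[of "\<lambda>k. T v c [] (k # K)"] by (simp add: interior_eq)
  have "?d k (\<lambda>u. interior Y T u c [] J')
      = (\<Sum>a\<in>UNIV. ?d k (\<lambda>u. Y u c [a] []) * T v c [] (a # J')) + ?d k (\<lambda>u. T u c [] (i # J'))" for k
    unfolding interior_eq
    using Yv[of "\<lambda>a. ?d k (\<lambda>u. T u c [] (a # J'))"]
    by (simp add: delta_sum[OF v c] delta_mult[OF v c] smooth_in_mult[OF cM] smooth_in_tensor[OF Y(1) cM]
        smooth_in_tensor[OF T cM] sum.distrib)
  then have L1: "D (interior Y T) v c [] J' =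
      (\<Sum>k\<in>UNIV. Z v c [k] [] * (\<Sum>a\<in>UNIV. ?d k (\<lambda>u. Y u c [a] []) * T v c [] (a # J')))
    + (\<Sum>k\<in>UNIV. Z v c [k] [] * ?d k (\<lambda>u. T u c [] (i # J')))
    + (\<Sum>m<s. \<Sum>l\<in>UNIV. ?d (J' ! m) (\<lambda>u. Z u c [l] []) * T v c [] (i # J'[m := l]))"
    using Suc.IH[OF interior_vector_field[OF Y(1) T] J'] by (simp add: int algebra_simps sum.distrib)
  have "D Y v c [a] [] = (\<Sum>k\<in>UNIV. Z v c [k] [] * ?d k (\<lambda>u. Y u c [a] [])) - ?d i (\<lambda>u. Z u c [a] [])" for a
  proof -
    have "D Y v c [a] [] = (\<Sum>k\<in>UNIV. Z v c [k] [] * ?d k (\<lambda>u. Y u c [a] []) - Y v c [k] [] * ?d k (\<lambda>u. Z u c [a] []))"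
      using D Y(1) v c unfolding anisotropic_lie_bracket_def by blast
    then show ?thesis using Yv[of "\<lambda>k. ?d k (\<lambda>u. Z u c [a] [])"] by (simp add: sum_subtractf)
  qed
  then have "D (interior Y T) v c [] J' = (\<Sum>a\<in>UNIV. \<Sum>k\<in>UNIV. Z v c [k] [] * ?d k (\<lambda>u. Y u c [a] []) * T v c [] (a # J'))
     - (\<Sum>a\<in>UNIV. ?d i (\<lambda>u. Z u c [a] []) * T v c [] (a # J')) + D T v c [] (i # J')"
    using tensor_derivation_interior[OF deriv Y(1) T, of v c "[]" J'] Yv[of "\<lambda>k. D T v c [] (k # J')"]
    by (simp add: interior_eq left_diff_distrib sum_subtractf sum_distrib_right)
  moreover have "(\<Sum>a\<in>UNIV. \<Sum>k\<in>UNIV. Z v c [k] [] * ?d k (\<lambda>u. Y u c [a] []) * T v c [] (a # J'))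
    = (\<Sum>k\<in>UNIV. Z v c [k] [] * (\<Sum>a\<in>UNIV. ?d k (\<lambda>u. Y u c [a] []) * T v c [] (a # J')))"
    by (subst sum.swap) (simp add: sum_distrib_left mult_ac)
  ultimately have "D T v c [] (i # J') = (\<Sum>k\<in>UNIV. Z v c [k] [] * ?d k (\<lambda>u. T u c [] (i # J')))
    + (\<Sum>m<s. \<Sum>l\<in>UNIV. ?d (J' ! m) (\<lambda>u. Z u c [l] []) * T v c [] (i # J'[m := l]))
    + (\<Sum>a\<in>UNIV. ?d i (\<lambda>u. Z u c [a] []) * T v c [] (a # J'))"
    using L1 by linarith
  then show ?case
    unfolding J by (subst sum.lessThan_Suc_shift) simp
qed

section \<open>Vertical derivatives and change of chart\<close>

lemma fiber_derivative:
  assumes "v \<in> A" "c \<in> charts_at M (fst v)" "smooth_in c f"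
  shows "((\<lambda>t. f (tcoord_inv M c (tcoord c v + t *\<^sub>R (0, h)))) has_real_derivative
    (\<Sum>a\<in>UNIV. h $ a * dy M c a f v)) (at 0)"
proof -
  note lin = has_derivative_line(2)[OF assms]
  have "(0, h) = (\<Sum>a\<in>UNIV. h $ a *\<^sub>R ((0, axis a 1) :: (real^'n) \<times> (real^'n)))"
    using basis_expansion[of h] by (simp add: prod_eq_iff fst_sum snd_sum scalar_mult_eq_scaleR)
  then have "frechet_derivative (f \<circ> tcoord_inv M c) (at (tcoord c v)) (0, h) = (\<Sum>a\<in>UNIV. h $ a * dy M c a f v)"
    by (simp add: dy_def linear_sum[OF lin] linear_scale[OF lin] del: scaleR_Pair)
  then show ?thesis using has_derivative_line(1)[OF assms, of "(0, h)"] by simp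
qed

text \<open>Over a fixed base point a change of chart is linear, so a line in the fibre is a line in
  every chart and its direction is moved by the Jacobian.\<close>

lemma fiber_line_transform:
  assumes v: "v \<in> A" and c: "c \<in> charts_at M (fst v)" and c': "c' \<in> charts_at M (fst v)"
  shows "tcoord_inv M c' (tcoord c' v + t *\<^sub>R (0, h))
    = tcoord_inv M c (tcoord c v + t *\<^sub>R (0, jac c' c (fst v) *v h))"
proof -
  have "jac c' d (fst v) *v (snd v c' + t *\<^sub>R h) = jac c d (fst v) *v (snd v c + t *\<^sub>R (jac c' c (fst v) *v h))"
    if d: "d \<in> charts_at M (fst v)" for d
    using tangent_transform[OF tangent[OF v] c' d] tangent_transform[OF tangent[OF v] c d] jac_cocycle[OF c' c d]
    by (simp add: matrix_vector_right_distrib matrix_vector_mult_scaleR matrix_vector_mul_assoc)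
  then show ?thesis
    using c c' by (simp add: tcoord_inv_def tcoord_def charts_atD Let_def fun_eq_iff cong: if_cong)
qed

text \<open>Both sides are the derivative of \<open>f\<close> along one and the same fibre line,
  computed in two charts.\<close>

lemma dy_transform:
  assumes v: "v \<in> A" and c: "c \<in> charts_at M (fst v)" and c': "c' \<in> charts_at M (fst v)"
    and "smooth_in c f" "smooth_in c' f"
  shows "dy M c' i f v = (\<Sum>a\<in>UNIV. jac c' c (fst v) $ a $ i * dy M c a f v)"
proof -
  have "(\<Sum>a\<in>UNIV. axis i 1 $ a * dy M c' a f v) = (\<Sum>a\<in>UNIV. (jac c' c (fst v) *v axis i 1) $ a * dy M c a f v)"
    using DERIV_unique fiber_derivative[OF v c' assms(5), of "axis i 1"] fiber_derivative[OF v c assms(4)]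
    unfolding fiber_line_transform[OF v c c'] by blast
  then show ?thesis
    by (simp add: matrix_vector_mult_basis column_def sum_axis)
qed

end

locale pseudo_finsler_manifold = anisotropic_domain M A
  for M :: "('m::t2_space, 'n::finite) chart set" and A :: "('m, 'n) tbundle set" +
  fixes L :: "('m, 'n) tbundle \<Rightarrow> real"
  assumes finsler: "pseudo_finsler M A L"
begin

lemma smooth_in_L: "c \<in> M \<Longrightarrow> smooth_in c L"
  using finsler by (simp add: pseudo_finsler_def smooth_in_def o_def)

lemma smooth_in_gmat: "c \<in> M \<Longrightarrow> smooth_in c (\<lambda>u. gmat M L c u $ i $ j)"
  by (simp add: gmat_def smooth_in_mult smooth_in_const smooth_in_dy smooth_in_L del: times_divide_eq_left)

text \<open>Symmetry of second derivatives, applied to \<open>L\<close> in coordinates.\<close>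

lemma gmat_symmetric:
  assumes v: "v \<in> A" and c: "c \<in> charts_at M (fst v)"
  shows "gmat M L c v $ i $ j = gmat M L c v $ j $ i"
proof -
  note cM = charts_atD(1)[OF c]
  let ?l = "\<lambda>z. L (tcoord_inv M c z)"
  have l: "smooth_on (coord_image A c) ?l" using smooth_in_L[OF cM] by (simp add: smooth_in_def)
  have "dy M c i (dy M c j L) v
      = frechet_derivative (\<lambda>z. frechet_derivative ?l (at z) (0, axis j 1)) (at (tcoord c v)) (0, axis i 1)" for i j
  proof -
    have "frechet_derivative (\<lambda>z. frechet_derivative ?l (at z) (0, axis j 1)) (at (tcoord c v))
       = frechet_derivative (dy M c j L \<circ> tcoord_inv M c) (at (tcoord c v))"
      by (rule frechet_derivative_transform_within_open[OF
            smooth_on_differentiable[OF smooth_on_frechet_derivative[OF l]] open_coord_image[OF cM]])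
         (use tcoord_in_coord_image[OF v c] in \<open>auto simp: dy_def tcoord_tcoord_inv[OF cM] o_def\<close>)
    then show ?thesis by (simp add: dy_def[of M c i])
  qed
  then show ?thesis
    using frechet_derivative_commute[OF l open_coord_image[OF cM] tcoord_in_coord_image[OF v c]]
    by (simp add: gmat_def)
qed

text \<open>The transformation law of the first vertical derivatives of \<open>L\<close> is
  differentiated once more along a fibre line. The base point stays fixed on that line, so the
  Jacobian entries act as constants.\<close>

lemma gmat_transform:
  assumes v: "v \<in> A" and c: "c \<in> charts_at M (fst v)" and c': "c' \<in> charts_at M (fst v)"
  shows "gmat M L c' v $ i $ j
    = (\<Sum>a\<in>UNIV. \<Sum>b\<in>UNIV. jac c' c (fst v) $ a $ i * jac c' c (fst v) $ b $ j * gmat M L c v $ a $ b)"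
proof -
  note cM = charts_atD(1)[OF c] and cM' = charts_atD(1)[OF c']
  let ?J = "jac c' c (fst v)"
  let ?w = "\<lambda>t. tcoord_inv M c' (tcoord c' v + t *\<^sub>R (0, axis i 1))"
  have w: "?w t = tcoord_inv M c (tcoord c v + t *\<^sub>R (0, column i ?J))" for t
    using fiber_line_transform[OF v c c', of t "axis i 1"] by (simp only: matrix_vector_mult_basis)
  have fst_w: "fst (?w t) = fst v" for t
    using c' by (simp add: tcoord_inv_def Let_def tcoord_def charts_atD)
  have L1: "((\<lambda>t. \<Sum>b\<in>UNIV. ?J $ b $ j * dy M c b L (?w t)) has_real_derivative
      (\<Sum>b\<in>UNIV. ?J $ b $ j * (\<Sum>a\<in>UNIV. column i ?J $ a * dy M c a (dy M c b L) v))) (at 0)"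
    unfolding w by (intro DERIV_sum DERIV_cmult fiber_derivative[OF v c] smooth_in_dy smooth_in_L cM)
  \<comment> \<open>The line may leave \<open>A\<close>. Since the coordinate image is open, the law
    for first derivatives is available for all small \<open>t\<close>, which is enough to compare
    derivatives at 0.\<close>
  have "\<forall>\<^sub>F t in nhds 0. (\<Sum>b\<in>UNIV. ?J $ b $ j * dy M c b L (?w t)) = dy M c' j L (?w t)"
  proof -
    let ?z = "\<lambda>t. tcoord c' v + t *\<^sub>R (0, axis i 1)"
    have "((\<lambda>t. ?z t) \<longlongrightarrow> ?z 0) (nhds 0)"
      by (intro tendsto_intros filterlim_ident)
    then have "((\<lambda>t. ?z t) \<longlongrightarrow> tcoord c' v) (nhds 0)"
      by (simp flip: zero_prod_def)
    then have "\<forall>\<^sub>F t in nhds 0. ?z t \<in> coord_image A c'"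
      using tcoord_in_coord_image[OF v c'] topological_tendstoD[OF _ open_coord_image[OF cM']] by fastforce
    then show ?thesis
    proof eventually_elim
      case (elim t)
      have "?w t \<in> A" by (rule tcoord_inv_in[OF cM' elim])
      then show ?case
        using dy_transform[of "?w t" c c' L j, unfolded fst_w] c c' smooth_in_L[OF cM] smooth_in_L[OF cM'] by simp
    qed
  qed
  from iffD1[OF DERIV_cong_ev[OF refl this refl] L1]
  have "((\<lambda>t. dy M c' j L (?w t)) has_real_derivative
      (\<Sum>b\<in>UNIV. ?J $ b $ j * (\<Sum>a\<in>UNIV. column i ?J $ a * dy M c a (dy M c b L) v))) (at 0)" .
  moreover have "((\<lambda>t. dy M c' j L (?w t)) has_real_derivative
      (\<Sum>a\<in>UNIV. axis i 1 $ a * dy M c' a (dy M c' j L) v)) (at 0)"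
    by (intro fiber_derivative[OF v c'] smooth_in_dy smooth_in_L cM')
  ultimately have "(\<Sum>a\<in>UNIV. axis i 1 $ a * dy M c' a (dy M c' j L) v)
      = (\<Sum>b\<in>UNIV. ?J $ b $ j * (\<Sum>a\<in>UNIV. column i ?J $ a * dy M c a (dy M c b L) v))"
    using DERIV_unique by blast
  then have "dy M c' i (dy M c' j L) v
      = (\<Sum>b\<in>UNIV. \<Sum>a\<in>UNIV. ?J $ a $ i * ?J $ b $ j * dy M c a (dy M c b L) v)"
    by (simp add: column_def sum_axis sum_distrib_left mult_ac)
  then show ?thesis
    by (subst sum.swap) (simp add: gmat_def sum_divide_distrib)
qed

lemma metric_tensor_field: "metric_tensor M A L \<in> tensor_fields M A 0 2"
  unfolding tensor_fields_def mem_Collect_eq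
proof (intro conjI allI ballI impI)
  show "metric_tensor M A L v c I J = 0"
    if "\<not> (v \<in> A \<and> c \<in> charts_at M (fst v) \<and> length I = 0 \<and> length J = 2)" for v c I J
    using that by (auto simp: metric_tensor_def)
next
  fix v c c' and I J :: "'n list"
  assume *: "v \<in> A" "c \<in> charts_at M (fst v)" "c' \<in> charts_at M (fst v)" "length I = 0" "length J = 2"
  then obtain i j where J: "J = [i, j]" by (auto simp: length_Suc_conv numeral_2_eq_2)
  show "metric_tensor M A L v c' I J = (\<Sum>K | length K = 0. \<Sum>H | length H = 2.
          (\<Prod>a<0. jac c c' (fst v) $ (I ! a) $ (K ! a)) *
          (\<Prod>b<2. jac c' c (fst v) $ (H ! b) $ (J ! b)) * metric_tensor M A L v c K H)"
    using * J gmat_transform[OF *(1-3), of i j]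
    by (simp add: metric_tensor_def sum_lists_Suc numeral_2_eq_2 lessThan_Suc mult_ac)
next
  fix c and I J :: "'n list"
  assume c: "c \<in> M"
  show "smooth_on (coord_image A c) (\<lambda>z. metric_tensor M A L (tcoord_inv M c z) c I J)"
  proof (cases "I = [] \<and> length J = 2")
    case True
    have "smooth_in c (\<lambda>u. metric_tensor M A L u c I J)"
      by (rule smooth_in_cong[OF c _ smooth_in_gmat[OF c, of "J ! 0" "J ! 1"]]) (simp add: metric_tensor_def True)
    then show ?thesis by (simp add: smooth_in_def)
  next
    case False
    then have "(\<lambda>z. metric_tensor M A L (tcoord_inv M c z) c I J) = (\<lambda>z. 0)" by (auto simp: metric_tensor_def)
    then show ?thesis by simp
  qed
qed

lemma gmat_invertible: "v \<in> A \<Longrightarrow> c \<in> charts_at M (fst v) \<Longrightarrow> invertible (gmat M L c v)"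
  using finsler unfolding pseudo_finsler_def by blast

end

section \<open>Determinants and the volume form\<close>

text \<open>The product rule in the permutation expansion: the terms in which the factor of row
  \<open>k\<close> is differentiated reassemble into one determinant.\<close>

lemma has_derivative_det:
  fixes A :: "real \<Rightarrow> real^'n^'n"
  assumes "\<And>i j. ((\<lambda>t. A t $ i $ j) has_real_derivative A' $ i $ j) (at t0)"
  shows "((\<lambda>t. det (A t)) has_real_derivative
    (\<Sum>k\<in>UNIV. det (\<chi> i. if i = k then A' $ k else A t0 $ i))) (at t0)"
proof -
  have "((\<lambda>t. det (A t)) has_real_derivative (\<Sum>p | p permutes (UNIV :: 'n set). of_int (sign p) *
      (\<Sum>k\<in>UNIV. A' $ k $ p k * (\<Prod>i\<in>UNIV - {k}. A t0 $ i $ p i)))) (at t0)"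
    unfolding det_def by (intro DERIV_sum DERIV_cmult has_field_derivative_prod assms)
  moreover have "(\<Prod>i\<in>UNIV. (if i = k then A' $ k else A t0 $ i) $ p i)
      = A' $ k $ p k * (\<Prod>i\<in>UNIV - {k}. A t0 $ i $ p i)" for k p
    by (subst prod.remove[of _ k]) auto
  ultimately show ?thesis
    unfolding det_def by (subst sum.swap) (simp add: sum_distrib_left)
qed

lemma matrix_inv:
  assumes "invertible A"
  shows "A ** matrix_inv A = mat 1" "matrix_inv A ** A = mat 1"
  using someI_ex[OF assms[unfolded invertible_def]] unfolding matrix_inv_def by auto

text \<open>Jacobi's formula. Since \<open>B\<close> is \<open>(B ** matrix_inv A) ** A\<close>,
  each row of \<open>B\<close> is a combination of rows of \<open>A\<close>; placed as row
  \<open>k\<close>, only its multiple of row \<open>k\<close> survives, with a diagonal entry as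
  coefficient.\<close>

lemma sum_det_replace_row:
  fixes A B :: "real^'n^'n"
  assumes "invertible A"
  shows "(\<Sum>k\<in>UNIV. det (\<chi> i. if i = k then B $ k else A $ i)) = trace (B ** matrix_inv A) * det A"
proof -
  have "matrix_inv A ** A = mat 1"
    using assms by (rule matrix_inv(2))
  then have "B = (B ** matrix_inv A) ** A" by (simp add: matrix_mul_assoc[symmetric])
  then have "B $ k = (\<Sum>i\<in>UNIV. (B ** matrix_inv A) $ k $ i *s row i A)" for k
    by (subst (asm) vec_eq_iff) (simp add: vec_eq_iff row_def matrix_matrix_mult_def[of _ A])
  then have "det (\<chi> i. if i = k then B $ k else A $ i) = (B ** matrix_inv A) $ k $ k * det A" for k
    using cramer_lemma_transpose[of k "(B ** matrix_inv A) $ k" A] by (simp add: row_def cong: if_cong)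
  then show ?thesis by (simp add: trace_def sum_distrib_right)
qed

text \<open>Both sides are the derivative at \<open>0\<close> of \<open>det (P ** (1 + t C)) = det P * det (1 + t C)\<close>.\<close>
lemma sum_det_replace_row_mult:
  fixes P C :: "real^'n^'n"
  shows "(\<Sum>k\<in>UNIV. det (\<chi> i. if i = k then (P ** C) $ k else P $ i)) = trace C * det P"
proof -
  have "P ** (mat 1 + t *\<^sub>R C) = P + t *\<^sub>R (P ** C)" for t
    by (simp add: matrix_add_ldistrib matrix_scalar_ac scalar_matrix_assoc[symmetric])
  then have "det (P + t *\<^sub>R (P ** C)) = det P * det (mat 1 + t *\<^sub>R C)" for t
    by (metis det_mul)
  moreover have row: "((\<lambda>t. (P + t *\<^sub>R (P ** C)) $ i $ j) has_real_derivative (P ** C) $ i $ j) (at 0)" for i j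
    by (auto intro!: derivative_eq_intros)
  ultimately have D: "((\<lambda>t. det P * det (mat 1 + t *\<^sub>R C)) has_real_derivative
      (\<Sum>k\<in>UNIV. det (\<chi> i. if i = k then (P ** C) $ k else P $ i))) (at 0)"
    using has_derivative_det[of "\<lambda>t. P + t *\<^sub>R (P ** C)", OF row] by (simp cong: if_cong)
  have "((\<lambda>t. det P * det (mat 1 + t *\<^sub>R C)) has_real_derivative
      det P * (\<Sum>k\<in>UNIV. det (\<chi> i. if i = k then C $ k else (mat 1 + 0 *\<^sub>R C) $ i))) (at 0)"
    by (intro DERIV_cmult has_derivative_det) (auto intro!: derivative_eq_intros)
  \<comment> \<open>The formula through an inverse is applied at the identity only, because
    \<open>P\<close> may be singular: it will be \<open>index_mat J\<close>, which has equal rows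
    when \<open>J\<close> repeats an index.\<close>
  moreover have "(\<Sum>k\<in>UNIV. det (\<chi> i. if i = k then C $ k else mat 1 $ i)) = trace C"
    using sum_det_replace_row[of "mat 1" C] matrix_inv(1)[of "mat 1 :: ((real, 'n) vec, 'n) vec"]
    by (simp add: invertible_def exI[of _ "mat 1"])
  ultimately have "((\<lambda>t. det P * det (mat 1 + t *\<^sub>R C)) has_real_derivative det P * trace C) (at 0)"
    by (simp cong: if_cong)
  from DERIV_unique[OF D this] show ?thesis by (simp add: mult.commute)
qed

section \<open>Index lists as functions on the set of coordinates\<close>

abbreviation pos :: "'n::{finite,linorder} \<Rightarrow> nat" where "pos b \<equiv> card {..<b}"

lemma bij_betw_pos: "bij_betw (pos :: 'n::{finite,linorder} \<Rightarrow> nat) UNIV {..<CARD('n)}"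
proof -
  have "inj (pos :: 'n \<Rightarrow> nat)"
  proof (rule linorder_injI)
    fix x y :: 'n assume "x < y"
    then have "{..<x} \<subset> {..<y}" by auto
    then show "pos x \<noteq> pos y" by (metis finite_code less_irrefl psubset_card_mono)
  qed
  moreover have "pos (b :: 'n) < CARD('n)" for b
    by (rule psubset_card_mono) auto
  ultimately show ?thesis
    by (simp add: bij_betw_def card_image card_subset_eq image_subset_iff)
qed

lemma sum_pos: "(\<Sum>m<CARD('n). f m) = (\<Sum>b\<in>UNIV. f (pos (b :: 'n::{finite,linorder})))"
  by (rule sum.reindex_bij_betw[OF bij_betw_pos, symmetric])

lemma prod_pos: "(\<Prod>m<CARD('n). f m) = (\<Prod>b\<in>UNIV. f (pos (b :: 'n::{finite,linorder})))"
  by (rule prod.reindex_bij_betw[OF bij_betw_pos, symmetric])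

lemma pos_less: "pos (b :: 'n::{finite,linorder}) < CARD('n)"
  using bij_betw_pos bij_betwE by blast

lemma pos_eq_iff: "pos b = pos (b' :: 'n::{finite,linorder}) \<longleftrightarrow> b = b'"
  using bij_betw_pos by (auto simp: bij_betw_def inj_on_def)

text \<open>Tensors index components by lists, determinants expand over functions on the index type.
  This bijection passes between the two and also supplies lists with prescribed entries.\<close>

lemma bij_betw_nth_pos:
  "bij_betw (\<lambda>H b. H ! pos b) {H. length H = CARD('n)} (UNIV :: ('n::{finite,linorder} \<Rightarrow> 'a) set)"
proof (rule bij_betw_byWitness[where f' = "\<lambda>f :: 'n \<Rightarrow> 'a. map (\<lambda>m. f (inv_into UNIV pos m)) [0..<CARD('n)]"])
  have *: "inv_into UNIV pos (pos b) = (b :: 'n)" for b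
    by (rule inv_into_f_f) (auto simp: inj_on_def pos_eq_iff)
  show "\<forall>f\<in>UNIV. (\<lambda>b. map (\<lambda>m. f (inv_into UNIV pos m)) [0..<CARD('n)] ! pos b) = (f :: 'n \<Rightarrow> 'a)"
  proof (intro ballI ext)
    fix f :: "'n \<Rightarrow> 'a" and b :: 'n
    show "map (\<lambda>m. f (inv_into UNIV pos m)) [0..<CARD('n)] ! pos b = f b"
      using pos_less[of b] *[of b] by simp
  qed
  have "pos (inv_into UNIV pos m :: 'n) = m" if "m < CARD('n)" for m
    using that bij_betw_pos[where 'n = 'n] by (intro f_inv_into_f) (auto simp: bij_betw_def)
  then show "\<forall>H\<in>{H. length H = CARD('n)}. map (\<lambda>m. (\<lambda>b. H ! pos b) (inv_into UNIV pos m :: 'n)) [0..<CARD('n)] = (H :: 'a list)"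
    by (auto intro!: nth_equalityI)
qed auto

text \<open>The transpose of the matrix in \<open>dVol\<close>, with the same determinant. In this
  form changing one entry of \<open>J\<close> changes one row, which matches the row calculus of
  determinants.\<close>

definition index_mat :: "'n::{finite,linorder} list \<Rightarrow> ((real, 'n) vec, 'n) vec" where
  "index_mat J = (\<chi> b a. if J ! pos b = a then 1 else 0)"

lemma index_mat_row: "index_mat J $ b = axis (J ! pos b) 1"
  by (simp add: index_mat_def axis_def vec_eq_iff eq_commute)

lemma sum_axis_scale: "(\<Sum>l\<in>UNIV. c l *s axis l 1) = (\<chi> l. (c l :: real))"
  by (simp add: vec_eq_iff axis_def if_distrib[of "\<lambda>x. _ * x"] cong: if_cong)

lemma index_mat_mult: "(index_mat J ** C) $ b = C $ (J ! pos b)"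
  by (simp add: vec_eq_iff matrix_matrix_mult_def index_mat_row sum_axis)

text \<open>This is the fact that an endomorphism acting on the slots of a top-degree form
  multiplies it by its trace. By linearity in one row, the sum over \<open>l\<close> puts a row of
  \<open>index_mat J ** C\<close> in place of the old one.\<close>

lemma sum_det_index_mat_update:
  fixes C :: "'n::{finite,linorder} \<Rightarrow> 'n \<Rightarrow> real"
  assumes "length J = CARD('n)"
  shows "(\<Sum>m<CARD('n). \<Sum>l\<in>UNIV. C (J ! m) l * det (index_mat (J[m := l]))) = (\<Sum>l\<in>UNIV. C l l) * det (index_mat J)"
proof -
  let ?C = "(\<chi> i l. C i l) :: ((real, 'n) vec, 'n) vec"
  have "(\<Sum>l\<in>UNIV. C (J ! pos k) l * det (index_mat (J[pos k := l])))
      = det (\<chi> i. if i = k then (index_mat J ** ?C) $ k else index_mat J $ i)" for k :: 'n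
  proof -
    have "index_mat (J[pos k := l]) = (\<chi> i. if i = k then axis l 1 else index_mat J $ i)" for l
      using assms pos_less[where 'n = 'n]
      by (auto simp: vec_eq_iff index_mat_row nth_list_update pos_eq_iff)
    then have "C (J ! pos k) l * det (index_mat (J[pos k := l]))
        = det (\<chi> i. if i = k then C (J ! pos k) l *s axis l 1 else index_mat J $ i)" for l
      by (simp only: det_row_mul)
    then have "(\<Sum>l\<in>UNIV. C (J ! pos k) l * det (index_mat (J[pos k := l])))
        = det (\<chi> i. if i = k then (\<Sum>l\<in>UNIV. C (J ! pos k) l *s axis l 1) else index_mat J $ i)"
      by (simp only: det_linear_row_sum[OF finite])
    moreover have "(\<Sum>l\<in>UNIV. C (J ! pos k) l *s axis l 1) = (index_mat J ** ?C) $ k"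
      unfolding sum_axis_scale index_mat_mult by (simp add: vec_eq_iff)
    ultimately show ?thesis by (simp only: cong: if_cong)
  qed
  then show ?thesis
    unfolding sum_pos by (simp add: sum_det_replace_row_mult trace_def)
qed

text \<open>The pullback of a top-degree form is scaled by the determinant: linearity in all rows
  collects the sum over lists into \<open>det (index_mat J ** transpose B)\<close>.\<close>

lemma sum_det_index_mat_transform:
  fixes B :: "((real, 'n::{finite,linorder}) vec, 'n) vec"
  shows "(\<Sum>H | length H = CARD('n). (\<Prod>b<CARD('n). B $ (H ! b) $ (J ! b)) * det (index_mat H)) = det B * det (index_mat J)"
proof -
  let ?F = "\<lambda>f. (\<Prod>b\<in>UNIV. B $ (f b) $ (J ! pos b)) * det (\<chi> b. (axis (f b) 1 :: (real, 'n) vec))"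
  have im: "index_mat H = (\<chi> b. axis (H ! pos b) 1)" for H :: "'n list"
    by (simp add: vec_eq_iff index_mat_row)
  have "(\<Sum>H | length H = CARD('n). (\<Prod>b<CARD('n). B $ (H ! b) $ (J ! b)) * det (index_mat H))
      = (\<Sum>H | length H = CARD('n). ?F (\<lambda>b. H ! pos b))"
    unfolding prod_pos im ..
  also have "\<dots> = (\<Sum>f\<in>UNIV. ?F f)"
    by (rule sum.reindex_bij_betw[OF bij_betw_nth_pos])
  also have "\<dots> = (\<Sum>f\<in>UNIV. det (\<chi> b. B $ (f b) $ (J ! pos b) *s axis (f b) 1))"
    by (simp only: det_rows_mul)
  also have "\<dots> = det (\<chi> b. \<Sum>h\<in>UNIV. B $ h $ (J ! pos b) *s axis h 1)"
    using det_linear_rows_sum[of "UNIV :: 'n set" "\<lambda>b h. B $ h $ (J ! pos b) *s axis h 1"] by simp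
  also have "(\<chi> b. \<Sum>h\<in>UNIV. B $ h $ (J ! pos b) *s axis h 1) = index_mat J ** transpose B"
    by (subst vec_eq_iff) (simp add: sum_axis_scale index_mat_mult transpose_def)
  finally show ?thesis by (simp add: det_mul mult.commute)
qed

lemma det_index_mat: "det (\<chi> (a::'n) b. if J ! pos b = a then 1 else 0) = det (index_mat (J :: 'n::{finite,linorder} list))"
  using det_transpose[of "index_mat J"] by (simp add: transpose_def index_mat_def)

section \<open>The metric volume form and its divergence\<close>

locale ordered_pseudo_finsler_manifold = pseudo_finsler_manifold M A L
  for M :: "('m::t2_space, 'n::{finite,linorder}) chart set" and A :: "('m, 'n) tbundle set"
    and L :: "('m, 'n) tbundle \<Rightarrow> real"
begin

definition vol_density :: "('m, 'n) chart \<Rightarrow> ('m, 'n) tbundle \<Rightarrow> real" where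
  "vol_density c v = sqrt \<bar>det (gmat M L c v)\<bar>"

lemma dVol_eq:
  "v \<in> A \<Longrightarrow> c \<in> charts_at M (fst v) \<Longrightarrow> length J = CARD('n) \<Longrightarrow>
    dVol M A L v c [] J = vol_density c v * det (index_mat J)"
  by (simp add: dVol_def vol_density_def det_index_mat)

lemma det_gmat_nonzero: "v \<in> A \<Longrightarrow> c \<in> charts_at M (fst v) \<Longrightarrow> det (gmat M L c v) \<noteq> 0"
  using gmat_invertible by (simp add: invertible_det_nz)

lemma smooth_in_det: "c \<in> M \<Longrightarrow> smooth_in c (\<lambda>u. det (gmat M L c u))"
  unfolding det_def by (intro smooth_in_sum smooth_in_mult smooth_in_prod smooth_in_const smooth_in_gmat)

lemma smooth_in_vol_density: "c \<in> M \<Longrightarrow> smooth_in c (vol_density c)"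
  unfolding vol_density_def
  by (rule smooth_in_compose[OF _ smooth_in_det _ smooth_on_sqrt_abs]) (auto simp: det_gmat_nonzero)

text \<open>The determinant of g picks up the square of the Jacobian determinant. Orientation makes
  that determinant positive, so its absolute value disappears after taking the root.\<close>

lemma vol_density_transform:
  assumes v: "v \<in> A" and c: "c \<in> charts_at M (fst v)" and c': "c' \<in> charts_at M (fst v)"
  shows "vol_density c' v = det (jac c' c (fst v)) * vol_density c v"
proof -
  let ?J = "jac c' c (fst v)"
  have "gmat M L c' v = transpose ?J ** gmat M L c v ** ?J"
    unfolding vec_eq_iff gmat_transform[OF v c c'] matrix_matrix_mult_def transpose_def
    by (intro allI, subst sum.swap) (simp add: sum_distrib_left sum_distrib_right mult_ac)
  then have "det (gmat M L c' v) = (det ?J)\<^sup>2 * det (gmat M L c v)"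
    by (simp add: det_mul power2_eq_square)
  moreover have "det ?J > 0"
    using atlas c c' unfolding oriented_atlas_def charts_at_def by blast
  ultimately show ?thesis
    by (simp add: vol_density_def abs_mult real_sqrt_mult)
qed

lemma dVol_field: "dVol M A L \<in> tensor_fields M A 0 CARD('n)"
  unfolding tensor_fields_def mem_Collect_eq
proof (intro conjI allI ballI impI)
  show "dVol M A L v c I J = 0"
    if "\<not> (v \<in> A \<and> c \<in> charts_at M (fst v) \<and> length I = 0 \<and> length J = CARD('n))" for v c I J
    using that by (auto simp: dVol_def)
next
  fix v c c' and I J :: "'n list"
  assume *: "v \<in> A" "c \<in> charts_at M (fst v)" "c' \<in> charts_at M (fst v)" "length I = 0" "length J = CARD('n)"
  let ?B = "jac c' c (fst v)"
  have "(\<Sum>H | length H = CARD('n). (\<Prod>b<CARD('n). ?B $ (H ! b) $ (J ! b)) * dVol M A L v c [] H)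
     = (\<Sum>H | length H = CARD('n). vol_density c v * ((\<Prod>b<CARD('n). ?B $ (H ! b) $ (J ! b)) * det (index_mat H)))"
    by (rule sum.cong) (simp_all add: dVol_eq * mult_ac)
  also have "\<dots> = vol_density c v * (det ?B * det (index_mat J))"
    by (simp only: sum_distrib_left[symmetric] sum_det_index_mat_transform)
  also have "\<dots> = dVol M A L v c' [] J"
    using * by (simp add: dVol_eq vol_density_transform[OF *(1-3)] mult_ac)
  finally show "dVol M A L v c' I J = (\<Sum>K | length K = 0. \<Sum>H | length H = CARD('n).
          (\<Prod>a<0. jac c c' (fst v) $ (I ! a) $ (K ! a)) *
          (\<Prod>b<CARD('n). ?B $ (H ! b) $ (J ! b)) * dVol M A L v c K H)"
    using * by simp
next
  fix c and I J :: "'n list"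
  assume c: "c \<in> M"
  show "smooth_on (coord_image A c) (\<lambda>z. dVol M A L (tcoord_inv M c z) c I J)"
  proof (cases "I = [] \<and> length J = CARD('n)")
    case True
    have "smooth_in c (\<lambda>u. dVol M A L u c I J)"
      by (rule smooth_in_cong[OF c _ smooth_in_mult[OF c smooth_in_vol_density[OF c] smooth_in_const[of c "det (index_mat J)"]]])
         (use True in \<open>simp add: dVol_eq\<close>)
    then show ?thesis by (simp add: smooth_in_def)
  next
    case False
    then have "(\<lambda>z. dVol M A L (tcoord_inv M c z) c I J) = (\<lambda>z. 0)" by (auto simp: dVol_def)
    then show ?thesis by simp
  qed
qed

text \<open>Jacobi's formula combined with the derivative of sqrt |t|. The factor next to the
  density will be recognised as a trace of the Chern symbols.\<close>

lemma delta_vol_density: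
  assumes v: "v \<in> A" and c: "c \<in> charts_at M (fst v)"
  shows "delta M L c k (vol_density c) v
    = vol_density c v * (1/2 * (\<Sum>i\<in>UNIV. \<Sum>j\<in>UNIV. delta M L c k (\<lambda>u. gmat M L c u $ i $ j) v * ginv M L c v $ j $ i))"
proof -
  note cM = charts_atD(1)[OF c]
  let ?dg = "(\<chi> i j. delta M L c k (\<lambda>u. gmat M L c u $ i $ j) v) :: ((real, 'n) vec, 'n) vec"
  let ?w = "\<lambda>t. tcoord_inv M c (tcoord c v + t *\<^sub>R horizontal_lift L c v k)"
  have "((\<lambda>t. det (gmat M L c (?w t))) has_real_derivative
      (\<Sum>k\<in>UNIV. det (\<chi> i. if i = k then ?dg $ k else gmat M L c (?w 0) $ i))) (at 0)"
    by (rule has_derivative_det) (simp add: has_derivative_delta[OF v c smooth_in_gmat[OF cM]])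
  then have "delta M L c k (\<lambda>u. det (gmat M L c u)) v = (\<Sum>k\<in>UNIV. det (\<chi> i. if i = k then ?dg $ k else gmat M L c v $ i))"
    using v c by (intro delta_unique[OF v c smooth_in_det[OF cM]]) (simp cong: if_cong)
  also have "\<dots> = trace (?dg ** ginv M L c v) * det (gmat M L c v)"
    unfolding ginv_def by (rule sum_det_replace_row[OF gmat_invertible[OF v c]])
  finally have d: "delta M L c k (\<lambda>u. det (gmat M L c u)) v = trace (?dg ** ginv M L c v) * det (gmat M L c v)" .
  have nz: "det (gmat M L c v) \<noteq> 0" using det_gmat_nonzero[OF v c] .
  have "delta M L c k (vol_density c) v
      = sqrt \<bar>det (gmat M L c v)\<bar> * inverse (det (gmat M L c v)) / 2 * delta M L c k (\<lambda>u. det (gmat M L c u)) v"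
    unfolding vol_density_def
    by (rule delta_compose[OF v c smooth_in_det[OF cM] smooth_in_vol_density[OF cM, unfolded vol_density_def] has_derivative_sqrt_abs[OF nz]])
  also have "\<dots> = vol_density c v * (1/2 * trace (?dg ** ginv M L c v))"
    using nz by (simp add: d vol_density_def)
  finally show ?thesis by (simp add: trace_def matrix_matrix_mult_def)
qed

lemma lie_bracket_dVol:
  assumes D: "anisotropic_lie_bracket M A L Z D" and Z: "Z \<in> tensor_fields M A 1 0"
    and v: "v \<in> A" and c: "c \<in> charts_at M (fst v)" and J: "length J = CARD('n)"
  shows "D (dVol M A L) v c [] J =
    ((\<Sum>k\<in>UNIV. Z v c [k] [] * (1/2 * (\<Sum>i\<in>UNIV. \<Sum>j\<in>UNIV.
        delta M L c k (\<lambda>u. gmat M L c u $ i $ j) v * ginv M L c v $ j $ i)))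
      + (\<Sum>l\<in>UNIV. delta M L c l (\<lambda>u. Z u c [l] []) v)) * dVol M A L v c [] J"
proof -
  note cM = charts_atD(1)[OF c]
  have d: "delta M L c k (\<lambda>u. dVol M A L u c [] J) v = delta M L c k (vol_density c) v * det (index_mat J)" for k
  proof -
    have "delta M L c k (\<lambda>u. vol_density c u * det (index_mat J)) v = delta M L c k (\<lambda>u. dVol M A L u c [] J) v"
      by (rule delta_cong[OF v c smooth_in_mult[OF cM smooth_in_vol_density[OF cM] smooth_in_const]]) (simp add: dVol_eq J)
    then show ?thesis by (simp add: delta_mult[OF v c smooth_in_vol_density[OF cM] smooth_in_const])
  qed
  have "(\<Sum>m<CARD('n). \<Sum>l\<in>UNIV. delta M L c (J ! m) (\<lambda>u. Z u c [l] []) v * dVol M A L v c [] (J[m := l]))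
     = vol_density c v * (\<Sum>m<CARD('n). \<Sum>l\<in>UNIV. delta M L c (J ! m) (\<lambda>u. Z u c [l] []) v * det (index_mat (J[m := l])))"
    by (simp add: dVol_eq v c J sum_distrib_left mult_ac)
  also have "\<dots> = (\<Sum>l\<in>UNIV. delta M L c l (\<lambda>u. Z u c [l] []) v) * dVol M A L v c [] J"
    using sum_det_index_mat_update[OF J, of "\<lambda>i l. delta M L c i (\<lambda>u. Z u c [l] []) v"] by (simp add: dVol_eq v c J)
  finally show ?thesis
    using lie_bracket_covariant[OF D Z v c dVol_field J]
    by (simp add: d delta_vol_density[OF v c] dVol_eq v c J sum_distrib_left sum_distrib_right distrib_left distrib_right mult_ac)
qed

text \<open>\<open>THE\<close> asks for existence and uniqueness. The identity computed in the chart
  \<open>c\<close> extends to all charts because both sides are tensor fields, and uniqueness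
  follows from a nonzero component of the volume form.\<close>

lemma divergence_eq:
  assumes lie: "anisotropic_lie_bracket M A L Z (lie Z)" and Z: "Z \<in> tensor_fields M A 1 0"
    and v: "v \<in> A" and c: "c \<in> charts_at M (fst v)"
  shows "divergence M A L lie Z v =
    (\<Sum>k\<in>UNIV. Z v c [k] [] * (1/2 * (\<Sum>i\<in>UNIV. \<Sum>j\<in>UNIV.
        delta M L c k (\<lambda>u. gmat M L c u $ i $ j) v * ginv M L c v $ j $ i)))
      + (\<Sum>l\<in>UNIV. delta M L c l (\<lambda>u. Z u c [l] []) v)" (is "_ = ?a")
  unfolding divergence_def
proof (rule the_equality)
  have "\<forall>r s. \<forall>T\<in>tensor_fields M A r s. lie Z T \<in> tensor_fields M A r s"
    using lie unfolding anisotropic_lie_bracket_def tensor_derivation_def by (elim conjE)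
  then have D: "lie Z (dVol M A L) \<in> tensor_fields M A 0 CARD('n)"
    using dVol_field by simp
  have lie_eq: "lie Z (dVol M A L) v c [] J = ?a * dVol M A L v c [] J" if "length J = CARD('n)" for J
    using lie_bracket_dVol[where D = "lie Z", OF lie Z v c that] .
  show "\<forall>c' I J. lie Z (dVol M A L) v c' I J = ?a * dVol M A L v c' I J"
  proof (intro allI)
    fix c' and I J :: "'n list"
    show "lie Z (dVol M A L) v c' I J = ?a * dVol M A L v c' I J"
    proof (cases "c' \<in> charts_at M (fst v) \<and> length I = 0 \<and> length J = CARD('n)")
      case True
      define a where "a = ?a"
      have "lie Z (dVol M A L) v c' [] J
          = (\<Sum>H | length H = CARD('n). (\<Prod>b<CARD('n). jac c' c (fst v) $ (H ! b) $ (J ! b)) * (a * dVol M A L v c [] H))"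
        using tensor_fields_transform[OF D v c, of c' "[]" J] True lie_eq[folded a_def] by simp
      also have "\<dots> = a * dVol M A L v c' [] J"
        using tensor_fields_transform[OF dVol_field v c, of c' "[]" J] True
        by (simp add: sum_distrib_left mult_ac)
      finally show ?thesis using True by (simp add: a_def)
    next
      case False
      then have "lie Z (dVol M A L) v c' I J = 0" "dVol M A L v c' I J = 0"
        using tensor_fields_zero[OF D, of v c' I J] tensor_fields_zero[OF dVol_field, of v c' I J] by blast+
      then show ?thesis by simp
    qed
  qed
next
  fix a assume a: "\<forall>c I J. lie Z (dVol M A L) v c I J = a * dVol M A L v c I J"
  \<comment> \<open>The list of all indices in increasing order makes \<open>index_mat J\<close> the
    identity, so the corresponding component of the volume form is the density itself.\<close>
  have "(\<lambda>b::'n. b) \<in> (\<lambda>H b. H ! pos b) ` {H. length H = CARD('n)}"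
    using bij_betw_imp_surj_on[OF bij_betw_nth_pos[where 'n = 'n and 'a = 'n]] by simp
  then obtain J where J: "length J = CARD('n)" "\<And>b::'n. J ! pos b = b"
    by (auto simp: fun_eq_iff)
  have "index_mat J = mat 1" by (simp add: index_mat_def J mat_def vec_eq_iff)
  then have "dVol M A L v c [] J \<noteq> 0"
    using det_gmat_nonzero[OF v c] by (simp add: dVol_eq v c J vol_density_def)
  moreover have "a * dVol M A L v c [] J = ?a * dVol M A L v c [] J"
    using a lie_bracket_dVol[where D = "lie Z", OF lie Z v c J(1)] by metis
  ultimately show "a = ?a" by (simp only: mult_cancel_right simp_thms)
qed

end

section \<open>The Chern connection\<close>

lemma trace_transpose: "trace (transpose A) = trace A"
  by (simp add: trace_def transpose_def)

lemma trace_symmetric_antisymmetric: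
  fixes A B :: "real^'n^'n"
  assumes "transpose A = A" "transpose B = - B"
  shows "trace (A ** B) = 0"
proof -
  have "trace (A ** B) = trace (transpose B ** transpose A)"
    by (simp add: trace_transpose flip: matrix_transpose_mul)
  also have "\<dots> = - trace (B ** A)"
    by (simp add: assms trace_def matrix_matrix_mult_def sum_negf)
  finally show ?thesis using trace_mul_sym[of A B] by simp
qed

lemma transpose_eq_uminusI:
  fixes B :: "real^'n^'n"
  assumes "\<And>i j. B $ i $ j = - B $ j $ i"
  shows "transpose B = - B"
proof -
  have "transpose B $ i $ j = (- B) $ i $ j" for i j
    using assms[of j i] by (simp add: transpose_def)
  then show ?thesis unfolding vec_eq_iff by blast
qed

lemma mat_1_nth: "mat 1 $ i = axis i (1::real)"
  by (simp add: mat_def axis_def vec_eq_iff eq_commute)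

lemma sum_lessThan_2: "(\<Sum>m<2. f m) = f 0 + f (Suc 0)"
  by (simp add: numeral_2_eq_2)

context anisotropic_domain
begin

text \<open>Fields and tangent vectors follow the same transformation law, so agreement at
  \<open>v\<close> in one chart gives agreement in all.\<close>

lemma tangent_vector_extension:
  assumes v: "v \<in> A" and y: "y \<in> tangent_space M (fst v)" and c: "c \<in> charts_at M (fst v)"
  obtains Y where "Y \<in> tensor_fields M A 1 0" "\<And>c l. c \<in> charts_at M (fst v) \<Longrightarrow> Y v c [l] [] = y c $ l"
proof -
  obtain Y where Y: "Y \<in> tensor_fields M A 1 0" "\<And>l. Y v c [l] [] = y c $ l"
    using vector_field_extension[OF v c] by blast
  have "Y v c' [l] [] = y c' $ l" if c': "c' \<in> charts_at M (fst v)" for c' l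
    using vector_transform[OF Y(1) v c c', of l] tangent_transform[OF y c c']
    by (simp add: Y(2) matrix_vector_mult_def)
  then show ?thesis using Y(1) that by blast
qed

lemma interior_interior:
  assumes "\<And>l. Y v c [l] [] = y c $ l" "\<And>l. W v c [l] [] = w c $ l"
  shows "interior W (interior Y S) v c [] [] = bilin c S v y w"
  unfolding interior_eq bilin_def assms
  by (subst sum.swap) (simp add: sum_distrib_left mult_ac)

text \<open>After extending \<open>y\<close> and \<open>w\<close> to fields, the number is the value
  of a twofold interior product, a scalar field, and scalars do not depend on the chart.\<close>

lemma bilin_transform:
  assumes S: "S \<in> tensor_fields M A 0 2" and v: "v \<in> A"
    and y: "y \<in> tangent_space M (fst v)" and w: "w \<in> tangent_space M (fst v)"
    and c: "c \<in> charts_at M (fst v)" and c': "c' \<in> charts_at M (fst v)"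
  shows "bilin c' S v y w = bilin c S v y w"
proof -
  obtain Y where Y: "Y \<in> tensor_fields M A 1 0" "\<And>c l. c \<in> charts_at M (fst v) \<Longrightarrow> Y v c [l] [] = y c $ l"
    using tangent_vector_extension[OF v y c] by blast
  obtain W where W: "W \<in> tensor_fields M A 1 0" "\<And>c l. c \<in> charts_at M (fst v) \<Longrightarrow> W v c [l] [] = w c $ l"
    using tangent_vector_extension[OF v w c] by blast
  have "interior W (interior Y S) \<in> tensor_fields M A 0 0"
    using S by (intro interior_vector_field W(1) Y(1)) (simp add: numeral_2_eq_2)
  from scalar_transform[OF this v c c'] show ?thesis
    by (simp add: interior_interior[where y = y and w = w] Y(2) W(2) c c')
qed

lemma bilin_axis_left:
  assumes "y c = axis i 1"
  shows "bilin c S v y w = (\<Sum>j\<in>UNIV. S v c [] [i, j] * w c $ j)"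
proof -
  have "bilin c S v y w = (\<Sum>a\<in>UNIV. axis i 1 $ a * (\<Sum>j\<in>UNIV. S v c [] [a, j] * w c $ j))"
    by (simp add: bilin_def assms sum_distrib_left mult_ac)
  then show ?thesis by (simp add: sum_axis)
qed

lemma bilin_axis:
  assumes "y c = axis i 1" "w c = axis j 1"
  shows "bilin c S v y w = S v c [] [i, j]"
  using bilin_axis_left[of y, OF assms(1)] sum_axis[of j "\<lambda>j. S v c [] [i, j]"] by (simp add: assms(2) mult.commute)

lemma anisotropic_lie_bracket_field:
  "anisotropic_lie_bracket M A L Z D \<Longrightarrow> T \<in> tensor_fields M A r s \<Longrightarrow> D T \<in> tensor_fields M A r s"
  unfolding anisotropic_lie_bracket_def tensor_derivation_def by (elim conjE) simp

lemma nabla_vector_field: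
  assumes "v \<in> A" "c \<in> charts_at M (fst v)"
  shows "nabla M A L X v c [i] [k]
    = delta M L c k (\<lambda>u. X u c [i] []) v + (\<Sum>l\<in>UNIV. chern M L c v i k l * X v c [l] [])"
  using assms by (simp add: nabla_def Let_def)

definition nabla_mat ::
  "(('m, 'n) tbundle \<Rightarrow> real) \<Rightarrow> ('m, 'n) tensor \<Rightarrow> ('m, 'n) chart \<Rightarrow> ('m, 'n) tbundle \<Rightarrow> ((real, 'n) vec, 'n) vec"
  where "nabla_mat L X c v = (\<chi> i k. nabla M A L X v c [i] [k])"

lemma nabla_at_eq: "nabla_at M A L v y X c = nabla_mat L X c v *v y c"
  by (simp add: nabla_at_def nabla_mat_def matrix_vector_mult_def mult.commute)

text \<open>Checks the zero convention directly from the formula, so that the covariant derivative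
  can be compared with a Lie bracket as a function of all charts and index lists.\<close>

lemma nabla_along_zero:
  assumes T: "T \<in> tensor_fields M A r s"
    and *: "\<not> (v \<in> A \<and> c \<in> charts_at M (fst v) \<and> length I = r \<and> length J = s)"
  shows "nabla_along M A L X T v c I J = 0"
proof (cases "v \<in> A \<and> c \<in> charts_at M (fst v)")
  case True
  then have "length I \<noteq> r \<or> length J \<noteq> s" using * by blast
  then have "T u c I' J' = 0" if "length I' = length I" "length J' = length J" for u I' J'
    using tensor_fields_zero[OF T, of u c I' J'] that by auto
  then have "nabla M A L T v c I (J @ [k]) = 0" for k
    by (simp add: nabla_def Let_def)
  then show ?thesis by (simp add: nabla_along_def)
qed (auto simp: nabla_along_def nabla_def)

end

section \<open>Torsion-freeness and metric compatibility in coefficients\<close>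

context pseudo_finsler_manifold
begin

lemma transpose_gmat: "v \<in> A \<Longrightarrow> c \<in> charts_at M (fst v) \<Longrightarrow> transpose (gmat M L c v) = gmat M L c v"
  by (simp add: vec_eq_iff transpose_def gmat_symmetric)

lemma ginv_inverse:
  assumes "v \<in> A" "c \<in> charts_at M (fst v)"
  shows "gmat M L c v ** ginv M L c v = mat 1" "ginv M L c v ** gmat M L c v = mat 1"
  using matrix_inv[OF gmat_invertible[OF assms]] by (simp_all add: ginv_def)

lemma transpose_ginv:
  assumes "v \<in> A" "c \<in> charts_at M (fst v)"
  shows "transpose (ginv M L c v) = ginv M L c v"
proof -
  let ?G = "gmat M L c v" and ?H = "ginv M L c v"
  have "transpose ?H ** ?G = mat 1"
    using arg_cong[OF ginv_inverse(1)[OF assms], of transpose]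
    by (simp add: matrix_transpose_mul transpose_gmat[OF assms] transpose_mat)
  then have "transpose ?H = transpose ?H ** (?G ** ?H)" by (simp add: ginv_inverse[OF assms])
  also have "\<dots> = ?H" using \<open>transpose ?H ** ?G = mat 1\<close> by (simp add: matrix_mul_assoc)
  finally show ?thesis .
qed

context
  fixes v c
  assumes v: "v \<in> A" and c: "c \<in> charts_at M (fst v)"
begin

private abbreviation (input) "g \<equiv> \<lambda>i j. gmat M L c v $ i $ j"
private abbreviation (input) "dg \<equiv> \<lambda>k i j. delta M L c k (\<lambda>u. gmat M L c u $ i $ j) v"
private abbreviation (input) "\<Gamma> \<equiv> chern M L c v"

lemma cM: "c \<in> M" using c by (rule charts_atD)

lemma dg_symmetric: "dg k i j = dg k j i"
  by (rule delta_cong[OF v c smooth_in_gmat[OF cM]]) (rule gmat_symmetric)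

lemma chern_symmetric: "\<Gamma> i j k = \<Gamma> i k j"
  by (simp add: chern_def dg_symmetric[of _ j k] algebra_simps)

text \<open>Christoffel symbols of the first kind: lowering the index cancels the inverse metric in
  the definition of \<Gamma>.\<close>

lemma lower_chern: "(\<Sum>l\<in>UNIV. g i l * \<Gamma> l j k) = 1/2 * (dg k i j + dg j i k - dg i j k)"
proof -
  let ?E = "\<lambda>m. dg k m j + dg j m k - dg m j k"
  have "(\<Sum>l\<in>UNIV. g i l * \<Gamma> l j k) = (\<Sum>m\<in>UNIV. \<Sum>l\<in>UNIV. g i l * ginv M L c v $ l $ m * (1/2 * ?E m))"
    unfolding chern_def sum_distrib_left by (subst sum.swap) (simp add: mult_ac)
  also have "\<dots> = (\<Sum>m\<in>UNIV. (gmat M L c v ** ginv M L c v) $ i $ m * (1/2 * ?E m))"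
    by (simp only: matrix_matrix_mult_def vec_lambda_beta sum_distrib_right)
  also have "\<dots> = 1/2 * ?E i"
    by (simp only: ginv_inverse[OF v c] mat_1_nth sum_axis)
  finally show ?thesis .
qed

text \<open>This is \<nabla>g = 0 in coefficients. In the sum of the two lowered symbols the other
  derivatives of g cancel by symmetry.\<close>

lemma metric_compatible: "dg k i j = (\<Sum>l\<in>UNIV. \<Gamma> l k i * g l j) + (\<Sum>l\<in>UNIV. \<Gamma> l k j * g i l)"
proof -
  have "(\<Sum>l\<in>UNIV. \<Gamma> l k i * g l j) = (\<Sum>l\<in>UNIV. g j l * \<Gamma> l k i)"
    by (simp add: gmat_symmetric[OF v c, of _ j] mult.commute)
  moreover have "(\<Sum>l\<in>UNIV. \<Gamma> l k j * g i l) = (\<Sum>l\<in>UNIV. g i l * \<Gamma> l k j)"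
    by (simp add: mult.commute)
  ultimately show ?thesis
    using dg_symmetric[of i j k] dg_symmetric[of k j i] dg_symmetric[of j k i] by (simp add: lower_chern)
qed

text \<open>Contracted with the symmetric inverse metric, two of the three derivative terms cancel.
  What remains is the factor found in \<open>delta_vol_density\<close>, which ties the divergence to
  the connection.\<close>

lemma chern_trace:
  "(\<Sum>i\<in>UNIV. \<Gamma> i i k) = 1/2 * (\<Sum>i\<in>UNIV. \<Sum>j\<in>UNIV. dg k i j * ginv M L c v $ j $ i)"
proof -
  let ?h = "\<lambda>i j. ginv M L c v $ i $ j"
  have h: "?h i j = ?h j i" for i j
    using arg_cong[OF transpose_ginv[OF v c], of "\<lambda>B. B $ j $ i"] by (simp add: transpose_def)
  have "\<Gamma> i i k = 1/2 * (\<Sum>l\<in>UNIV. ?h i l * dg k l i) + 1/2 * (\<Sum>l\<in>UNIV. ?h i l * dg i l k)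
      - 1/2 * (\<Sum>l\<in>UNIV. ?h i l * dg l i k)" for i
    unfolding chern_def sum_distrib_left sum.distrib[symmetric] sum_subtractf[symmetric]
    by (rule sum.cong) (simp_all add: algebra_simps)
  then have "(\<Sum>i\<in>UNIV. \<Gamma> i i k) = 1/2 * (\<Sum>i\<in>UNIV. \<Sum>l\<in>UNIV. ?h i l * dg k l i)
      + 1/2 * (\<Sum>i\<in>UNIV. \<Sum>l\<in>UNIV. ?h i l * dg i l k) - 1/2 * (\<Sum>i\<in>UNIV. \<Sum>l\<in>UNIV. ?h i l * dg l i k)"
    by (simp only: sum.distrib sum_subtractf sum_distrib_left)
  moreover have "(\<Sum>i\<in>UNIV. \<Sum>l\<in>UNIV. ?h i l * dg l i k) = (\<Sum>i\<in>UNIV. \<Sum>l\<in>UNIV. ?h i l * dg i l k)"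
    by (subst sum.swap, intro sum.cong refl) (simp only: h)
  moreover have "(\<Sum>i\<in>UNIV. \<Sum>l\<in>UNIV. ?h i l * dg k l i) = (\<Sum>i\<in>UNIV. \<Sum>j\<in>UNIV. dg k i j * ?h j i)"
    by (subst sum.swap, intro sum.cong refl mult.commute)
  ultimately show ?thesis by simp
qed

context
  fixes X assumes X: "X \<in> tensor_fields M A 1 0"
begin

private abbreviation (input) "nX \<equiv> \<lambda>i k. nabla M A L X v c [i] [k]"
private abbreviation (input) "dX \<equiv> \<lambda>k i. delta M L c k (\<lambda>u. X u c [i] []) v"

lemma lie_minus_nabla:
  assumes D: "anisotropic_lie_bracket M A L X D" and S: "S \<in> tensor_fields M A 0 2"
  shows "D S v c [] [i, j] - nabla_along M A L X S v c [] [i, j]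
    = (\<Sum>l\<in>UNIV. nX l i * S v c [] [l, j]) + (\<Sum>l\<in>UNIV. nX l j * S v c [] [i, l])"
proof -
  let ?S = "\<lambda>i j. S v c [] [i, j]" and ?dS = "\<lambda>k. delta M L c k (\<lambda>u. S u c [] [i, j]) v"
  let ?x = "\<lambda>k. X v c [k] []"
  have "D S v c [] [i, j] = (\<Sum>k\<in>UNIV. ?x k * ?dS k)
      + (\<Sum>l\<in>UNIV. dX i l * ?S l j) + (\<Sum>l\<in>UNIV. dX j l * ?S i l)"
    using lie_bracket_covariant[OF D X v c S, of "[i, j]"] by (simp add: sum_lessThan_2)
  moreover have "nabla_along M A L X S v c [] [i, j] = (\<Sum>k\<in>UNIV. ?x k * ?dS k)
      - (\<Sum>k\<in>UNIV. \<Sum>l\<in>UNIV. ?x k * (\<Gamma> l k i * ?S l j)) - (\<Sum>k\<in>UNIV. \<Sum>l\<in>UNIV. ?x k * (\<Gamma> l k j * ?S i l))"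
    using v c
    by (simp add: nabla_along_def nabla_def Let_def sum_lessThan_2 right_diff_distrib
        sum_subtractf sum.distrib sum_distrib_left distrib_left flip: numeral_2_eq_2)
  \<comment> \<open>Torsion-freeness is used here: \<nabla>X involves \<open>\<Gamma> l a k\<close>,
    whereas the derivative of \<open>S\<close> along \<open>X\<close> involves
    \<open>\<Gamma> l k a\<close>.\<close>
  moreover have "(\<Sum>l\<in>UNIV. nX l a * f l) = (\<Sum>l\<in>UNIV. dX a l * f l) + (\<Sum>k\<in>UNIV. \<Sum>l\<in>UNIV. ?x k * (\<Gamma> l k a * f l))" for a f
    by (subst sum.swap) (simp add: nabla_vector_field[OF v c] chern_symmetric[of _ a] distrib_left distrib_right
        sum.distrib sum_distrib_left sum_distrib_right mult_ac)
  ultimately show ?thesis by simp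
qed

lemma nabla_along_metric: "nabla_along M A L X (metric_tensor M A L) v c [] [i, j] = 0"
proof -
  have "delta M L c k (\<lambda>u. metric_tensor M A L u c [] [i, j]) v = dg k i j" for k
    by (rule delta_cong[OF v c smooth_in_gmat[OF cM], symmetric]) (simp add: metric_tensor_def)
  then have "nabla M A L (metric_tensor M A L) v c [] [i, j, k] = 0" for k
    using v c metric_compatible[of k i j]
    by (simp add: nabla_def Let_def metric_tensor_def sum_lessThan_2 flip: numeral_2_eq_2)
  then show ?thesis by (simp add: nabla_along_def)
qed

lemma lie_metric:
  assumes D: "anisotropic_lie_bracket M A L X D"
  shows "D (metric_tensor M A L) v c [] [i, j] = (\<Sum>l\<in>UNIV. g j l * nX l i) + (\<Sum>l\<in>UNIV. g i l * nX l j)"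
  using lie_minus_nabla[OF D metric_tensor_field, of i j] v c gmat_symmetric[OF v c, of _ j]
  by (simp add: nabla_along_metric metric_tensor_def mult.commute)

lemma lower_nabla:
  "(\<Sum>l\<in>UNIV. g i l * nX l k) = (\<Sum>l\<in>UNIV. g i l * dX k l)
    + (\<Sum>m\<in>UNIV. X v c [m] [] * (1/2 * (dg m i k + dg k i m - dg i k m)))"
proof -
  have "(\<Sum>l\<in>UNIV. g i l * (\<Sum>m\<in>UNIV. \<Gamma> l k m * X v c [m] [])) = (\<Sum>m\<in>UNIV. X v c [m] [] * (\<Sum>l\<in>UNIV. g i l * \<Gamma> l k m))"
    unfolding sum_distrib_left by (subst sum.swap) (simp add: mult_ac)
  then show ?thesis
    by (simp add: nabla_vector_field[OF v c] distrib_left sum.distrib lower_chern)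
qed

lemma delta_interior_metric:
  "delta M L c k (\<lambda>u. interior X (metric_tensor M A L) u c [] [i]) v
     = (\<Sum>l\<in>UNIV. g i l * dX k l) + (\<Sum>m\<in>UNIV. X v c [m] [] * dg k i m)"
proof -
  have "delta M L c k (\<lambda>u. \<Sum>l\<in>UNIV. X u c [l] [] * gmat M L c u $ l $ i) v
      = delta M L c k (\<lambda>u. interior X (metric_tensor M A L) u c [] [i]) v"
    by (rule delta_cong[OF v c])
       (auto intro!: smooth_in_sum smooth_in_mult smooth_in_tensor[OF X] smooth_in_gmat cM
         simp: interior_eq metric_tensor_def)
  moreover have "delta M L c k (\<lambda>u. \<Sum>l\<in>UNIV. X u c [l] [] * gmat M L c u $ l $ i) v
      = (\<Sum>l\<in>UNIV. dX k l * g l i + X v c [l] [] * dg k l i)"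
    by (simp add: delta_sum[OF v c] delta_mult[OF v c] smooth_in_mult[OF cM] smooth_in_tensor[OF X cM] smooth_in_gmat[OF cM])
  ultimately show ?thesis
    by (simp add: sum.distrib gmat_symmetric[OF v c, of _ i] dg_symmetric[of k _ i] mult.commute)
qed

text \<open>The symmetric part of \<open>\<nabla>X\<close> is the Lie derivative of the metric, the antisymmetric part is the exterior
  derivative of the one-form dual to \<open>X\<close>. Both are built from Lie brackets, which are tensor fields by
  assumption; hence no transformation law of the nonlinear connection or of \<open>\<Gamma>\<close> is needed.\<close>
lemma metric_nabla_eq_lie:
  assumes lie: "\<And>Z. Z \<in> tensor_fields M A 1 0 \<Longrightarrow> anisotropic_lie_bracket M A L Z (lie Z)"
    and Y: "Y \<in> tensor_fields M A 1 0" "\<And>l. Y v c [l] [] = y c $ l"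
    and W: "W \<in> tensor_fields M A 1 0" "\<And>l. W v c [l] [] = w c $ l"
  shows "2 * bilin c (metric_tensor M A L) v w (nabla_at M A L v y X)
    = interior W (interior Y (lie X (metric_tensor M A L))) v c [] []
      + interior W (lie Y (interior X (metric_tensor M A L))) v c [] []
      - lie W (interior Y (interior X (metric_tensor M A L))) v c [] []"
proof -
  let ?G = "metric_tensor M A L"
  let ?\<theta> = "interior X ?G"
  let ?d\<theta> = "\<lambda>k i. delta M L c k (\<lambda>u. ?\<theta> u c [] [i]) v"
  let ?P = "\<lambda>k i. \<Sum>l\<in>UNIV. g i l * nX l k"
  let ?y = "\<lambda>k. y c $ k" and ?w = "\<lambda>k. w c $ k" and ?dY = "\<lambda>k l. delta M L c k (\<lambda>u. Y u c [l] []) v"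
  have \<theta>: "?\<theta> \<in> tensor_fields M A 0 1"
    using metric_tensor_field by (intro interior_vector_field X) (simp add: numeral_2_eq_2)
  \<comment> \<open>In the antisymmetric part the derivatives of g in the direction of
    \<open>X\<close> drop out; the rest is the horizontal exterior derivative of the one-form dual
    to \<open>X\<close>.\<close>
  have "?d\<theta> k i - ?d\<theta> i k = ?P k i - ?P i k" for i k
  proof -
    have "(\<Sum>m\<in>UNIV. X v c [m] [] * (1/2 * (dg m i k + dg k i m - dg i k m)))
        - (\<Sum>m\<in>UNIV. X v c [m] [] * (1/2 * (dg m k i + dg i k m - dg k i m)))
        = (\<Sum>m\<in>UNIV. X v c [m] [] * dg k i m) - (\<Sum>m\<in>UNIV. X v c [m] [] * dg i k m)"
      unfolding sum_subtractf[symmetric]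
      by (rule sum.cong) (simp_all add: dg_symmetric[of _ k i] algebra_simps)
    then show ?thesis by (simp only: delta_interior_metric lower_nabla)
  qed
  \<comment> \<open>The Lie derivative of the metric is \<open>?P k i + ?P i k\<close>; adding the
    antisymmetric difference leaves twice \<open>?P k i\<close>.\<close>
  then have P: "lie X ?G v c [] [k, i] + ?d\<theta> k i - ?d\<theta> i k = 2 * ?P k i" for k i
    using lie_metric[OF lie[OF X], of k i] by (simp add: algebra_simps)
  \<comment> \<open>This term minus \<open>lie W (interior Y ?\<theta>)\<close> is the exterior
    derivative of \<open>?\<theta>\<close> on \<open>Y\<close> and \<open>W\<close>. The
    uncontrolled derivatives of \<open>Y\<close> occur in both and cancel.\<close>
  have "interior W (lie Y ?\<theta>) v c [] []
      = (\<Sum>i\<in>UNIV. \<Sum>k\<in>UNIV. ?w i * (?y k * ?d\<theta> k i)) + (\<Sum>i\<in>UNIV. \<Sum>l\<in>UNIV. ?w i * (?dY i l * ?\<theta> v c [] [l]))"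
    using lie_bracket_covariant[OF lie[OF Y(1)] Y(1) v c \<theta>]
    by (simp add: interior_eq[of W] W(2) Y(2) distrib_left sum.distrib sum_distrib_left)
  moreover have "lie W (interior Y ?\<theta>) v c [] []
      = (\<Sum>i\<in>UNIV. \<Sum>l\<in>UNIV. ?w i * (?dY i l * ?\<theta> v c [] [l])) + (\<Sum>i\<in>UNIV. \<Sum>k\<in>UNIV. ?w i * (?y k * ?d\<theta> i k))"
  proof -
    have "interior Y ?\<theta> \<in> tensor_fields M A 0 0" using interior_vector_field[OF Y(1)] \<theta> by simp
    from lie_bracket_covariant[OF lie[OF W(1)] W(1) v c this, of "[]"]
    have "lie W (interior Y ?\<theta>) v c [] [] = (\<Sum>i\<in>UNIV. ?w i * delta M L c i (\<lambda>u. interior Y ?\<theta> u c [] []) v)"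
      by (simp add: W(2))
    moreover have "delta M L c i (\<lambda>u. interior Y ?\<theta> u c [] []) v
        = (\<Sum>l\<in>UNIV. ?dY i l * ?\<theta> v c [] [l]) + (\<Sum>k\<in>UNIV. ?y k * ?d\<theta> i k)" for i
      unfolding interior_eq[of Y]
      by (simp add: delta_sum[OF v c] delta_mult[OF v c] smooth_in_mult[OF cM] smooth_in_tensor[OF Y(1) cM]
          smooth_in_tensor[OF \<theta> cM] sum.distrib Y(2))
    ultimately show ?thesis by (simp add: distrib_left sum.distrib sum_distrib_left)
  qed
  moreover have "interior W (interior Y (lie X ?G)) v c [] []
      = (\<Sum>i\<in>UNIV. \<Sum>k\<in>UNIV. ?w i * (?y k * lie X ?G v c [] [k, i]))"
    by (simp add: interior_eq[of W] interior_eq[of Y] W(2) Y(2) sum_distrib_left)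
  ultimately have "interior W (interior Y (lie X ?G)) v c [] [] + interior W (lie Y ?\<theta>) v c [] [] - lie W (interior Y ?\<theta>) v c [] []
     = (\<Sum>i\<in>UNIV. \<Sum>k\<in>UNIV. ?w i * (?y k * (lie X ?G v c [] [k, i] + ?d\<theta> k i - ?d\<theta> i k)))"
    by (simp add: distrib_left right_diff_distrib sum.distrib sum_subtractf)
  also have "\<dots> = 2 * (\<Sum>i\<in>UNIV. \<Sum>k\<in>UNIV. \<Sum>l\<in>UNIV. ?w i * (?y k * (g i l * nX l k)))"
    unfolding P by (simp add: sum_distrib_left mult_ac)
  also have "(\<Sum>i\<in>UNIV. \<Sum>k\<in>UNIV. \<Sum>l\<in>UNIV. ?w i * (?y k * (g i l * nX l k))) = bilin c ?G v w (nabla_at M A L v y X)"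
    unfolding bilin_def
    by (rule sum.cong[OF refl], subst sum.swap)
      (simp add: v c metric_tensor_def nabla_at_def sum_distrib_left mult_ac)
  finally show ?thesis by simp
qed

end

end

text \<open>For every tangent w, g(w, \<nabla>X(y)) is built from scalar fields and so has the same
  value in both charts. Comparing with the tangent vector \<open>z\<close> that has the same
  components in \<open>c\<close>, and testing against basis vectors in \<open>c'\<close>,
  nondegeneracy of g identifies the components in \<open>c'\<close>.\<close>

lemma nabla_at_tangent_space:
  assumes lie: "\<And>Z. Z \<in> tensor_fields M A 1 0 \<Longrightarrow> anisotropic_lie_bracket M A L Z (lie Z)"
    and X: "X \<in> tensor_fields M A 1 0" and v: "v \<in> A" and y: "y \<in> tangent_space M (fst v)"
  shows "nabla_at M A L v y X \<in> tangent_space M (fst v)"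
proof -
  let ?n = "nabla_at M A L v y X" and ?G = "metric_tensor M A L"
  have "?n c' = jac c c' (fst v) *v ?n c"
    if c: "c \<in> charts_at M (fst v)" and c': "c' \<in> charts_at M (fst v)" for c c'
  proof -
    obtain z where z: "z \<in> tangent_space M (fst v)" "z c = ?n c"
      using tangent_vector_exists[OF c] by blast
    have eq: "bilin c' ?G v w ?n = bilin c' ?G v w z" if w: "w \<in> tangent_space M (fst v)" for w
    proof -
      obtain Y where Y: "Y \<in> tensor_fields M A 1 0" "\<And>c l. c \<in> charts_at M (fst v) \<Longrightarrow> Y v c [l] [] = y c $ l"
        using tangent_vector_extension[OF v y c] by blast
      obtain W where W: "W \<in> tensor_fields M A 1 0" "\<And>c l. c \<in> charts_at M (fst v) \<Longrightarrow> W v c [l] [] = w c $ l"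
        using tangent_vector_extension[OF v w c] by blast
      have G: "?G \<in> tensor_fields M A 0 (Suc (Suc 0))"
        using metric_tensor_field by (simp add: numeral_2_eq_2)
      have "interior W (interior Y (lie X ?G)) \<in> tensor_fields M A 0 0"
        "interior W (lie Y (interior X ?G)) \<in> tensor_fields M A 0 0"
        "lie W (interior Y (interior X ?G)) \<in> tensor_fields M A 0 0"
        by (intro interior_vector_field anisotropic_lie_bracket_field[OF lie] X Y(1) W(1) G)+
      from this[THEN scalar_transform[OF _ v c c']]
      have "bilin c' ?G v w ?n = bilin c ?G v w ?n"
        using metric_nabla_eq_lie[where y = y and w = w, OF v c X lie Y(1) Y(2)[OF c] W(1) W(2)[OF c]]
          metric_nabla_eq_lie[where y = y and w = w, OF v c' X lie Y(1) Y(2)[OF c'] W(1) W(2)[OF c']] by simp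
      also have "\<dots> = bilin c ?G v w z" by (simp add: bilin_def z(2))
      also have "\<dots> = bilin c' ?G v w z"
        using bilin_transform[OF metric_tensor_field v w z(1) c' c] .
      finally show ?thesis .
    qed
    have "(gmat M L c' v *v ?n c') $ i = (gmat M L c' v *v z c') $ i" for i
    proof -
      obtain w where w: "w \<in> tangent_space M (fst v)" "w c' = axis i 1"
        using tangent_vector_exists[OF c'] by blast
      have "bilin c' ?G v w u = (gmat M L c' v *v u c') $ i" for u
        using v c' by (simp add: bilin_axis_left[of w, OF w(2)] metric_tensor_def matrix_vector_mult_def)
      with eq[OF w(1)] show ?thesis by metis
    qed
    then have "gmat M L c' v *v ?n c' = gmat M L c' v *v z c'"
      by (simp add: vec_eq_iff)
    then have "ginv M L c' v *v (gmat M L c' v *v ?n c') = ginv M L c' v *v (gmat M L c' v *v z c')"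
      by simp
    then have "?n c' = z c'"
      by (simp add: matrix_vector_mul_assoc ginv_inverse[OF v c'])
    also have "\<dots> = jac c c' (fst v) *v ?n c"
      using tangent_transform[OF z(1) c c'] z(2) by simp
    finally show ?thesis .
  qed
  moreover have "?n c = 0" if "c \<notin> charts_at M (fst v)" for c
    using that by (simp add: nabla_at_def nabla_def vec_eq_iff)
  ultimately show ?thesis unfolding tangent_space_def by blast
qed

text \<open>Collects the two insertions of \<nabla>X into one bilinear form whose coefficients are
  exactly those of the Lie bracket minus the covariant derivative.\<close>

lemma bilin_nabla:
  fixes c :: "('m, 'n) chart"
  shows "bilin c S v (nabla_at M A L v y X) w + bilin c S v y (nabla_at M A L v w X)
    = (\<Sum>i\<in>UNIV. \<Sum>j\<in>UNIV. ((\<Sum>l\<in>UNIV. nabla M A L X v c [l] [i] * S v c [] [l, j])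
        + (\<Sum>l\<in>UNIV. nabla M A L X v c [l] [j] * S v c [] [i, l])) * y c $ i * w c $ j)"
proof -
  let ?N = "\<lambda>l i. nabla M A L X v c [l] [i]" and ?S = "\<lambda>i j. S v c [] [i, j]"
  have "bilin c S v (nabla_at M A L v y X) w = (\<Sum>l\<in>UNIV. \<Sum>j\<in>UNIV. \<Sum>i\<in>UNIV. ?N l i * ?S l j * y c $ i * w c $ j)"
    by (simp add: bilin_def nabla_at_def sum_distrib_left sum_distrib_right mult_ac)
  also have "\<dots> = (\<Sum>l\<in>UNIV. \<Sum>i\<in>UNIV. \<Sum>j\<in>UNIV. ?N l i * ?S l j * y c $ i * w c $ j)"
    by (intro sum.cong refl sum.swap)
  also have "\<dots> = (\<Sum>i\<in>UNIV. \<Sum>l\<in>UNIV. \<Sum>j\<in>UNIV. ?N l i * ?S l j * y c $ i * w c $ j)"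
    by (rule sum.swap)
  also have "\<dots> = (\<Sum>i\<in>UNIV. \<Sum>j\<in>UNIV. \<Sum>l\<in>UNIV. ?N l i * ?S l j * y c $ i * w c $ j)"
    by (intro sum.cong refl sum.swap)
  finally have 1: "bilin c S v (nabla_at M A L v y X) w
    = (\<Sum>i\<in>UNIV. \<Sum>j\<in>UNIV. \<Sum>l\<in>UNIV. ?N l i * ?S l j * y c $ i * w c $ j)" .
  have "bilin c S v y (nabla_at M A L v w X) = (\<Sum>i\<in>UNIV. \<Sum>l\<in>UNIV. \<Sum>j\<in>UNIV. ?N l j * ?S i l * y c $ i * w c $ j)"
    by (simp add: bilin_def nabla_at_def sum_distrib_left sum_distrib_right mult_ac)
  also have "\<dots> = (\<Sum>i\<in>UNIV. \<Sum>j\<in>UNIV. \<Sum>l\<in>UNIV. ?N l j * ?S i l * y c $ i * w c $ j)"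
    by (intro sum.cong refl sum.swap)
  finally have 2: "bilin c S v y (nabla_at M A L v w X)
    = (\<Sum>i\<in>UNIV. \<Sum>j\<in>UNIV. \<Sum>l\<in>UNIV. ?N l j * ?S i l * y c $ i * w c $ j)" .
  show ?thesis
    unfolding 1 2 by (simp add: sum.distrib distrib_right sum_distrib_right)
qed

text \<open>From right to left the chart \<open>c\<close> is enough. From left to right the
  antisymmetry must be carried from \<open>c\<close> to every other chart, which is possible because
  \<nabla>X has tangent values at \<open>v\<close>; basis vectors then isolate single
  components.\<close>

lemma anti_self_adjoint_iff_lie_eq_nabla:
  assumes lie: "\<And>Z. Z \<in> tensor_fields M A 1 0 \<Longrightarrow> anisotropic_lie_bracket M A L Z (lie Z)"
    and X: "X \<in> tensor_fields M A 1 0" and S: "S \<in> tensor_fields M A 0 2"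
    and v: "v \<in> A" and c: "c \<in> charts_at M (fst v)"
  shows "(\<forall>y\<in>tangent_space M (fst v). \<forall>w\<in>tangent_space M (fst v).
      bilin c S v (nabla_at M A L v y X) w = - bilin c S v y (nabla_at M A L v w X))
    \<longleftrightarrow> lie X S v = nabla_along M A L X S v" (is "?anti \<longleftrightarrow> ?eq")
proof
  assume ?eq
  then have "(\<Sum>l\<in>UNIV. nabla M A L X v c [l] [i] * S v c [] [l, j])
      + (\<Sum>l\<in>UNIV. nabla M A L X v c [l] [j] * S v c [] [i, l]) = 0" for i j
    using lie_minus_nabla[OF v c X lie[OF X] S, of i j] by simp
  then have "bilin c S v (nabla_at M A L v y X) w + bilin c S v y (nabla_at M A L v w X) = 0" for y w
    unfolding bilin_nabla by simp
  then show ?anti by (simp add: eq_neg_iff_add_eq_0)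
next
  assume anti: ?anti
  show ?eq
  proof (intro ext)
    fix c' I J
    show "lie X S v c' I J = nabla_along M A L X S v c' I J"
    proof (cases "c' \<in> charts_at M (fst v) \<and> length I = 0 \<and> length J = 2")
      \<comment> \<open>Outside the range of genuine components both sides are 0 by
        convention.\<close>
      case False
      then show ?thesis
        using nabla_along_zero[OF S, of v c' I J]
          tensor_fields_zero[OF anisotropic_lie_bracket_field[OF lie[OF X] S], of v c' I J] by auto
    next
      case True
      then have c': "c' \<in> charts_at M (fst v)" by blast
      obtain i j where J: "J = [i, j]" using True by (auto simp: length_Suc_conv numeral_2_eq_2)
      obtain y where y: "y \<in> tangent_space M (fst v)" "y c' = axis i 1"
        using tangent_vector_exists[OF c'] by blast
      obtain w where w: "w \<in> tangent_space M (fst v)" "w c' = axis j 1"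
        using tangent_vector_exists[OF c'] by blast
      have "bilin c' S v (nabla_at M A L v y X) w + bilin c' S v y (nabla_at M A L v w X)
          = bilin c S v (nabla_at M A L v y X) w + bilin c S v y (nabla_at M A L v w X)"
        using y(1) w(1) nabla_at_tangent_space[OF lie X v] bilin_transform[OF S v _ _ c c'] by simp
      also have "\<dots> = 0" using anti y(1) w(1) by simp
      finally have "(\<Sum>a\<in>UNIV. \<Sum>b\<in>UNIV. ((\<Sum>l\<in>UNIV. nabla M A L X v c' [l] [a] * S v c' [] [l, b])
        + (\<Sum>l\<in>UNIV. nabla M A L X v c' [l] [b] * S v c' [] [a, l])) * axis i 1 $ a * axis j 1 $ b) = 0"
        unfolding bilin_nabla y(2) w(2) .
      then have "(\<Sum>l\<in>UNIV. nabla M A L X v c' [l] [i] * S v c' [] [l, j])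
        + (\<Sum>l\<in>UNIV. nabla M A L X v c' [l] [j] * S v c' [] [i, l]) = 0"
        by (simp add: axis_def if_distrib[of "\<lambda>x. _ * x"] cong: if_cong)
      then show ?thesis
        using lie_minus_nabla[OF v c' X lie[OF X] S, of i j] True J by simp
    qed
  qed
qed

section \<open>Vanishing of the trace of T(\<nabla>X)\<close>

lemma trace_T_nabla_eq:
  "trace_T_nabla M A L c T X v = trace ((\<chi> i j. T v c [i] [j]) ** nabla_mat L X c v)"
  by (simp add: trace_T_nabla_def nabla_mat_def matrix_matrix_mult_def)

lemma flat_eq:
  assumes "v \<in> A" "c \<in> charts_at M (fst v)"
  shows "flat M A L T v c [] [i, j] = (gmat M L c v ** (\<chi> i j. T v c [i] [j])) $ i $ j"
  using assms by (simp add: flat_def metric_tensor_def matrix_matrix_mult_def)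

text \<open>The matrix \<open>?Q\<close> of the bilinear form is antisymmetric, and multiplying it
  by the symmetric inverse metric gives back the matrix of T(\<nabla>X).\<close>

lemma trace_T_nabla_zero_if_antisymmetric:
  assumes v: "v \<in> A" and c: "c \<in> charts_at M (fst v)"
    and anti: "\<forall>y\<in>tangent_space M (fst v). \<forall>w\<in>tangent_space M (fst v).
      bilin c (flat M A L T) v y (nabla_at M A L v w X) = - bilin c (flat M A L T) v w (nabla_at M A L v y X)"
  shows "trace_T_nabla M A L c T X v = 0"
proof -
  let ?T = "(\<chi> i j. T v c [i] [j]) :: ((real, 'n) vec, 'n) vec" and ?N = "nabla_mat L X c v"
  let ?G = "gmat M L c v" and ?H = "ginv M L c v"
  let ?Q = "?G ** ?T ** ?N"
  have "?Q $ i $ j = - ?Q $ j $ i" for i j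
  proof -
    obtain y where y: "y \<in> tangent_space M (fst v)" "y c = axis i 1"
      using tangent_vector_exists[OF c] by blast
    obtain w where w: "w \<in> tangent_space M (fst v)" "w c = axis j 1"
      using tangent_vector_exists[OF c] by blast
    have "bilin c (flat M A L T) v a (nabla_at M A L v b X) = ?Q $ k $ l"
      if "a c = axis k 1" "b c = axis l 1" for a b k l
      by (simp add: bilin_axis_left[of a, OF that(1)] flat_eq[OF v c] nabla_at_eq that(2)
          matrix_vector_mult_basis column_def matrix_matrix_mult_def[of _ ?N])
    then show ?thesis using anti y w by metis
  qed
  then have "transpose ?Q = - ?Q" by (rule transpose_eq_uminusI)
  from trace_symmetric_antisymmetric[OF transpose_ginv[OF v c] this]
  show ?thesis by (simp add: trace_T_nabla_eq matrix_mul_assoc ginv_inverse[OF v c])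
qed

text \<open>With G the metric, H its inverse and N the matrix of \<nabla>X, one has T N = (H (G T)
  H) (G N). The first factor is symmetric because G T and H are, the second is antisymmetric by the
  Killing condition.\<close>

lemma trace_T_nabla_zero_if_killing:
  assumes v: "v \<in> A" and c: "c \<in> charts_at M (fst v)"
    and D: "anisotropic_lie_bracket M A L X D" and X: "X \<in> tensor_fields M A 1 0"
    and sym: "\<forall>y\<in>tangent_space M (fst v). \<forall>w\<in>tangent_space M (fst v).
      bilin c (flat M A L T) v y w = bilin c (flat M A L T) v w y"
    and killing: "D (metric_tensor M A L) v = (\<lambda>c I J. 0)"
  shows "trace_T_nabla M A L c T X v = 0"
proof -
  let ?T = "(\<chi> i j. T v c [i] [j]) :: ((real, 'n) vec, 'n) vec" and ?N = "nabla_mat L X c v"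
  let ?G = "gmat M L c v" and ?H = "ginv M L c v"
  have "(?G ** ?T) $ i $ j = (?G ** ?T) $ j $ i" for i j
  proof -
    obtain y where y: "y \<in> tangent_space M (fst v)" "y c = axis i 1"
      using tangent_vector_exists[OF c] by blast
    obtain w where w: "w \<in> tangent_space M (fst v)" "w c = axis j 1"
      using tangent_vector_exists[OF c] by blast
    show ?thesis
      using sym y w bilin_axis[of y c i w j "flat M A L T" v] bilin_axis[of w c j y i "flat M A L T" v]
      by (simp add: flat_eq[OF v c])
  qed
  then have "transpose (?G ** ?T) = ?G ** ?T" by (simp add: vec_eq_iff transpose_def)
  then have "transpose (?H ** (?G ** ?T) ** ?H) = ?H ** (?G ** ?T) ** ?H"
    by (simp only: matrix_transpose_mul transpose_ginv[OF v c] matrix_mul_assoc)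
  moreover have "transpose (?G ** ?N) = - (?G ** ?N)"
    using lie_metric[OF v c X D] killing
    by (simp add: vec_eq_iff transpose_def matrix_matrix_mult_def nabla_mat_def eq_neg_iff_add_eq_0)
  ultimately have "trace (?H ** (?G ** ?T) ** ?H ** (?G ** ?N)) = 0"
    by (rule trace_symmetric_antisymmetric)
  moreover have "?H ** (?G ** ?T) ** ?H ** (?G ** ?N) = (?H ** ?G) ** ?T ** ((?H ** ?G) ** ?N)"
    by (simp only: matrix_mul_assoc)
  ultimately show ?thesis by (simp add: trace_T_nabla_eq ginv_inverse[OF v c])
qed

end

section \<open>The divergence of T(X)\<close>

context ordered_pseudo_finsler_manifold
begin

text \<open>The horizontal derivatives of \<open>X\<close> occur in the divergence and in the trace
  and cancel. The symbols left from the divergence belong to the upper index of \<nabla>T, those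
  from the trace, with a minus sign, to its lower index.\<close>

lemma divergence_endo_apply:
  assumes lie: "\<And>Z. Z \<in> tensor_fields M A 1 0 \<Longrightarrow> anisotropic_lie_bracket M A L Z (lie Z)"
    and T: "T \<in> tensor_fields M A 1 1" and X: "X \<in> tensor_fields M A 1 0"
    and v: "v \<in> A" and c: "c \<in> charts_at M (fst v)"
  shows "divergence M A L lie (endo_apply T X) v - trace_T_nabla M A L c T X v
    = pairing c (contract 0 1 (nabla M A L T)) X v"
proof -
  note cM = charts_atD(1)[OF c]
  let ?t = "\<lambda>i j. T v c [i] [j]" and ?x = "\<lambda>j. X v c [j] []" and ?\<Gamma> = "chern M L c v"
  let ?dt = "\<lambda>i j. delta M L c i (\<lambda>u. T u c [i] [j]) v" and ?dx = "\<lambda>i j. delta M L c i (\<lambda>u. X u c [j] []) v"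
  have "delta M L c l (\<lambda>u. endo_apply T X u c [l] []) v = (\<Sum>j\<in>UNIV. ?dt l j * ?x j) + (\<Sum>j\<in>UNIV. ?t l j * ?dx l j)" for l
    by (simp add: endo_apply_def delta_sum[OF v c] delta_mult[OF v c] smooth_in_mult[OF cM]
        smooth_in_tensor[OF T cM] smooth_in_tensor[OF X cM] sum.distrib)
  then have div: "divergence M A L lie (endo_apply T X) v
      = (\<Sum>k\<in>UNIV. (\<Sum>j\<in>UNIV. ?t k j * ?x j) * (\<Sum>i\<in>UNIV. ?\<Gamma> i i k))
        + ((\<Sum>l\<in>UNIV. \<Sum>j\<in>UNIV. ?dt l j * ?x j) + (\<Sum>l\<in>UNIV. \<Sum>j\<in>UNIV. ?t l j * ?dx l j))"
    using divergence_eq[where lie = lie, OF lie[OF endo_apply_vector_field[OF T X]] endo_apply_vector_field[OF T X] v c]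
    by (simp add: chern_trace[OF v c] endo_apply_def[of T X v] sum.distrib)
  have tr: "trace_T_nabla M A L c T X v = (\<Sum>i\<in>UNIV. \<Sum>j\<in>UNIV. ?t i j * ?dx i j)
      + (\<Sum>i\<in>UNIV. \<Sum>j\<in>UNIV. \<Sum>l\<in>UNIV. ?t i j * (?\<Gamma> j i l * ?x l))"
    by (simp add: trace_T_nabla_def trace_def nabla_vector_field[OF v c] distrib_left sum.distrib sum_distrib_left)
  \<comment> \<open>The index introduced by \<nabla> comes last, in covariant slot 1 counted from 0;
    \<open>contract 0 1\<close> sets it equal to the upper index.\<close>
  have "nabla M A L T v c [i] [j, i] = ?dt i j + (\<Sum>l\<in>UNIV. ?\<Gamma> i i l * ?t l j) - (\<Sum>l\<in>UNIV. ?\<Gamma> l i j * ?t i l)" for i j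
    using v c by (simp add: nabla_def Let_def)
  then have "pairing c (contract 0 1 (nabla M A L T)) X v
      = (\<Sum>j\<in>UNIV. \<Sum>i\<in>UNIV. ?dt i j * ?x j) + (\<Sum>j\<in>UNIV. \<Sum>i\<in>UNIV. \<Sum>l\<in>UNIV. ?\<Gamma> i i l * ?t l j * ?x j)
        - (\<Sum>j\<in>UNIV. \<Sum>i\<in>UNIV. \<Sum>l\<in>UNIV. ?\<Gamma> l i j * ?t i l * ?x j)"
    by (simp add: pairing_def contract_def sum_distrib_right distrib_right left_diff_distrib sum.distrib sum_subtractf)
  moreover have "(\<Sum>j\<in>UNIV. \<Sum>i\<in>UNIV. ?dt i j * ?x j) = (\<Sum>l\<in>UNIV. \<Sum>j\<in>UNIV. ?dt l j * ?x j)"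
    by (rule sum.swap)
  moreover have "(\<Sum>j\<in>UNIV. \<Sum>i\<in>UNIV. \<Sum>l\<in>UNIV. ?\<Gamma> i i l * ?t l j * ?x j)
      = (\<Sum>k\<in>UNIV. (\<Sum>j\<in>UNIV. ?t k j * ?x j) * (\<Sum>i\<in>UNIV. ?\<Gamma> i i k))"
  proof -
    have "(\<Sum>j\<in>UNIV. \<Sum>i\<in>UNIV. \<Sum>l\<in>UNIV. ?\<Gamma> i i l * ?t l j * ?x j)
        = (\<Sum>j\<in>UNIV. \<Sum>l\<in>UNIV. \<Sum>i\<in>UNIV. ?\<Gamma> i i l * ?t l j * ?x j)"
      by (intro sum.cong refl sum.swap)
    also have "\<dots> = (\<Sum>l\<in>UNIV. \<Sum>j\<in>UNIV. \<Sum>i\<in>UNIV. ?\<Gamma> i i l * ?t l j * ?x j)"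
      by (rule sum.swap)
    finally show ?thesis by (simp add: sum_distrib_left sum_distrib_right mult_ac)
  qed
  moreover have "(\<Sum>j\<in>UNIV. \<Sum>i\<in>UNIV. \<Sum>l\<in>UNIV. ?\<Gamma> l i j * ?t i l * ?x j)
      = (\<Sum>i\<in>UNIV. \<Sum>j\<in>UNIV. \<Sum>l\<in>UNIV. ?t i j * (?\<Gamma> j i l * ?x l))"
  proof -
    have "(\<Sum>j\<in>UNIV. \<Sum>i\<in>UNIV. \<Sum>l\<in>UNIV. ?\<Gamma> l i j * ?t i l * ?x j)
        = (\<Sum>i\<in>UNIV. \<Sum>j\<in>UNIV. \<Sum>l\<in>UNIV. ?\<Gamma> l i j * ?t i l * ?x j)"
      by (rule sum.swap)
    also have "\<dots> = (\<Sum>i\<in>UNIV. \<Sum>l\<in>UNIV. \<Sum>j\<in>UNIV. ?\<Gamma> l i j * ?t i l * ?x j)"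
      by (intro sum.cong refl sum.swap)
    finally show ?thesis by (simp add: mult_ac)
  qed
  ultimately show ?thesis unfolding div tr by simp
qed

end

theorem proposition5p1:
  fixes M :: "('m::{t2_space,second_countable_topology}, 'n::{finite,linorder}) chart set"
    and A :: "('m, 'n) tbundle set"
    and L :: "('m, 'n) tbundle \<Rightarrow> real"
    and lie :: "('m, 'n) tensor \<Rightarrow> ('m, 'n) tensor \<Rightarrow> ('m, 'n) tensor"
    and S T X :: "('m, 'n) tensor"
    and v :: "('m, 'n) tbundle"
  assumes "CARD('n) \<ge> 2"
    and "connected (UNIV :: 'm set)"
    and "oriented_atlas M"
    and "conic_domain M A"
    and "pseudo_finsler M A L"
    and "\<And>Z. Z \<in> tensor_fields M A 1 0 \<Longrightarrow> anisotropic_lie_bracket M A L Z (lie Z)"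
    and "S \<in> tensor_fields M A 0 2"
    and "\<And>u c i j. u \<in> A \<Longrightarrow> c \<in> charts_at M (fst u) \<Longrightarrow> S u c [] [i, j] = S u c [] [j, i]"
    and "v \<in> A"
    and "T \<in> tensor_fields M A 1 1"
    and "X \<in> tensor_fields M A 1 0"
  shows
    "(\<forall>c\<in>charts_at M (fst v).
       ((\<forall>y\<in>tangent_space M (fst v). \<forall>w\<in>tangent_space M (fst v).
           bilin c S v y (nabla_at M A L v w X) = - bilin c S v w (nabla_at M A L v y X))
        \<longleftrightarrow>
        (\<forall>y\<in>tangent_space M (fst v). \<forall>w\<in>tangent_space M (fst v).
           bilin c S v (nabla_at M A L v y X) w = - bilin c S v y (nabla_at M A L v w X)))
       \<and>
       ((\<forall>y\<in>tangent_space M (fst v). \<forall>w\<in>tangent_space M (fst v).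
           bilin c S v (nabla_at M A L v y X) w = - bilin c S v y (nabla_at M A L v w X))
        \<longleftrightarrow>
        lie X S v = nabla_along M A L X S v))
     \<and>
     (\<forall>u\<in>A. \<forall>c\<in>charts_at M (fst u).
        divergence M A L lie (endo_apply T X) u - trace_T_nabla M A L c T X u
          = pairing c (contract 0 1 (nabla M A L T)) X u)
     \<and>
     (\<forall>c\<in>charts_at M (fst v).
        (\<forall>y\<in>tangent_space M (fst v). \<forall>w\<in>tangent_space M (fst v).
           bilin c (flat M A L T) v y (nabla_at M A L v w X)
             = - bilin c (flat M A L T) v w (nabla_at M A L v y X))
        \<or>
        (\<forall>y\<in>tangent_space M (fst v). \<forall>w\<in>tangent_space M (fst v).
           bilin c (flat M A L T) v y w = bilin c (flat M A L T) v w y)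
          \<and> lie X (metric_tensor M A L) v = (\<lambda>c I J. 0)
        \<longrightarrow> trace_T_nabla M A L c T X v = 0)"
proof -
  interpret ordered_pseudo_finsler_manifold M A L
    using assms by unfold_locales auto
  note lie = assms(6) and S = assms(7) and v = assms(9) and T = assms(10) and X = assms(11)
  have anti: "(\<forall>y\<in>tangent_space M (fst v). \<forall>w\<in>tangent_space M (fst v).
         bilin c S v y (nabla_at M A L v w X) = - bilin c S v w (nabla_at M A L v y X))
      \<longleftrightarrow> (\<forall>y\<in>tangent_space M (fst v). \<forall>w\<in>tangent_space M (fst v).
         bilin c S v (nabla_at M A L v y X) w = - bilin c S v y (nabla_at M A L v w X))"
    if c: "c \<in> charts_at M (fst v)" for c
  proof -
    \<comment> \<open>Symmetry moves \<nabla>X into the second slot; the two conditions then differ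
      only in which side carries the minus sign.\<close>
    have sym: "bilin c S v y w = bilin c S v w y" for y w
      unfolding bilin_def using assms(8)[OF v c] by (subst sum.swap) (simp add: mult_ac)
    show ?thesis unfolding sym[of "nabla_at M A L v _ X"] by (metis minus_minus)
  qed
  show ?thesis
    using anti anti_self_adjoint_iff_lie_eq_nabla[OF lie X S v] divergence_endo_apply[OF lie T X]
      trace_T_nabla_zero_if_antisymmetric[OF v] trace_T_nabla_zero_if_killing[OF v _ lie[OF X] X]
    by blast
qed


end
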